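(* Let $T$ be a linear operator on $\mathcal S(\mathcal H)$ with $\Lambda$-linear extension $\mathrm T$ on $\mathcal S^\Lambda(\mathcal H)$, and let $\mathrm T_{\mathcal F}$ be its representation on $\mathcal F^\Lambda(\mathcal H_\Lambda^D)$. Then for any $\varphi\in\mathcal F^\Lambda(\mathcal H_\Lambda^D)$ and any $\eta\in\mathcal H^D_\Lambda$, $$(\mathrm T_{\mathcal F}\varphi)(\eta)=\langle K_T(\cdot,\eta)\,\|\,\varphi\rangle,$$ where the kernel $K_T:\mathcal H_\Lambda^D\times\mathcal H_\Lambda^D\to\Lambda$ is given by $$K_T(\zeta_1,\zeta_2):=\langle\mathrm T\exp\zeta_1\mid\exp\zeta_2\rangle=\langle\exp\zeta_1\mid\mathrm T'\exp\zeta_2\rangle=(\exp\zeta_1\mid\mathrm T'\exp\zeta_2).$$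
   Context: Fock space. $\mathcal H=\mathcal H_{\bar0}\oplus\mathcal H_{\bar1}$ is a $\mathbb Z_2$-graded complex separable Hilbert space (inner product antilinear in the first argument), $\mathcal H_{\bar k}=\mathcal E_{\bar k}\oplus\mathcal E_{\bar k}^*$, with an antiunitary involution $f\mapsto f^*$, $f^{**}=f$, exchanging $\mathcal E_{\bar k}$ and its dual $\mathcal E_{\bar k}^*$. Parity: $\pi(f)=k$ for $0\ne f\in\mathcal H_{\bar k}$. Let $P^{(n)}f_1\otimes\cdots\otimes f_n=\frac1{n!}\sum_\sigma\chi_\sigma f_{\sigma(1)}\otimes\cdots\otimes f_{\sigma(n)}$ for vectors of definite parity, where $\chi_\sigma=(-1)^{N_\sigma}$, $N_\sigma$ the number of pairs $i<j$ with $\sigma(i)>\sigma(j)$ and $\pi(f_{\sigma(i)})=\pi(f_{\sigma(j)})=1$; it extends to a projection. $\mathcal H^{\odot n}=P^{(n)}\mathcal H^{\otimes n}$, $\mathcal S_{fin}(\mathcal H)=\bigoplus_n\mathcal H^{\odot n}$ with product $F\odot G=\sqrt{\frac{(p+q)!}{p!q!}}P^{(p+q)}F\otimes G$ ($F\in\mathcal H^{\odot p}$, $G\in\mathcal H^{\odot q}$), norm inherited from $\|f_1\otimes\cdots\otimes f_n\|_n=\prod\|f_a\|$, $\|F\|^2=\sum_n\|F_n\|_n^2$; its completion is $\mathcal S(\mathcal H)$. The involution extends to an isometric antilinear involution of $\mathcal S(\mathcal H)$ with $(F\odot G)^*=G^*\odot F^*$, and $\langle F\mid G\rangle:=(F^*\mid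 G)$. Grassmann extension. $\Lambda$ is the completion of the antisymmetric tensor algebra over a separable infinite-dimensional complex Hilbert space $\Lambda_1$, $\Lambda=\bigoplus_p\Lambda_p$, unit $\kappa_0$, product $\lambda\mu=\sqrt{\frac{(p+q)!}{p!q!}}\mathrm{Alt}(\lambda\otimes\mu)$ for $\lambda\in\Lambda_p,\mu\in\Lambda_q$ ($\mathrm{Alt}$ = antisymmetrizing projection), norm $\|\lambda\|_\Lambda^2=\sum_p(p!)^{-2}\|\lambda_p\|_p^2$, and a parity-conserving isometric antilinear involution with $(\lambda\mu)^*=\mu^*\lambda^*$; $\Lambda_{\bar0},\Lambda_{\bar1}$ are the even and odd parts. $\mathcal S^\Lambda(\mathcal H)=\Lambda\widehat\otimes\mathcal S(\mathcal H)$ (Hilbert tensor product), with $(\lambda_1\otimes F_1)(\lambda_2\otimes F_2)=\lambda_1\lambda_2\otimes(F_1\odot F_2)$ where defined, $(\lambda\otimes F)^*=\lambda^*\otimes F^*$, the continuous $\Lambda$-valued bilinear form $\langle\lambda_1\otimes F_1\mid\lambda_2\otimes F_2\rangle=\lambda_1\lambda_2\langle F_1\mid F_2\rangle$ and the sesquilinear form $(\Xi_1\mid\Xi_2)=\langle\Xi_1^*\mid\Xi_2\rangle$. $\mathcal H_\Lambda=(\Lambda_{\bar0}\widehat\otimes\mathcal H_{\bar0})\oplus(\Lambda_{\bar1}\widehat\otimes\mathcal H_{\bar1})$, $\exp\zeta=\sum_p\frac1{p!}\zeta^p\in\mathcal S^\Lambda(\mathcal H)$ for $\zeta\in\mathcal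 H_\Lambda$, and $\mathcal H_\Lambda^D=\{\zeta\in\mathcal H_\Lambda:\zeta^*=\zeta\}$. Function space. $\Upsilon:\Xi\mapsto\varphi_\Xi$, $\varphi_\Xi(\zeta)=\langle\exp\zeta\mid\Xi\rangle$ ($\zeta\in\mathcal H_\Lambda^D$), is injective on $\mathcal S^\Lambda(\mathcal H)$ with image $\mathcal F^\Lambda(\mathcal H_\Lambda^D)$; $\langle\varphi_\Xi\,\|\,\varphi_{\mathrm H}\rangle:=\langle\Xi\mid\mathrm H\rangle\in\Lambda$. Operators. $\mathrm T(\lambda\otimes F)=\lambda\otimes TF$; $T'$ is the transposed operator, $\langle T'F\mid G\rangle=\langle F\mid TG\rangle$ for $F,G\in\mathcal S(\mathcal H)$, and $\mathrm T'$ its $\Lambda$-extension, which satisfies $\langle\mathrm T'\Xi\mid\mathrm H\rangle=\langle\Xi\mid\mathrm T\mathrm H\rangle$; $\mathrm T_{\mathcal F}$ is defined by $\mathrm T_{\mathcal F}\Upsilon=\Upsilon\mathrm T$. *)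

theory Defs
  imports
    "HOL-Analysis.Analysis"
    "HOL-Library.Z2"
    "HOL-Library.FuncSet"
    "HOL-Combinatorics.Permutations"
begin

section \<open>Complex Hilbert spaces\<close>

text \<open>
  The norm and the topology come from the underlying real inner product \<open>Re (cinner x y)\<close>;
  \<open>cinner\<close> is antilinear in its first argument.  Separability is expressed by the additional
  sort \<open>second_countable_topology\<close>.
\<close>

class complex_hilbert = real_inner + complete_space +
  fixes scaleC :: "complex \<Rightarrow> 'a \<Rightarrow> 'a"  (infixr "*\<^sub>C" 75)
    and cinner :: "'a \<Rightarrow> 'a \<Rightarrow> complex"
  assumes scaleC_add_right: "a *\<^sub>C (x + y) = a *\<^sub>C x + a *\<^sub>C y"
    and scaleC_add_left: "(a + b) *\<^sub>C x = a *\<^sub>C x + b *\<^sub>C x"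
    and scaleC_scaleC: "a *\<^sub>C b *\<^sub>C x = (a * b) *\<^sub>C x"
    and scaleR_scaleC: "r *\<^sub>R x = complex_of_real r *\<^sub>C x"
    and cinner_add_right: "cinner x (y + z) = cinner x y + cinner x z"
    and cinner_scaleC_right: "cinner x (a *\<^sub>C y) = a * cinner x y"
    and cinner_commute: "cinner x y = cnj (cinner y x)"
    and inner_cinner: "inner x y = Re (cinner x y)"

definition closed_csubspace :: "'a::complex_hilbert set \<Rightarrow> bool" where
  "closed_csubspace V \<longleftrightarrow> closed V \<and> 0 \<in> V \<and>
     (\<forall>x\<in>V. \<forall>y\<in>V. x + y \<in> V) \<and> (\<forall>c. \<forall>x\<in>V. c *\<^sub>C x \<in> V)"

definition orth_sum :: "'a::complex_hilbert set \<Rightarrow> 'a set \<Rightarrow> 'a set \<Rightarrow> bool" where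
  "orth_sum A B C \<longleftrightarrow> (\<forall>a\<in>A. \<forall>b\<in>B. cinner a b = 0) \<and> C = {a + b | a b. a \<in> A \<and> b \<in> B}"

definition antiunitary_involution :: "('a::complex_hilbert \<Rightarrow> 'a) \<Rightarrow> bool" where
  "antiunitary_involution J \<longleftrightarrow>
     (\<forall>x y. J (x + y) = J x + J y) \<and> (\<forall>c x. J (c *\<^sub>C x) = cnj c *\<^sub>C J x) \<and>
     (\<forall>x. J (J x) = x) \<and> (\<forall>x y. cinner (J x) (J y) = cnj (cinner x y))"

definition infinite_dimensional :: "'a::complex_hilbert itself \<Rightarrow> bool" where
  "infinite_dimensional _ \<longleftrightarrow> (\<nexists>A. finite A \<and> module.span scaleC A = (UNIV :: 'a set))"

definition is_onb :: "'a::complex_hilbert set \<Rightarrow> bool" where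
  "is_onb B \<longleftrightarrow> (\<forall>b\<in>B. \<forall>c\<in>B. cinner b c = (if b = c then 1 else 0)) \<and>
     (\<forall>x. (\<forall>b\<in>B. cinner b x = 0) \<longrightarrow> x = 0)"

definition onb :: "'a::complex_hilbert set" where
  "onb = (SOME B. is_onb B)"

text \<open>
  The involution is written \<open>J\<close>, so that \<open>J ` E k\<close> is the dual of \<open>E k\<close>; \<open>H k\<close> is the part
  of parity \<open>k\<close> and the whole type is the Hilbert space.
\<close>

definition super_hilbert ::
    "(bit \<Rightarrow> 'h::complex_hilbert set) \<Rightarrow> (bit \<Rightarrow> 'h set) \<Rightarrow> ('h \<Rightarrow> 'h) \<Rightarrow> bool" where
  "super_hilbert H E J \<longleftrightarrow> antiunitary_involution J \<and>
     (\<forall>k. closed_csubspace (E k) \<and> orth_sum (E k) (J ` E k) (H k)) \<and>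
     orth_sum (H 0) (H 1) UNIV"


section \<open>Tensors as Hilbert--Schmidt forms\<close>

text \<open>
  As in Kadison and Ringrose (Section 2.6), the Hilbert tensor power of order \<open>n\<close> is the space
  of bounded multi-antilinear forms in \<open>n\<close> arguments whose squared values on tuples of basis
  vectors are summable (the sum does not depend on the orthonormal basis).  A tensor \<open>t\<close> is the
  form mapping \<open>[h\<^sub>1, ..., h\<^sub>n]\<close> to the inner product of \<open>h\<^sub>1 \<otimes> ... \<otimes> h\<^sub>n\<close> with \<open>t\<close>.  All degrees
  are treated at once: an element of the Hilbert direct sum over \<open>n\<close> is a function on lists,
  and its component of degree \<open>n\<close> is the restriction to lists of length \<open>n\<close>.
\<close>

definition multi_antilinear :: "('a::complex_hilbert list \<Rightarrow> complex) \<Rightarrow> bool" where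
  "multi_antilinear F \<longleftrightarrow>
     (\<forall>xs ys x y. F (xs @ (x + y) # ys) = F (xs @ x # ys) + F (xs @ y # ys)) \<and>
     (\<forall>xs ys c x. F (xs @ (c *\<^sub>C x) # ys) = cnj c * F (xs @ x # ys))"

definition bounded_form :: "('a::complex_hilbert list \<Rightarrow> complex) \<Rightarrow> bool" where
  "bounded_form F \<longleftrightarrow>
     (\<forall>n. \<exists>C. \<forall>xs. length xs = n \<longrightarrow> cmod (F xs) \<le> C * prod_list (map norm xs))"

definition simple_tensor :: "'a::complex_hilbert list \<Rightarrow> 'a list \<Rightarrow> complex" where
  "simple_tensor fs hs =
     (if length hs = length fs then \<Prod>i<length fs. cinner (hs ! i) (fs ! i) else 0)"

definition vac :: "'a list \<Rightarrow> complex" where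
  "vac xs = (if xs = [] then 1 else 0)"


section \<open>The Fock space\<close>

definition hpart :: "(bit \<Rightarrow> 'h::complex_hilbert set) \<Rightarrow> bit \<Rightarrow> 'h \<Rightarrow> 'h" where
  "hpart H k h = (THE a. a \<in> H k \<and> h - a \<in> H (k + 1))"

text \<open>The sign of \<open>\<sigma>\<close> for factors whose parities are listed in \<open>ks\<close>.\<close>

definition koszul :: "(nat \<Rightarrow> nat) \<Rightarrow> bit list \<Rightarrow> complex" where
  "koszul \<sigma> ks = (- 1) ^ card {(i, j). i < j \<and> j < length ks \<and> \<sigma> j < \<sigma> i \<and>
     ks ! \<sigma> i = 1 \<and> ks ! \<sigma> j = 1}"

text \<open>
  The projection \<open>P\<close> on forms.  As \<open>P\<close> is self-adjoint, the value of \<open>P F\<close> at \<open>h\<^sub>1, ..., h\<^sub>n\<close> is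
  the inner product of \<open>P (h\<^sub>1 \<otimes> ... \<otimes> h\<^sub>n)\<close> with \<open>F\<close>; the sum over \<open>ks\<close> decomposes the arguments
  into parts of definite parity.  The defining formula on tensors of vectors of definite parity
  is \<open>sym_proj_simple_tensor\<close> below.
\<close>

definition sym_proj ::
    "(bit \<Rightarrow> 'h::complex_hilbert set) \<Rightarrow> ('h list \<Rightarrow> complex) \<Rightarrow> 'h list \<Rightarrow> complex" where
  "sym_proj H F hs = (1 / fact (length hs)) *
     (\<Sum>\<sigma> | \<sigma> permutes {..<length hs}. \<Sum>ks | length ks = length hs.
        koszul \<sigma> ks * F (permute_list \<sigma> (map2 (hpart H) ks hs)))"

definition fock :: "(bit \<Rightarrow> 'h::complex_hilbert set) \<Rightarrow> ('h list \<Rightarrow> complex) set" where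
  "fock H = {F. multi_antilinear F \<and> bounded_form F \<and> sym_proj H F = F \<and>
     (\<lambda>hs. (cmod (F hs))\<^sup>2) summable_on lists onb}"

definition fock_mult :: "(bit \<Rightarrow> 'h::complex_hilbert set) \<Rightarrow> ('h list \<Rightarrow> complex) \<Rightarrow>
    ('h list \<Rightarrow> complex) \<Rightarrow> 'h list \<Rightarrow> complex" where
  "fock_mult H F G hs = (\<Sum>p\<le>length hs.
     complex_of_real (sqrt (fact (length hs) / (fact p * fact (length hs - p)))) *
     sym_proj H (\<lambda>ys. F (take p ys) * G (drop p ys)) hs)"

definition fock_inner :: "('h::complex_hilbert list \<Rightarrow> complex) \<Rightarrow> ('h list \<Rightarrow> complex) \<Rightarrow> complex" where
  "fock_inner F G = (\<Sum>\<^sub>\<infinity>hs\<in>lists onb. cnj (F hs) * G hs)"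

text \<open>The involution maps \<open>f\<^sub>1 \<otimes> ... \<otimes> f\<^sub>n\<close> to \<open>J f\<^sub>n \<otimes> ... \<otimes> J f\<^sub>1\<close>.\<close>

definition fock_star :: "('h \<Rightarrow> 'h) \<Rightarrow> ('h list \<Rightarrow> complex) \<Rightarrow> 'h list \<Rightarrow> complex" where
  "fock_star J F hs = cnj (F (map J (rev hs)))"

definition fock_pair ::
    "('h::complex_hilbert \<Rightarrow> 'h) \<Rightarrow> ('h list \<Rightarrow> complex) \<Rightarrow> ('h list \<Rightarrow> complex) \<Rightarrow> complex" where
  "fock_pair J F G = fock_inner (fock_star J F) G"

definition linear_on_fock :: "(bit \<Rightarrow> 'h::complex_hilbert set) \<Rightarrow>
    (('h list \<Rightarrow> complex) \<Rightarrow> ('h list \<Rightarrow> complex)) \<Rightarrow> bool" where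
  "linear_on_fock H T \<longleftrightarrow> T \<in> fock H \<rightarrow> fock H \<and>
     (\<forall>F\<in>fock H. \<forall>G\<in>fock H. T (\<lambda>hs. F hs + G hs) = (\<lambda>hs. T F hs + T G hs)) \<and>
     (\<forall>c. \<forall>F\<in>fock H. T (\<lambda>hs. c * F hs) = (\<lambda>hs. c * T F hs))"

definition is_transposed :: "(bit \<Rightarrow> 'h::complex_hilbert set) \<Rightarrow> ('h \<Rightarrow> 'h) \<Rightarrow>
    (('h list \<Rightarrow> complex) \<Rightarrow> ('h list \<Rightarrow> complex)) \<Rightarrow>
    (('h list \<Rightarrow> complex) \<Rightarrow> ('h list \<Rightarrow> complex)) \<Rightarrow> bool" where
  "is_transposed H J T T' \<longleftrightarrow> T' \<in> fock H \<rightarrow> fock H \<and>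
     (\<forall>F\<in>fock H. \<forall>G\<in>fock H. fock_pair J (T' F) G = fock_pair J F (T G))"


section \<open>The Grassmann algebra\<close>

definition alt :: "('l list \<Rightarrow> complex) \<Rightarrow> 'l list \<Rightarrow> complex" where
  "alt l ls = (1 / fact (length ls)) *
     (\<Sum>\<sigma> | \<sigma> permutes {..<length ls}. of_int (sign \<sigma>) * l (permute_list \<sigma> ls))"

definition grass :: "('l::complex_hilbert list \<Rightarrow> complex) set" where
  "grass = {l. multi_antilinear l \<and> bounded_form l \<and> alt l = l \<and>
     (\<lambda>ls. (cmod (l ls))\<^sup>2 / (fact (length ls))\<^sup>2) summable_on lists onb}"

definition grass_norm :: "('l::complex_hilbert list \<Rightarrow> complex) \<Rightarrow> real" where
  "grass_norm l = sqrt (\<Sum>\<^sub>\<infinity>ls\<in>lists onb. (cmod (l ls))\<^sup>2 / (fact (length ls))\<^sup>2)"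

definition grass_mult ::
    "('l list \<Rightarrow> complex) \<Rightarrow> ('l list \<Rightarrow> complex) \<Rightarrow> 'l list \<Rightarrow> complex" where
  "grass_mult l m ls = (\<Sum>p\<le>length ls.
     complex_of_real (sqrt (fact (length ls) / (fact p * fact (length ls - p)))) *
     alt (\<lambda>xs. l (take p xs) * m (drop p xs)) ls)"

definition grass_part :: "bit \<Rightarrow> ('l::complex_hilbert list \<Rightarrow> complex) set" where
  "grass_part k = {l \<in> grass. \<forall>ls. l ls \<noteq> 0 \<longrightarrow> of_nat (length ls) = k}"

definition grass_involution ::
    "(('l::complex_hilbert list \<Rightarrow> complex) \<Rightarrow> ('l list \<Rightarrow> complex)) \<Rightarrow> bool" where
  "grass_involution s \<longleftrightarrow> s \<in> grass \<rightarrow> grass \<and>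
     (\<forall>k. s \<in> grass_part k \<rightarrow> grass_part k) \<and>
     (\<forall>l\<in>grass. s (s l) = l) \<and>
     (\<forall>l\<in>grass. grass_norm (s l) = grass_norm l) \<and>
     (\<forall>l\<in>grass. \<forall>m\<in>grass. s (\<lambda>ls. l ls + m ls) = (\<lambda>ls. s l ls + s m ls)) \<and>
     (\<forall>c. \<forall>l\<in>grass. s (\<lambda>ls. c * l ls) = (\<lambda>ls. cnj c * s l ls)) \<and>
     (\<forall>l\<in>grass. \<forall>m\<in>grass. s (grass_mult l m) = grass_mult (s m) (s l))"


section \<open>The Grassmann extension of the Fock space\<close>

text \<open>
  Elements of the Hilbert tensor product of \<open>grass\<close> and \<open>fock H\<close> are Hilbert--Schmidt forms in
  two groups of arguments.  For such a form \<open>X\<close>, each \<open>X ls\<close> lies in \<open>fock H\<close> and each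
  \<open>\<lambda>ls. X ls hs\<close> lies in \<open>grass\<close>.  The pairing, the involution and the extension of a bounded
  operator are the continuous extensions of the maps prescribed on \<open>tens l F\<close>; they act on
  these partial forms, and the product is given by a finite sum at each pair of lists.  The
  prescribed values are proved in \<open>slam_mult_tens\<close>, \<open>slam_star_tens\<close>, \<open>slam_pair_tens\<close> and
  \<open>lam_ext_tens\<close> below.
\<close>

type_synonym ('l, 'h) sform = "'l list \<Rightarrow> 'h list \<Rightarrow> complex"

definition slam :: "(bit \<Rightarrow> 'h::complex_hilbert set) \<Rightarrow> ('l::complex_hilbert, 'h) sform set" where
  "slam H = {X.
     (\<forall>hs. multi_antilinear (\<lambda>ls. X ls hs) \<and> alt (\<lambda>ls. X ls hs) = (\<lambda>ls. X ls hs)) \<and>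
     (\<forall>ls. multi_antilinear (X ls) \<and> sym_proj H (X ls) = X ls) \<and>
     (\<forall>m n. \<exists>C. \<forall>ls hs. length ls = m \<longrightarrow> length hs = n \<longrightarrow>
        cmod (X ls hs) \<le> C * (prod_list (map norm ls) * prod_list (map norm hs))) \<and>
     (\<lambda>(ls, hs). (cmod (X ls hs))\<^sup>2 / (fact (length ls))\<^sup>2) summable_on (lists onb \<times> lists onb)}"

definition tens :: "('l list \<Rightarrow> complex) \<Rightarrow> ('h list \<Rightarrow> complex) \<Rightarrow> ('l, 'h) sform" where
  "tens l F = (\<lambda>ls hs. l ls * F hs)"

definition slam_mult :: "(bit \<Rightarrow> 'h::complex_hilbert set) \<Rightarrow>
    ('l, 'h) sform \<Rightarrow> ('l, 'h) sform \<Rightarrow> ('l, 'h) sform" where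
  "slam_mult H X Y ls hs = (\<Sum>p\<le>length ls. \<Sum>q\<le>length hs.
     complex_of_real (sqrt (fact (length ls) / (fact p * fact (length ls - p)))) *
     complex_of_real (sqrt (fact (length hs) / (fact q * fact (length hs - q)))) *
     alt (\<lambda>xs. sym_proj H (\<lambda>ys.
       X (take p xs) (take q ys) * Y (drop p xs) (drop q ys)) hs) ls)"

primrec slam_power ::
    "(bit \<Rightarrow> 'h::complex_hilbert set) \<Rightarrow> ('l, 'h) sform \<Rightarrow> nat \<Rightarrow> ('l, 'h) sform" where
  "slam_power H X 0 = tens vac vac"
| "slam_power H X (Suc p) = slam_mult H X (slam_power H X p)"

text \<open>
  For arguments in \<open>h_lam H\<close> the \<open>p\<close>-th power has degree \<open>p\<close> in the second group, so the
  exponential series is an orthogonal sum whose components are given pointwise.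
\<close>

definition slam_exp :: "(bit \<Rightarrow> 'h::complex_hilbert set) \<Rightarrow> ('l, 'h) sform \<Rightarrow> ('l, 'h) sform" where
  "slam_exp H X ls hs = (\<Sum>p. (1 / fact p) * slam_power H X p ls hs)"

definition slam_star :: "('h \<Rightarrow> 'h) \<Rightarrow> (('l list \<Rightarrow> complex) \<Rightarrow> ('l list \<Rightarrow> complex)) \<Rightarrow>
    ('l, 'h) sform \<Rightarrow> ('l, 'h) sform" where
  "slam_star J s X = (\<lambda>ls hs. s (\<lambda>ls'. X ls' (map J (rev hs))) ls)"

definition slam_pair :: "('h::complex_hilbert \<Rightarrow> 'h) \<Rightarrow>
    ('l, 'h) sform \<Rightarrow> ('l, 'h) sform \<Rightarrow> 'l list \<Rightarrow> complex" where
  "slam_pair J X Y ls = (\<Sum>p\<le>length ls.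
     complex_of_real (sqrt (fact (length ls) / (fact p * fact (length ls - p)))) *
     alt (\<lambda>xs. fock_pair J (X (take p xs)) (Y (drop p xs))) ls)"

definition slam_sesq :: "('h::complex_hilbert \<Rightarrow> 'h) \<Rightarrow>
    (('l list \<Rightarrow> complex) \<Rightarrow> ('l list \<Rightarrow> complex)) \<Rightarrow>
    ('l, 'h) sform \<Rightarrow> ('l, 'h) sform \<Rightarrow> 'l list \<Rightarrow> complex" where
  "slam_sesq J s X Y = slam_pair J (slam_star J s X) Y"

definition lam_ext :: "(('h list \<Rightarrow> complex) \<Rightarrow> ('h list \<Rightarrow> complex)) \<Rightarrow>
    ('l, 'h) sform \<Rightarrow> ('l, 'h) sform" where
  "lam_ext T X = (\<lambda>ls. T (X ls))"

text \<open>
  The tensor product of the part of parity \<open>k\<close> of the Grassmann algebra with \<open>H k\<close>: the forms of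
  degree one in the second group that vanish on the orthogonal complement \<open>H (k + 1)\<close> of \<open>H k\<close>.
\<close>

definition h_lam_part ::
    "(bit \<Rightarrow> 'h::complex_hilbert set) \<Rightarrow> bit \<Rightarrow> ('l::complex_hilbert, 'h) sform set" where
  "h_lam_part H k = {X \<in> slam H.
     (\<forall>ls hs. X ls hs \<noteq> 0 \<longrightarrow> of_nat (length ls) = k \<and> length hs = 1) \<and>
     (\<forall>ls. \<forall>h\<in>H (k + 1). X ls [h] = 0)}"

definition h_lam ::
    "(bit \<Rightarrow> 'h::complex_hilbert set) \<Rightarrow> ('l::complex_hilbert, 'h) sform set" where
  "h_lam H = {\<lambda>ls hs. X ls hs + Y ls hs | X Y. X \<in> h_lam_part H 0 \<and> Y \<in> h_lam_part H 1}"

definition h_lam_diag :: "(bit \<Rightarrow> 'h::complex_hilbert set) \<Rightarrow> ('h \<Rightarrow> 'h) \<Rightarrow>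
    (('l::complex_hilbert list \<Rightarrow> complex) \<Rightarrow> ('l list \<Rightarrow> complex)) \<Rightarrow> ('l, 'h) sform set" where
  "h_lam_diag H J s = {z \<in> h_lam H. slam_star J s z = z}"


section \<open>The function space\<close>

type_synonym ('l, 'h) sfun = "('l, 'h) sform \<Rightarrow> 'l list \<Rightarrow> complex"

text \<open>Functions on \<open>h_lam_diag H J s\<close> are extensional, i.e. \<open>undefined\<close> outside this domain.\<close>

definition upsilon :: "(bit \<Rightarrow> 'h::complex_hilbert set) \<Rightarrow> ('h \<Rightarrow> 'h) \<Rightarrow>
    (('l::complex_hilbert list \<Rightarrow> complex) \<Rightarrow> ('l list \<Rightarrow> complex)) \<Rightarrow>
    ('l, 'h) sform \<Rightarrow> ('l, 'h) sfun" where
  "upsilon H J s X = (\<lambda>z\<in>h_lam_diag H J s. slam_pair J (slam_exp H z) X)"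

definition fun_space :: "(bit \<Rightarrow> 'h::complex_hilbert set) \<Rightarrow> ('h \<Rightarrow> 'h) \<Rightarrow>
    (('l::complex_hilbert list \<Rightarrow> complex) \<Rightarrow> ('l list \<Rightarrow> complex)) \<Rightarrow> ('l, 'h) sfun set" where
  "fun_space H J s = upsilon H J s ` slam H"

definition upsilon_inv :: "(bit \<Rightarrow> 'h::complex_hilbert set) \<Rightarrow> ('h \<Rightarrow> 'h) \<Rightarrow>
    (('l::complex_hilbert list \<Rightarrow> complex) \<Rightarrow> ('l list \<Rightarrow> complex)) \<Rightarrow>
    ('l, 'h) sfun \<Rightarrow> ('l, 'h) sform" where
  "upsilon_inv H J s = the_inv_into (slam H) (upsilon H J s)"

definition fun_pair :: "(bit \<Rightarrow> 'h::complex_hilbert set) \<Rightarrow> ('h \<Rightarrow> 'h) \<Rightarrow>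
    (('l::complex_hilbert list \<Rightarrow> complex) \<Rightarrow> ('l list \<Rightarrow> complex)) \<Rightarrow>
    ('l, 'h) sfun \<Rightarrow> ('l, 'h) sfun \<Rightarrow> 'l list \<Rightarrow> complex" where
  "fun_pair H J s \<phi> \<psi> = slam_pair J (upsilon_inv H J s \<phi>) (upsilon_inv H J s \<psi>)"

definition fun_rep :: "(bit \<Rightarrow> 'h::complex_hilbert set) \<Rightarrow> ('h \<Rightarrow> 'h) \<Rightarrow>
    (('l::complex_hilbert list \<Rightarrow> complex) \<Rightarrow> ('l list \<Rightarrow> complex)) \<Rightarrow>
    (('h list \<Rightarrow> complex) \<Rightarrow> ('h list \<Rightarrow> complex)) \<Rightarrow> ('l, 'h) sfun \<Rightarrow> ('l, 'h) sfun" where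
  "fun_rep H J s T \<phi> = upsilon H J s (lam_ext T (upsilon_inv H J s \<phi>))"

definition op_kernel :: "(bit \<Rightarrow> 'h::complex_hilbert set) \<Rightarrow> ('h \<Rightarrow> 'h) \<Rightarrow>
    (('h list \<Rightarrow> complex) \<Rightarrow> ('h list \<Rightarrow> complex)) \<Rightarrow>
    ('l, 'h) sform \<Rightarrow> ('l, 'h) sform \<Rightarrow> 'l list \<Rightarrow> complex" where
  "op_kernel H J T z\<^sub>1 z\<^sub>2 = slam_pair J (lam_ext T (slam_exp H z\<^sub>1)) (slam_exp H z\<^sub>2)"


section \<open>The defining formulas\<close>

lemma cinner_add_left: "cinner (x + y) z = cinner x z + cinner (y::'a::complex_hilbert) z"
  by (metis cinner_add_right cinner_commute complex_cnj_add)

lemma cinner_scaleC_left: "cinner (a *\<^sub>C x) y = cnj a * cinner (x::'a::complex_hilbert) y"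
  by (metis cinner_commute cinner_scaleC_right complex_cnj_mult)

lemma cinner_zero_right [simp]: "cinner (x::'a::complex_hilbert) 0 = 0"
  by (metis add_cancel_right_right cinner_add_right add.right_neutral)

lemma cinner_zero_left [simp]: "cinner 0 (x::'a::complex_hilbert) = 0"
  by (metis cinner_commute cinner_zero_right complex_cnj_zero)

lemma cinner_self: "cinner x (x::'a::complex_hilbert) = complex_of_real ((norm x)\<^sup>2)"
proof -
  have "Im (cinner x x) = 0"
    by (metis cinner_commute complex_cnj_cancel_iff complex_cnj complex.sel(2) 
        add.inverse_neutral equation_minus_iff cnj.simps(2) neg_equal_zero)
  then show ?thesis
    by (simp add: complex_eq_iff power2_norm_eq_inner inner_cinner)
qed

lemma is_onb_onb: "is_onb (onb :: 'a::complex_hilbert set)"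
proof -
  define orth where "orth B \<longleftrightarrow> (\<forall>b\<in>B. \<forall>c\<in>B. cinner b c = (if b = c then 1 else 0))"
    for B :: "'a set"
  have "\<exists>M\<in>{B. orth B}. \<forall>X\<in>{B. orth B}. M \<subseteq> X \<longrightarrow> X = M"
  proof (rule subset_Zorn')
    fix C assume C: "subset.chain {B. orth B} C"
    have "cinner b c = (if b = c then 1 else 0)" if bc: "b \<in> \<Union>C" "c \<in> \<Union>C" for b c
    proof -
      obtain X Y where XY: "X \<in> C" "b \<in> X" "Y \<in> C" "c \<in> Y" using bc by blast
      then have "X \<subseteq> Y \<or> Y \<subseteq> X" using C by (auto simp: subset.chain_def)
      then obtain Z where "Z \<in> C" "b \<in> Z" "c \<in> Z" using XY by blast
      moreover have "orth Z" using C \<open>Z \<in> C\<close> by (auto simp: subset.chain_def)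
      ultimately show ?thesis by (auto simp: orth_def)
    qed
    then show "\<Union>C \<in> {B. orth B}" by (auto simp: orth_def)
  qed
  then obtain M where M: "orth M" and max: "\<And>X. orth X \<Longrightarrow> M \<subseteq> X \<Longrightarrow> X = M" by blast
  have "x = 0" if x: "\<forall>b\<in>M. cinner b x = 0" for x
  proof (rule ccontr)
    assume "x \<noteq> 0"
    define y where "y = complex_of_real (1 / norm x) *\<^sub>C x"
    have "cinner y y = 1"
      using \<open>x \<noteq> 0\<close> unfolding y_def cinner_scaleC_left cinner_scaleC_right cinner_self[of x]
      by (simp add: power2_eq_square)
    moreover have "cinner b y = 0 \<and> cinner y b = 0" if "b \<in> M" for b
    proof -
      have "cinner b y = 0" using x that by (simp add: y_def cinner_scaleC_right)
      then show ?thesis by (metis cinner_commute complex_cnj_zero)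
    qed
    ultimately have "orth (insert y M)" using M by (auto simp: orth_def)
    then have "y \<in> M" using max by blast
    then show False using \<open>cinner y y = 1\<close> \<open>\<And>b. b \<in> M \<Longrightarrow> cinner b y = 0 \<and> cinner y b = 0\<close> by force
  qed
  then have "is_onb M" using M by (auto simp: is_onb_def orth_def)
  then show ?thesis unfolding onb_def by (rule someI)
qed

lemma hpart_props:
  assumes "super_hilbert H E J"
  shows hpart_in: "hpart H k h \<in> H k"
    and hpart_orth: "f \<in> H k \<Longrightarrow> cinner (hpart H k' h) f = (if k' = k then cinner h f else 0)"
proof -
  have bits: "k = 0 \<or> k = 1" for k :: bit by (cases k) auto
  have orth01: "cinner a b = 0" if "a \<in> H 0" "b \<in> H 1" for a b
    using assms that by (auto simp: super_hilbert_def orth_sum_def)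
  have orth: "cinner a b = 0" if "a \<in> H k" "b \<in> H k'" "k \<noteq> k'" for a b k k'
    using bits[of k] bits[of k'] that orth01 cinner_commute[of a b] by auto
  have add: "a - b \<in> H k" if ab: "a \<in> H k" "b \<in> H k" for a b k
  proof -
    have sub: "closed_csubspace (E k)" and H: "H k = {a + b | a b. a \<in> E k \<and> b \<in> J ` E k}"
      and J: "antiunitary_involution J"
      using assms by (auto simp: super_hilbert_def orth_sum_def)
    have neg: "- x = (- 1) *\<^sub>C x" for x :: 'a
      using scaleR_scaleC[of "-1" x] by simp
    have diff: "x - y \<in> E k" if "x \<in> E k" "y \<in> E k" for x y
      using sub that neg[of y] unfolding closed_csubspace_def by (metis diff_conv_add_uminus)
    have Jneg: "J (- y) = - J y" for y
      using J neg[of y] neg[of "J y"] unfolding antiunitary_involution_def by simp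
    have Jdiff: "J x - J y = J (x - y)" for x y
      using J Jneg[of y] unfolding antiunitary_involution_def by (metis diff_conv_add_uminus)
    obtain a1 a2 b1 b2 where *: "a = a1 + J a2" "b = b1 + J b2" "a1 \<in> E k" "a2 \<in> E k"
      "b1 \<in> E k" "b2 \<in> E k" using ab H by auto
    have "a - b = (a1 - b1) + J (a2 - b2)" by (simp add: * Jdiff[symmetric])
    then show ?thesis unfolding H using diff * by blast
  qed
  have ex1: "\<exists>!a. a \<in> H k \<and> h - a \<in> H (k + 1)" for k h
  proof -
    have "h \<in> {a + b | a b. a \<in> H 0 \<and> b \<in> H 1}"
      using assms unfolding super_hilbert_def orth_sum_def by (metis UNIV_I)
    then obtain a b where ab: "h = a + b" "a \<in> H 0" "b \<in> H 1" by auto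
    have ex: "\<exists>a. a \<in> H k \<and> h - a \<in> H (k + 1)"
      using bits[of k] ab by (auto intro: exI[of _ a] exI[of _ b])
    have "x = y" if "x \<in> H k" "h - x \<in> H (k+1)" "y \<in> H k" "h - y \<in> H (k+1)" for x y
    proof -
      have 1: "x - y \<in> H k" using add that by blast
      have 2: "x - y \<in> H (k + 1)" using add[OF that(4) that(2)] by simp
      have "cinner (x - y) (x - y) = 0" using orth[OF 1 2] bits[of k] by auto
      then show ?thesis by (simp add: cinner_self)
    qed
    with ex show ?thesis by blast
  qed
  have spec: "hpart H k h \<in> H k \<and> h - hpart H k h \<in> H (k + 1)" for k h
    unfolding hpart_def by (rule theI'[OF ex1])
  then show "hpart H k h \<in> H k" by blast
  show "cinner (hpart H k' h) f = (if k' = k then cinner h f else 0)" if f: "f \<in> H k"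
  proof (cases "k' = k")
    case True
    have "cinner (h - hpart H k h) f = 0"
      using orth[of _ "k + 1" f k] spec[of k h] f bits[of k] by auto
    then show ?thesis using True cinner_add_left[of "h - hpart H k h" "hpart H k h" f] by simp
  next
    case False
    then show ?thesis using orth[OF conjunct1[OF spec] f False] by simp
  qed
qed

lemma koszul_inv:
  assumes \<tau>: "\<tau> permutes {..<length ks}"
  shows "koszul (inv \<tau>) (permute_list \<tau> ks) = koszul \<tau> ks"
proof -
  let ?n = "length ks"
  let ?A = "{(i, j). i < j \<and> j < length (permute_list \<tau> ks) \<and> inv \<tau> j < inv \<tau> i \<and>
     permute_list \<tau> ks ! inv \<tau> i = 1 \<and> permute_list \<tau> ks ! inv \<tau> j = 1}"
  let ?B = "{(i, j). i < j \<and> j < ?n \<and> \<tau> j < \<tau> i \<and> ks ! \<tau> i = 1 \<and> ks ! \<tau> j = 1}"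
  have i: "inv \<tau> permutes {..<?n}" using \<tau> by (rule permutes_inv)
  have inv: "\<tau> (inv \<tau> x) = x" "inv \<tau> (\<tau> x) = x" for x
    using permutes_inverses[OF \<tau>] by auto
  have lt: "\<tau> x < ?n \<longleftrightarrow> x < ?n" "inv \<tau> x < ?n \<longleftrightarrow> x < ?n" for x
    using permutes_in_image[OF \<tau>, of x] permutes_in_image[OF i, of x] by auto
  have "bij_betw (\<lambda>(i, j). (\<tau> j, \<tau> i)) ?B ?A"
    by (rule bij_betwI[of _ _ _ "\<lambda>(i, j). (inv \<tau> j, inv \<tau> i)"])
      (auto simp: inv lt permute_list_nth[OF \<tau>] dest: order.strict_trans)
  then show ?thesis unfolding koszul_def by (simp add: bij_betw_same_card)
qed

lemma sym_proj_simple_tensor: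
  assumes sh: "super_hilbert H E J" and len: "length ks = length fs"
    and fs: "\<And>i. i < length fs \<Longrightarrow> fs ! i \<in> H (ks ! i)"
  shows "sym_proj H (simple_tensor fs) = (\<lambda>hs. (1 / fact (length fs)) *
     (\<Sum>\<sigma> | \<sigma> permutes {..<length fs}. koszul \<sigma> ks * simple_tensor (permute_list \<sigma> fs) hs))"
proof
  fix hs
  let ?n = "length fs"
  let ?P = "{\<sigma>. \<sigma> permutes {..<?n}}"
  show "sym_proj H (simple_tensor fs) hs = (1 / fact (length fs)) *
     (\<Sum>\<sigma> | \<sigma> permutes {..<length fs}. koszul \<sigma> ks * simple_tensor (permute_list \<sigma> fs) hs)"
  proof (cases "length hs = ?n")
    case False
    then show ?thesis by (simp add: sym_proj_def simple_tensor_def)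
  next
    case hs: True
    have fin: "finite {qs :: bit list. length qs = ?n}"
    proof -
      have "(UNIV :: bit set) = {0, 1}" by (auto intro: bit.exhaust)
      then have "finite (UNIV :: bit set)" by (metis finite.emptyI finite.insertI)
      from finite_lists_length_eq[OF this, of ?n] show ?thesis by simp
    qed
    have main: "(\<Sum>qs | length qs = ?n. koszul \<sigma> qs *
        simple_tensor fs (permute_list \<sigma> (map2 (hpart H) qs hs))) =
        koszul (inv \<sigma>) ks * simple_tensor (permute_list (inv \<sigma>) fs) hs"
      if \<sigma>: "\<sigma> permutes {..<?n}" for \<sigma>
    proof -
      have i: "inv \<sigma> permutes {..<?n}" using \<sigma> by (rule permutes_inv)
      have inv: "\<sigma> (inv \<sigma> x) = x" "inv \<sigma> (\<sigma> x) = x" for x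
        using permutes_inverses[OF \<sigma>] by auto
      have lt: "\<sigma> x < ?n \<longleftrightarrow> x < ?n" "inv \<sigma> x < ?n \<longleftrightarrow> x < ?n" for x
        using permutes_in_image[OF \<sigma>, of x] permutes_in_image[OF i, of x] by auto
      let ?q = "permute_list (inv \<sigma>) ks"
      have val: "simple_tensor fs (permute_list \<sigma> (map2 (hpart H) qs hs)) =
          (if qs = ?q then simple_tensor (permute_list (inv \<sigma>) fs) hs else 0)"
        if qs: "length qs = ?n" for qs
      proof -
        have "simple_tensor fs (permute_list \<sigma> (map2 (hpart H) qs hs)) =
          (\<Prod>i<?n. cinner (hpart H (qs ! \<sigma> i) (hs ! \<sigma> i)) (fs ! i))"
          using \<sigma> qs hs unfolding simple_tensor_def
          by (auto intro!: prod.cong simp: permute_list_nth lt)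
        also have "\<dots> = (\<Prod>i<?n. if qs ! \<sigma> i = ks ! i then cinner (hs ! \<sigma> i) (fs ! i) else 0)"
          by (intro prod.cong refl hpart_orth[OF sh] fs) auto
        also have "\<dots> = (if qs = ?q then simple_tensor (permute_list (inv \<sigma>) fs) hs else 0)"
        proof (cases "qs = ?q")
          case True
          have "qs ! \<sigma> i = ks ! i" if "i < ?n" for i
            using that i by (simp add: True permute_list_nth len lt inv)
          then have "(\<Prod>i<?n. if qs ! \<sigma> i = ks ! i then cinner (hs ! \<sigma> i) (fs ! i) else 0) =
              (\<Prod>i<?n. cinner (hs ! \<sigma> i) (fs ! i))" by (intro prod.cong) auto
          also have "\<dots> = (\<Prod>i<?n. cinner (hs ! i) (fs ! inv \<sigma> i))"
            using prod.permute[OF \<sigma>, of "\<lambda>i. cinner (hs ! i) (fs ! inv \<sigma> i)"]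
            by (simp add: o_def inv)
          also have "\<dots> = simple_tensor (permute_list (inv \<sigma>) fs) hs"
            using hs i by (auto simp: simple_tensor_def permute_list_nth intro!: prod.cong)
          finally show ?thesis using True by simp
        next
          case False
          have "\<exists>j<?n. qs ! j \<noteq> ?q ! j"
            using False qs len by (auto simp: list_eq_iff_nth_eq)
          then obtain j where j: "j < ?n" "qs ! j \<noteq> ks ! inv \<sigma> j"
            using i len by (auto simp: permute_list_nth)
          then have "inv \<sigma> j < ?n \<and> qs ! \<sigma> (inv \<sigma> j) \<noteq> ks ! inv \<sigma> j"
            by (simp add: lt inv)
          then have "(\<Prod>i<?n. if qs ! \<sigma> i = ks ! i then cinner (hs ! \<sigma> i) (fs ! i) else 0) = 0"
            by (auto simp: prod_zero_iff)
          then show ?thesis using False by simp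
        qed
        finally show ?thesis .
      qed
      have "(\<Sum>qs | length qs = ?n. koszul \<sigma> qs *
          simple_tensor fs (permute_list \<sigma> (map2 (hpart H) qs hs))) =
          (\<Sum>qs | length qs = ?n. if qs = ?q then
             koszul \<sigma> qs * simple_tensor (permute_list (inv \<sigma>) fs) hs else 0)"
        by (intro sum.cong) (auto simp: val)
      also have "\<dots> = koszul \<sigma> ?q * simple_tensor (permute_list (inv \<sigma>) fs) hs"
        using fin by (simp add: sum.delta len)
      also have "koszul \<sigma> ?q = koszul (inv \<sigma>) ks"
        using koszul_inv[of "inv \<sigma>" ks] i len permutes_inv_inv[OF \<sigma>] by simp
      finally show ?thesis .
    qed
    have "sym_proj H (simple_tensor fs) hs = (1 / fact ?n) *
        (\<Sum>\<sigma>\<in>?P. koszul (inv \<sigma>) ks * simple_tensor (permute_list (inv \<sigma>) fs) hs)"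
      unfolding sym_proj_def hs by (intro arg_cong2[where f = "(*)"] sum.cong refl main) auto
    also have "(\<Sum>\<sigma>\<in>?P. koszul (inv \<sigma>) ks * simple_tensor (permute_list (inv \<sigma>) fs) hs) =
        (\<Sum>\<sigma>\<in>?P. koszul \<sigma> ks * simple_tensor (permute_list \<sigma> fs) hs)"
      by (rule sum_permutations_inverse[symmetric])
    finally show ?thesis .
  qed
qed

lemma fock_star_simple_tensor:
  assumes "antiunitary_involution J"
  shows "fock_star J (simple_tensor fs) = simple_tensor (map J (rev fs))"
proof
  fix hs
  have J: "cnj (cinner (J x) y) = cinner x (J y)" for x y
    using assms unfolding antiunitary_involution_def by (metis complex_cnj_cnj)
  have "cnj (\<Prod>i<length fs. cinner (J (rev hs ! i)) (fs ! i)) =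
      (\<Prod>i<length fs. cinner (hs ! i) (J (rev fs ! i)))" if "length hs = length fs"
  proof -
    have "cnj (\<Prod>i<length fs. cinner (J (rev hs ! i)) (fs ! i)) =
        (\<Prod>i<length fs. cinner (rev hs ! i) (J (fs ! i)))" by (simp add: J)
    also have "\<dots> = (\<Prod>i<length fs. cinner (hs ! i) (J (rev fs ! i)))"
      by (rule prod.reindex_bij_witness[of _ "\<lambda>i. length fs - Suc i" "\<lambda>i. length fs - Suc i"])
        (auto simp: rev_nth that)
    finally show ?thesis .
  qed
  then show "fock_star J (simple_tensor fs) hs = simple_tensor (map J (rev fs)) hs"
    by (auto simp: fock_star_def simple_tensor_def rev_map)
qed

lemma alt_scale: "alt (\<lambda>xs. l xs * c) ls = alt l ls * c"
  by (simp add: alt_def sum_distrib_right sum_distrib_left mult_ac)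

lemma sym_proj_scale: "sym_proj H (\<lambda>ys. c * F ys) hs = c * sym_proj H F hs"
  by (simp add: sym_proj_def sum_distrib_left mult_ac)

lemma lam_ext_tens:
  assumes "linear_on_fock H T" "F \<in> fock H"
  shows "lam_ext T (tens l F) = tens l (T F)"
  using assms by (auto simp: lam_ext_def tens_def linear_on_fock_def fun_eq_iff)

lemma slam_pair_tens:
  "slam_pair J (tens l F) (tens m G) = (\<lambda>ls. grass_mult l m ls * fock_pair J F G)"
proof -
  have "fock_pair J (\<lambda>hs. a * F hs) (\<lambda>hs. b * G hs) = a * b * fock_pair J F G" for a b
    unfolding fock_pair_def fock_inner_def fock_star_def infsum_cmult_right'[symmetric]
    by (simp add: mult_ac)
  then show ?thesis
    by (simp add: slam_pair_def grass_mult_def tens_def alt_scale sum_distrib_right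
        mult.assoc[symmetric] fun_eq_iff)
qed

lemma slam_mult_tens:
  "slam_mult H (tens l F) (tens m G) = tens (grass_mult l m) (fock_mult H F G)"
proof -
  have *: "alt (\<lambda>xs. sym_proj H (\<lambda>ys. l (take p xs) * F (take q ys) *
        (m (drop p xs) * G (drop q ys))) hs) ls =
      alt (\<lambda>xs. l (take p xs) * m (drop p xs)) ls *
      sym_proj H (\<lambda>ys. F (take q ys) * G (drop q ys)) hs" for p q ls hs
  proof -
    have "(\<lambda>xs. sym_proj H (\<lambda>ys. l (take p xs) * F (take q ys) *
        (m (drop p xs) * G (drop q ys))) hs) =
      (\<lambda>xs. l (take p xs) * m (drop p xs) *
        sym_proj H (\<lambda>ys. F (take q ys) * G (drop q ys)) hs)"
      unfolding sym_proj_scale[symmetric] by (simp add: mult_ac)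
    then show ?thesis by (simp only: alt_scale)
  qed
  show ?thesis
    unfolding slam_mult_def tens_def grass_mult_def fock_mult_def * sum_product fun_eq_iff
    by (intro allI sum.cong refl) (simp only: mult_ac)
qed

lemma slam_star_tens:
  assumes "grass_involution s" "l \<in> grass"
  shows "slam_star J s (tens l F) = tens (s l) (fock_star J F)"
proof -
  have "s (\<lambda>ls. l ls * c) = (\<lambda>ls. s l ls * cnj c)" for c
    using assms unfolding grass_involution_def by (simp add: mult.commute[of _ c] mult.commute)
  then show ?thesis
    by (simp add: slam_star_def tens_def fock_star_def)
qed

end

theory Submission
  imports Defs
begin

text \<open>
  The kernel formula itself is a formal consequence of the transposition rule
  \<open>\<langle>T' F | G\<rangle> = \<langle>F | T G\<rangle>\<close> applied to each partial form, once the objects in it exist.  Four facts are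
  needed for that.

  \<^item> A transposed operator is bounded (Hellinger--Toeplitz), so its extension preserves \<open>slam H\<close>.

  \<^item> For \<open>z\<close> in \<open>h_lam H\<close> the exponential has the closed form
    \<open>exp z (ls, hs) = (z(-, h\<^sub>1) \<and> \<dots> \<and> z(-, h\<^sub>n)) ls / sqrt (n!)\<close>: the factors have the parity of their
    arguments, so the exterior product is already graded symmetric.  As
    \<open>\<parallel>l m\<parallel>\<^sup>2 \<le> 3 \<parallel>l\<parallel>\<^sup>2 \<parallel>m\<parallel>\<^sup>2\<close> in the Grassmann algebra, it is square-summable; as the involution reverses
    products, it fixes \<open>exp z\<close> when it fixes \<open>z\<close>.

  \<^item> The bilinear pairing on the Fock space is symmetric, because sums over an orthonormal basis
    do not depend on the basis.

  \<^item> The map \<open>upsilon\<close> is injective: if \<open>\<langle>exp z | D\<rangle> = 0\<close> for all real \<open>z\<close>, then scaling \<open>z\<close> separates the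
    degrees, polarisation of finite-rank \<open>z\<close> gives \<open>l\<^sub>1 \<and> \<dots> \<and> l\<^sub>n \<and> D(-, h\<^sub>1, \<dots>, h\<^sub>n) = 0\<close> for all \<open>l\<^sub>i\<close> with
    the parity of \<open>h\<^sub>i\<close>, and multiplying by fresh basis vectors of the infinite-dimensional space of
    generators recovers \<open>D\<close>.
\<close>

text \<open>As a function of its first variable the kernel is the \<open>upsilon\<close> image of
  \<open>lam_ext T' (slam_exp H \<eta>)\<close>. The pairing on the function space inverts
  \<open>upsilon\<close>, so the formula has content only if this form lies in \<open>slam H\<close>
  and \<open>upsilon\<close> is injective there. The algebraic obstacle is the normalisation: sums
  over permutations with coefficients sqrt (n! / (p! q!)). Rescaling degree n by sqrt (n!) gives a
  shuffle product defined by recursion on the argument list, and associativity, graded commutativity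
  and bounds become list inductions. The analytic obstacle is that sums over basis words are
  exchanged before their convergence is known, so norms are summed in \<open>ennreal\<close>. The
  constant 3 bounds the sum over p of 1 / (n choose p), which Cauchy-Schwarz produces when the
  weight 1 / (n!)^2 is split between two factors. In the injectivity proof the real elements form no
  complex space and a finite-rank form does not remember its terms; polarisation therefore acts on
  lists of formal terms over the reals.\<close>

section \<open>Adjacent transpositions and skew forms\<close>

text \<open>Conjugating by an adjacent transposition shortens the distance between the two exchanged
  points by one, so induction on the distance reduces the usual induction over transpositions to
  adjacent ones. These match the local exchange rules \<open>skew\<close> and
  \<open>graded_sym\<close>.\<close>

lemma permutes_adjacent_induct [consumes 1, case_names id adjacent]:
  assumes p: "p permutes {..<n::nat}" and id: "P id"
    and adj: "\<And>i q. Suc i < n \<Longrightarrow> q permutes {..<n} \<Longrightarrow> P q \<Longrightarrow>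
      P (Transposition.transpose i (Suc i) \<circ> q)"
  shows "P p"
proof -
  have tr: "P (Transposition.transpose a (a + Suc d) \<circ> q)"
    if "a + Suc d < n" "q permutes {..<n}" "P q" for a d q
    using that
  proof (induction d arbitrary: a q)
    case 0
    then show ?case using adj[of a q] by (simp del: o_apply)
  next
    case (Suc d)
    let ?t = "Transposition.transpose a (Suc a)"
    let ?u = "Transposition.transpose (Suc a) (Suc a + Suc d)"
    have t: "?t permutes {..<n}" by (rule permutes_swap_id) (use Suc.prems in auto)
    have u: "?u permutes {..<n}" by (rule permutes_swap_id) (use Suc.prems in auto)
    have tq: "?t \<circ> q permutes {..<n}" by (rule permutes_compose[OF Suc.prems(2) t])
    have "P (?t \<circ> q)" using adj Suc.prems by simp
    then have "P (?u \<circ> (?t \<circ> q))"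
      using Suc.IH[of "Suc a" "?t \<circ> q"] tq Suc.prems by (simp del: o_apply)
    then have "P (?t \<circ> (?u \<circ> (?t \<circ> q)))"
      using adj[of a] permutes_compose[OF tq u] Suc.prems by (simp del: o_apply)
    also have "?t \<circ> (?u \<circ> (?t \<circ> q)) = Transposition.transpose a (a + Suc (Suc d)) \<circ> q"
      by (auto simp: fun_eq_iff Transposition.transpose_def)
    finally show ?case .
  qed
  have "finite {..<n}" by simp
  from p this show ?thesis
  proof (induction rule: permutes_induct)
    case id
    show ?case by (rule assms(2))
  next
    case (swap a b p)
    show ?case
    proof (cases "a < b")
      case True
      then show ?thesis using tr[of a "b - Suc a" p] swap by (simp del: o_apply)
    next
      case False
      then have "b < a" using swap by simp
      then show ?thesis using tr[of b "a - Suc b" p] swap by (simp add: transpose_commute del: o_apply)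
    qed
  qed
qed

lemma adjacent_permutes: "Suc i < n \<Longrightarrow> Transposition.transpose i (Suc i) permutes {..<n}"
  by (rule permutes_swap_id) auto

lemma permute_list_adjacent:
  "permute_list (Transposition.transpose (length xs) (Suc (length xs))) (xs @ x # y # ys) = xs @ y # x # ys"
proof (rule nth_equalityI)
  fix i assume "i < length (permute_list (Transposition.transpose (length xs) (Suc (length xs))) (xs @ x # y # ys))"
  then have i: "i < length (xs @ x # y # ys)" by simp
  consider "i < length xs" | "i = length xs" | "i = Suc (length xs)" |
    j where "i = length xs + Suc (Suc j)"
  proof (cases "i < Suc (Suc (length xs))")
    case False
    then have "i = length xs + Suc (Suc (i - Suc (Suc (length xs))))" by simp
    then show thesis using that(4) by blast
  qed (use that in \<open>auto simp: less_Suc_eq\<close>)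
  then show "permute_list (Transposition.transpose (length xs) (Suc (length xs))) (xs @ x # y # ys) ! i =
      (xs @ y # x # ys) ! i"
    by cases (use i in \<open>auto simp: permute_list_nth adjacent_permutes nth_append Transposition.transpose_def\<close>)
qed simp

lemma split_adjacent:
  assumes "Suc i < length ls"
  obtains xs x y ys where "ls = xs @ x # y # ys" "length xs = i"
proof
  show "ls = take i ls @ ls ! i # ls ! Suc i # drop (Suc (Suc i)) ls"
    using assms by (metis Cons_nth_drop_Suc Suc_lessD append_take_drop_id)
  show "length (take i ls) = i" using assms by simp
qed

text \<open>Only adjacent exchanges are required, because this condition passes through the
  recursion of \<open>shuf\<close>. By \<open>alt_eq_iff_skew\<close> it describes exactly the fixed
  points of \<open>alt\<close>.\<close>

definition skew :: "('a list \<Rightarrow> complex) \<Rightarrow> bool" where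
  "skew f \<longleftrightarrow> (\<forall>xs x y ys. f (xs @ x # y # ys) = - f (xs @ y # x # ys))"

lemma sign_adjacent_comp:
  assumes "q permutes {..<n}"
  shows "sign (Transposition.transpose i (Suc i) \<circ> q) = - sign q"
proof -
  have "permutation q" by (rule permutes_imp_permutation[OF _ assms]) simp
  moreover have "permutation (Transposition.transpose i (Suc i))" by (rule permutation_swap_id)
  ultimately show ?thesis by (simp add: sign_compose sign_swap_id)
qed

lemma skew_permute:
  assumes f: "skew f" and p: "\<sigma> permutes {..<length ls}"
  shows "f (permute_list \<sigma> ls) = of_int (sign \<sigma>) * f ls"
proof -
  have "\<forall>ls. length ls = n \<longrightarrow> f (permute_list \<sigma> ls) = of_int (sign \<sigma>) * f ls"
    if "\<sigma> permutes {..<n}" for n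
    using that
  proof (induction rule: permutes_adjacent_induct)
    case id
    then show ?case by simp
  next
    case (adjacent i q)
    show ?case
    proof (intro allI impI)
      fix ls :: "'a list" assume ls: "length ls = n"
      then obtain xs x y ys where *: "ls = xs @ x # y # ys" "length xs = i"
        using split_adjacent adjacent by metis
      have "permute_list (Transposition.transpose i (Suc i) \<circ> q) ls = permute_list q (xs @ y # x # ys)"
        using adjacent ls by (simp add: permute_list_compose * permute_list_adjacent flip: *(2))
      then have "f (permute_list (Transposition.transpose i (Suc i) \<circ> q) ls) =
          of_int (sign q) * f (xs @ y # x # ys)"
        using adjacent ls * by simp
      also have "f (xs @ y # x # ys) = - f (xs @ x # y # ys)" using f unfolding skew_def by blast
      finally show "f (permute_list (Transposition.transpose i (Suc i) \<circ> q) ls) =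
          of_int (sign (Transposition.transpose i (Suc i) \<circ> q)) * f ls"
        using * sign_adjacent_comp[OF adjacent(2)] by (simp del: o_apply)
    qed
  qed
  then show ?thesis using p by blast
qed

lemma alt_cong:
  assumes "\<And>xs. length xs = length ls \<Longrightarrow> f xs = g xs"
  shows "alt f ls = alt g ls"
  using assms by (simp add: alt_def)

text \<open>The summation variable is translated on the left, from \<sigma> to \<tau> \<circ>
  \<sigma>.\<close>

lemma alt_permute:
  assumes t: "\<tau> permutes {..<length ls}"
  shows "alt f (permute_list \<tau> ls) = of_int (sign \<tau>) * alt f ls"
proof -
  let ?P = "{\<sigma>. \<sigma> permutes {..<length ls}}"
  have perm: "permutation \<sigma>" if "\<sigma> permutes {..<length ls}" for \<sigma>
    by (rule permutes_imp_permutation[OF _ that]) simp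
  have "(\<Sum>\<sigma>\<in>?P. of_int (sign \<sigma>) * f (permute_list \<sigma> (permute_list \<tau> ls))) =
    (\<Sum>\<sigma>\<in>?P. of_int (sign \<tau>) * (of_int (sign (\<tau> \<circ> \<sigma>)) * f (permute_list (\<tau> \<circ> \<sigma>) ls)))"
  proof (rule sum.cong)
    fix \<sigma> assume s: "\<sigma> \<in> ?P"
    have "of_int (sign \<tau>) * of_int (sign (\<tau> \<circ> \<sigma>)) = (of_int (sign \<sigma>) :: complex)"
      using s t perm by (simp add: sign_compose flip: of_int_mult)
    then show "of_int (sign \<sigma>) * f (permute_list \<sigma> (permute_list \<tau> ls)) =
      of_int (sign \<tau>) * (of_int (sign (\<tau> \<circ> \<sigma>)) * f (permute_list (\<tau> \<circ> \<sigma>) ls))"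
      using s by (simp add: permute_list_compose flip: mult.assoc)
  qed simp
  also have "\<dots> = of_int (sign \<tau>) * (\<Sum>\<sigma>\<in>?P. of_int (sign \<sigma>) * f (permute_list \<sigma> ls))"
    unfolding sum_distrib_left
    by (rule sum.reindex_bij_witness[of _ "\<lambda>\<sigma>. inv \<tau> \<circ> \<sigma>" "\<lambda>\<sigma>. \<tau> \<circ> \<sigma>"])
      (use t in \<open>auto simp: permutes_inv_o permutes_inv permutes_compose o_assoc simp del: o_apply\<close>)
  finally show ?thesis by (simp add: alt_def)
qed

text \<open>Here the translation is on the right, from \<sigma> to \<sigma> \<circ> \<tau>, because
  \<open>permute_list\<close> reverses the order of composition.\<close>

lemma alt_precompose:
  assumes t: "\<tau> permutes {..<length ls}"
  shows "alt (\<lambda>xs. f (permute_list \<tau> xs)) ls = of_int (sign \<tau>) * alt f ls"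
proof -
  let ?P = "{\<sigma>. \<sigma> permutes {..<length ls}}"
  have perm: "permutation \<sigma>" if "\<sigma> permutes {..<length ls}" for \<sigma>
    by (rule permutes_imp_permutation[OF _ that]) simp
  have "(\<Sum>\<sigma>\<in>?P. of_int (sign \<sigma>) * f (permute_list \<tau> (permute_list \<sigma> ls))) =
    (\<Sum>\<sigma>\<in>?P. of_int (sign \<tau>) * (of_int (sign (\<sigma> \<circ> \<tau>)) * f (permute_list (\<sigma> \<circ> \<tau>) ls)))"
  proof (rule sum.cong)
    fix \<sigma> assume s: "\<sigma> \<in> ?P"
    have "of_int (sign \<tau>) * of_int (sign (\<sigma> \<circ> \<tau>)) = (of_int (sign \<sigma>) :: complex)"
      using s t perm by (simp add: sign_compose mult.commute flip: of_int_mult)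
    then show "of_int (sign \<sigma>) * f (permute_list \<tau> (permute_list \<sigma> ls)) =
      of_int (sign \<tau>) * (of_int (sign (\<sigma> \<circ> \<tau>)) * f (permute_list (\<sigma> \<circ> \<tau>) ls))"
      using t by (simp add: permute_list_compose flip: mult.assoc)
  qed simp
  also have "\<dots> = of_int (sign \<tau>) * (\<Sum>\<sigma>\<in>?P. of_int (sign \<sigma>) * f (permute_list \<sigma> ls))"
    unfolding sum_distrib_left
    by (rule sum.reindex_bij_witness[of _ "\<lambda>\<sigma>. \<sigma> \<circ> inv \<tau>" "\<lambda>\<sigma>. \<sigma> \<circ> \<tau>"])
      (use t in \<open>auto simp: permutes_inv_o permutes_inv permutes_compose comp_assoc simp del: o_apply\<close>)
  finally show ?thesis by (simp add: alt_def)
qed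

lemma skew_alt: "skew (alt f)"
  unfolding skew_def
proof (intro allI)
  fix xs ys :: "'a list" and x y :: 'a
  have "Transposition.transpose (length xs) (Suc (length xs)) permutes {..<length (xs @ y # x # ys)}"
    by (rule adjacent_permutes) simp
  from alt_permute[OF this, of f] show "alt f (xs @ x # y # ys) = - alt f (xs @ y # x # ys)"
    by (simp add: permute_list_adjacent sign_swap_id)
qed

lemma alt_eq_iff_skew: "alt f = f \<longleftrightarrow> skew f"
proof
  show "skew f" if "alt f = f" using skew_alt[of f] that by simp
  show "alt f = f" if f: "skew f"
  proof
    fix ls :: "'a list"
    let ?P = "{\<sigma>. \<sigma> permutes {..<length ls}}"
    have "(\<Sum>\<sigma>\<in>?P. of_int (sign \<sigma>) * f (permute_list \<sigma> ls)) = (\<Sum>\<sigma>\<in>?P. f ls)"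
    proof (rule sum.cong)
      fix \<sigma> assume "\<sigma> \<in> ?P"
      moreover have "of_int (sign \<sigma>) * of_int (sign \<sigma>) = (1 :: complex)"
        by (simp flip: of_int_mult)
      ultimately show "of_int (sign \<sigma>) * f (permute_list \<sigma> ls) = f ls"
        using skew_permute[OF f] by (simp flip: mult.assoc)
    qed simp
    also have "\<dots> = fact (length ls) * f ls" by (simp add: card_permutations)
    finally show "alt f ls = f ls" by (simp add: alt_def)
  qed
qed

lemma alt_add: "alt (\<lambda>xs. f xs + g xs) ls = alt f ls + alt g ls"
  by (simp add: alt_def algebra_simps sum.distrib add_divide_distrib)

lemma alt_cmult: "alt (\<lambda>xs. c * f xs) ls = c * alt f ls"
  by (simp add: alt_def sum_distrib_left mult_ac)

lemma alt_sum: "alt (\<lambda>xs. \<Sum>i\<in>I. f i xs) ls = (\<Sum>i\<in>I. alt (f i) ls)"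
proof (cases "finite I")
  case True
  then show ?thesis
    by (induction I rule: finite_induct) (simp_all add: alt_add, simp add: alt_def)
qed (simp add: alt_def)


section \<open>The shuffle product\<close>

text \<open>
  Up to factors \<open>sqrt (fact n)\<close>, the products of the Grassmann algebra are antisymmetrised
  shuffle products.  The recursion below is the antiderivation rule for the contraction with the
  first argument.
\<close>

fun shuf :: "('a list \<Rightarrow> 'a list \<Rightarrow> complex) \<Rightarrow> 'a list \<Rightarrow> complex" where
  "shuf w [] = w [] []"
| "shuf w (x # xs) = shuf (\<lambda>a b. w (x # a) b) xs + shuf (\<lambda>a b. (- 1) ^ length a * w a (x # b)) xs"

lemma shuf_add: "shuf (\<lambda>a b. w a b + v a b) ls = shuf w ls + shuf v ls"
  by (induction ls arbitrary: w v) (simp_all add: distrib_left)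

lemma shuf_cmult: "shuf (\<lambda>a b. c * w a b) ls = c * shuf w ls"
proof (induction ls arbitrary: w)
  case (Cons x ls)
  have "shuf (\<lambda>a b. (- 1) ^ length a * (c * w a (x # b))) ls =
      shuf (\<lambda>a b. c * ((- 1) ^ length a * w a (x # b))) ls" by (simp add: mult_ac)
  then show ?case using Cons by (simp add: distrib_left)
qed simp

lemma shuf_uminus: "shuf (\<lambda>a b. - w a b) ls = - shuf w ls"
  using shuf_cmult[of "-1" w ls] by simp

lemma shuf_zero [simp]: "shuf (\<lambda>a b. 0) ls = 0"
  using shuf_cmult[of 0 "\<lambda>a b. 0" ls] by simp

text \<open>The inclusions serve \<open>wedge_orthogonal\<close>, the condition on the lengths
  serves \<open>wedge_degree\<close>.\<close>

lemma shuf_cong: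
  assumes "\<And>a b. length a + length b = length ls \<Longrightarrow> set a \<subseteq> set ls \<Longrightarrow> set b \<subseteq> set ls \<Longrightarrow>  w a b = v a b"
  shows "shuf w ls = shuf v ls"
  using assms
proof (induction ls arbitrary: w v)
  case (Cons x ls)
  have "shuf (\<lambda>a b. w (x # a) b) ls = shuf (\<lambda>a b. v (x # a) b) ls"
    by (rule Cons.IH, rule Cons.prems) auto
  moreover have "shuf (\<lambda>a b. (- 1) ^ length a * w a (x # b)) ls =
      shuf (\<lambda>a b. (- 1) ^ length a * v a (x # b)) ls"
    by (rule Cons.IH, subst Cons.prems) auto
  ultimately show ?case by simp
qed simp

lemma skewD: "skew f \<Longrightarrow> f (xs @ x # y # ys) = - f (xs @ y # x # ys)"
  unfolding skew_def by blast

lemma skew_Cons: "skew f \<Longrightarrow> skew (\<lambda>a. f (x # a))"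
  unfolding skew_def by (metis append_Cons)

lemma skew_weight:
  assumes "skew f"
  shows "skew (\<lambda>a. c (length a) * f a)"
  unfolding skew_def
proof (intro allI)
  fix xs x y ys
  show "c (length (xs @ x # y # ys)) * f (xs @ x # y # ys) =
      - (c (length (xs @ y # x # ys)) * f (xs @ y # x # ys))"
    using skewD[OF assms, of xs x y ys] by simp
qed

text \<open>Two leading arguments can be distributed over the two factors in four ways. When both go
  to the same factor the sign changes by hypothesis; the two mixed ways are interchanged with
  opposite signs, which come from the weight \<open>(- 1) ^ length a\<close>.\<close>

lemma skew_shuf:
  assumes "\<And>b. skew (\<lambda>a. w a b)" "\<And>a. skew (w a)"
  shows "skew (shuf w)"
proof -
  have "shuf w (xs @ x # y # ys) = - shuf w (xs @ y # x # ys)" for xs x y ys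
    using assms
  proof (induction xs arbitrary: w)
    case Nil
    have 1: "w (x # y # a) b = - w (y # x # a) b" for a b
      using skewD[OF Nil(1), of "[]" x y] by simp
    have 2: "w a (x # y # b) = - w a (y # x # b)" for a b
      using skewD[OF Nil(2), of _ "[]" x y] by simp
    have 3: "shuf (\<lambda>a. w (x # y # a)) ys = - shuf (\<lambda>a. w (y # x # a)) ys"
      unfolding shuf_uminus[symmetric] by (intro shuf_cong 1)
    show ?case
      by (simp add: 3 2 shuf_uminus)
  next
    case (Cons z xs)
    have "shuf (\<lambda>a b. w (z # a) b) (xs @ x # y # ys) = - shuf (\<lambda>a b. w (z # a) b) (xs @ y # x # ys)"
      by (rule Cons.IH) (auto intro: skew_Cons Cons.prems)
    moreover have "shuf (\<lambda>a b. (- 1) ^ length a * w a (z # b)) (xs @ x # y # ys) =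
       - shuf (\<lambda>a b. (- 1) ^ length a * w a (z # b)) (xs @ y # x # ys)"
    proof (rule Cons.IH)
      show "skew (\<lambda>a. (- 1) ^ length a * w a (z # b))" for b
        by (rule skew_weight[OF Cons.prems(1)])
      show "skew (\<lambda>b. (- 1) ^ length a * w a (z # b))" for a
        using skew_weight[OF skew_Cons[OF Cons.prems(2)], of "\<lambda>_. (-1) ^ length a"] .
    qed
    ultimately show ?case by simp
  qed
  then show ?thesis unfolding skew_def by blast
qed

text \<open>Antisymmetrising the tail beforehand averages over permutations that fix position 0. By
  \<open>alt_precompose\<close> each of them contributes the same value, its sign
  cancelling.\<close>

lemma alt_cons:
  assumes "length ls = Suc m"
  shows "alt (\<lambda>xs. alt (\<lambda>ys. f (hd xs # ys)) (tl xs)) ls = alt f ls"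
proof -
  let ?P = "{\<tau>. \<tau> permutes {..<m}}"
  \<comment> \<open>The permutation of the tail shifted up by one position, with 0 fixed.\<close>
  define up where "up \<tau> = map_permutation {..<m} Suc \<tau>" for \<tau>
  have up: "up \<tau> permutes {..<Suc m}" "sign (up \<tau>) = sign \<tau>" "up \<tau> 0 = 0"
    "\<And>i. i < m \<Longrightarrow> up \<tau> (Suc i) = Suc (\<tau> i)" if t: "\<tau> permutes {..<m}" for \<tau>
  proof -
    have "up \<tau> permutes Suc ` {..<m}" unfolding up_def
      by (rule map_permutation_permutes[OF _ t]) (auto simp: bij_betw_def)
    then show "up \<tau> permutes {..<Suc m}" by (rule permutes_subset) auto
    show "sign (up \<tau>) = sign \<tau>" unfolding up_def
      by (rule sign_map_permutation[OF _ t]) auto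
    show "up \<tau> 0 = 0" by (simp add: up_def map_permutation_def restrict_id_def)
    show "up \<tau> (Suc i) = Suc (\<tau> i)" if "i < m" for i
      using that by (auto simp: up_def map_permutation_def restrict_id_def)
  qed
  have hd: "hd xs # permute_list \<tau> (tl xs) = permute_list (up \<tau>) xs"
    if t: "\<tau> permutes {..<m}" and xs: "length xs = Suc m" for \<tau> and xs :: "'a list"
  proof (rule nth_equalityI)
    show "length (hd xs # permute_list \<tau> (tl xs)) = length (permute_list (up \<tau>) xs)" using xs by simp
    fix i assume i: "i < length (hd xs # permute_list \<tau> (tl xs))"
    obtain y ys where y: "xs = y # ys" using xs by (cases xs) auto
    show "(hd xs # permute_list \<tau> (tl xs)) ! i = permute_list (up \<tau>) xs ! i"
      using i xs up[OF t] t y by (cases i) (auto simp: permute_list_nth)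
  qed
  have "alt (\<lambda>xs. alt (\<lambda>ys. f (hd xs # ys)) (tl xs)) ls =
      alt (\<lambda>xs. (1 / fact m) * (\<Sum>\<tau>\<in>?P. of_int (sign \<tau>) * f (permute_list (up \<tau>) xs))) ls"
  proof (rule alt_cong)
    fix xs :: "'a list" assume xs: "length xs = length ls"
    then have l: "length (tl xs) = m" using assms by simp
    show "alt (\<lambda>ys. f (hd xs # ys)) (tl xs) =
      (1 / fact m) * (\<Sum>\<tau>\<in>?P. of_int (sign \<tau>) * f (permute_list (up \<tau>) xs))"
      unfolding alt_def l
      by (intro arg_cong2[where f = "(*)"] sum.cong refl) (use xs assms in \<open>simp add: hd\<close>)
  qed
  also have "\<dots> = (1 / fact m) * (\<Sum>\<tau>\<in>?P. of_int (sign \<tau>) * alt (\<lambda>xs. f (permute_list (up \<tau>) xs)) ls)"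
    by (simp only: alt_cmult alt_sum)
  also have "(\<Sum>\<tau>\<in>?P. of_int (sign \<tau>) * alt (\<lambda>xs. f (permute_list (up \<tau>) xs)) ls) =
      (\<Sum>\<tau>\<in>?P. alt f ls)"
  proof (rule sum.cong)
    fix \<tau> assume t: "\<tau> \<in> ?P"
    have "of_int (sign \<tau>) * of_int (sign \<tau>) = (1 :: complex)" by (simp flip: of_int_mult)
    then show "of_int (sign \<tau>) * alt (\<lambda>xs. f (permute_list (up \<tau>) xs)) ls = alt f ls"
      using up[of \<tau>] t assms by (simp add: alt_precompose flip: mult.assoc)
  qed simp
  also have "\<dots> = fact m * alt f ls" by (simp add: card_permutations)
  finally show ?thesis by simp
qed

text \<open>The head passes p entries, each by one adjacent transposition.\<close>

lemma alt_move:
  assumes "p < length ls"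
  shows "alt (\<lambda>zs. g (take p (tl zs) @ hd zs # drop p (tl zs))) ls = (- 1) ^ p * alt g ls"
  using assms
proof (induction p arbitrary: g)
  case 0
  have "alt (\<lambda>zs. g (hd zs # tl zs)) ls = alt g ls"
    by (rule alt_cong) (use 0 in \<open>metis length_greater_0_conv list.collapse\<close>)
  then show ?case by simp
next
  case (Suc p)
  let ?t = "Transposition.transpose p (Suc p)"
  have "alt (\<lambda>zs. g (take (Suc p) (tl zs) @ hd zs # drop (Suc p) (tl zs))) ls =
      alt (\<lambda>zs. g (permute_list ?t (take p (tl zs) @ hd zs # drop p (tl zs)))) ls"
  proof (rule alt_cong)
    fix xs :: "'a list" assume xs: "length xs = length ls"
    obtain z zs where z: "xs = z # zs" using xs Suc.prems by (cases xs) auto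
    have p: "p < length zs" using z xs Suc.prems by simp
    then have "drop p zs = zs ! p # drop (Suc p) zs" "take (Suc p) zs = take p zs @ [zs ! p]"
      by (simp_all add: Cons_nth_drop_Suc take_Suc_conv_app_nth)
    then show "g (take (Suc p) (tl xs) @ hd xs # drop (Suc p) (tl xs)) =
      g (permute_list ?t (take p (tl xs) @ hd xs # drop p (tl xs)))"
      using permute_list_adjacent[of "take p zs" z "zs ! p" "drop (Suc p) zs"] p z by simp
  qed
  also have "\<dots> = (- 1) ^ p * alt (\<lambda>zs. g (permute_list ?t zs)) ls"
    using Suc by simp
  also have "\<dots> = (- 1) ^ Suc p * alt g ls"
    using Suc.prems by (subst alt_precompose) (auto simp: adjacent_permutes sign_swap_id)
  finally show ?case .
qed

text \<open>Pascal's rule. With the head in the left block the recursion yields the split at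
  \<open>Suc p\<close>; with the head in the right block it yields the split at \<open>p\<close>,
  and there the sign of \<open>alt_move\<close> cancels the sign in \<open>shuf\<close>.\<close>

lemma alt_shuf:
  "alt (shuf w) ls = (\<Sum>p\<le>length ls. of_nat (length ls choose p) *
     alt (\<lambda>xs. w (take p xs) (drop p xs)) ls)"
proof (induction n \<equiv> "length ls" arbitrary: ls w)
  case 0
  then show ?case by (simp add: alt_def)
next
  case (Suc m)
  define A where "A p = alt (\<lambda>xs. w (take p xs) (drop p xs)) ls" for p
  have ls: "length ls = Suc m" using Suc by simp
  have 1: "alt (\<lambda>xs. alt (shuf (\<lambda>a b. w (hd xs # a) b)) (tl xs)) ls =
      (\<Sum>p\<le>m. of_nat (m choose p) * A (Suc p))"
  proof -
    have "alt (\<lambda>xs. alt (shuf (\<lambda>a b. w (hd xs # a) b)) (tl xs)) ls =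
        alt (\<lambda>xs. \<Sum>p\<le>m. of_nat (m choose p) *
          alt (\<lambda>ys. w (hd xs # take p ys) (drop p ys)) (tl xs)) ls"
      by (rule alt_cong) (subst Suc(1), use ls in auto)
    also have "\<dots> = (\<Sum>p\<le>m. of_nat (m choose p) *
          alt (\<lambda>xs. alt (\<lambda>ys. w (take (Suc p) (hd xs # ys)) (drop (Suc p) (hd xs # ys))) (tl xs)) ls)"
      by (simp add: alt_sum alt_cmult)
    finally show ?thesis
      using alt_cons[OF ls, of "\<lambda>zs. w (take (Suc _) zs) (drop (Suc _) zs)"]
      by (simp only: A_def)
  qed
  have 2: "alt (\<lambda>xs. alt (shuf (\<lambda>a b. (- 1) ^ length a * w a (hd xs # b))) (tl xs)) ls =
      (\<Sum>p\<le>m. of_nat (m choose p) * A p)"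
  proof -
    have "alt (\<lambda>xs. alt (shuf (\<lambda>a b. (- 1) ^ length a * w a (hd xs # b))) (tl xs)) ls =
        alt (\<lambda>xs. \<Sum>p\<le>m. of_nat (m choose p) *
          alt (\<lambda>ys. (- 1) ^ length (take p ys) * w (take p ys) (hd xs # drop p ys)) (tl xs)) ls"
      by (rule alt_cong) (subst Suc(1), use ls in auto)
    also have "\<dots> = (\<Sum>p\<le>m. of_nat (m choose p) *
          alt (\<lambda>xs. alt (\<lambda>ys. (- 1) ^ length (take p ys) * w (take p ys) (hd xs # drop p ys)) (tl xs)) ls)"
      by (simp add: alt_sum alt_cmult)
    also have "\<dots> = (\<Sum>p\<le>m. of_nat (m choose p) * A p)"
    proof (intro sum.cong refl arg_cong2[where f = "(*)"])
      fix p assume p: "p \<in> {..m}"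
      have "alt (\<lambda>xs. alt (\<lambda>ys. (- 1) ^ length (take p ys) * w (take p ys) (hd xs # drop p ys)) (tl xs)) ls
        = alt (\<lambda>xs. (- 1) ^ length (take p (tl xs)) * w (take p (tl xs)) (hd xs # drop p (tl xs))) ls"
        using alt_cons[OF ls, of "\<lambda>xs. (- 1) ^ length (take p (tl xs)) * w (take p (tl xs)) (hd xs # drop p (tl xs))"]
        by simp
      also have "\<dots> = alt (\<lambda>xs. (- 1) ^ p * (\<lambda>zs. w (take p zs) (drop p zs)) (take p (tl xs) @ hd xs # drop p (tl xs))) ls"
        by (rule alt_cong) (use p ls in \<open>auto simp: min_def\<close>)
      also have "\<dots> = A p" unfolding alt_cmult
        using p ls power_mult_distrib[of "-1 :: complex" "-1" p]
        by (subst alt_move) (auto simp: A_def simp flip: mult.assoc)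
      finally show "alt (\<lambda>xs. alt (\<lambda>ys. (- 1) ^ length (take p ys) * w (take p ys) (hd xs # drop p ys)) (tl xs)) ls = A p" .
    qed
    finally show ?thesis .
  qed
  have "alt (shuf w) ls = alt (\<lambda>xs. alt (\<lambda>ys. shuf w (hd xs # ys)) (tl xs)) ls"
    using alt_cons[OF ls] by metis
  also have "\<dots> = (\<Sum>p\<le>m. of_nat (m choose p) * A (Suc p)) + (\<Sum>p\<le>m. of_nat (m choose p) * A p)"
    by (simp add: alt_add 1 2)
  also have "(\<Sum>p\<le>m. of_nat (m choose p) * A p) = A 0 + (\<Sum>p\<le>m. of_nat (m choose Suc p) * A (Suc p))"
  proof -
    \<comment> \<open>The added term is zero since \<open>m choose Suc m\<close> is zero; the index
      shift then splits off \<open>A 0\<close>.\<close>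
    have "(\<Sum>p\<le>m. of_nat (m choose p) * A p) = (\<Sum>p\<le>Suc m. of_nat (m choose p) * A p)"
      by (simp add: binomial_eq_0)
    then show ?thesis by (simp only: sum.atMost_Suc_shift) simp
  qed
  also have "(\<Sum>p\<le>m. of_nat (m choose p) * A (Suc p)) + (A 0 + (\<Sum>p\<le>m. of_nat (m choose Suc p) * A (Suc p)))
     = (\<Sum>p\<le>Suc m. of_nat (Suc m choose p) * A p)"
    by (simp only: sum.atMost_Suc_shift) (simp add: sum.distrib algebra_simps)
  finally show ?case by (simp only: ls A_def)
qed

text \<open>The common form of \<open>grass_mult\<close> and \<open>slam_pair\<close>. The
  coefficient of a split is an arbitrary function of the two blocks, since in
  \<open>slam_pair\<close> it is a Fock pairing and not a product.\<close>

definition gpair :: "('a list \<Rightarrow> 'a list \<Rightarrow> complex) \<Rightarrow> 'a list \<Rightarrow> complex" where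
  "gpair w ls = (\<Sum>p\<le>length ls.
     complex_of_real (sqrt (fact (length ls) / (fact p * fact (length ls - p)))) *
     alt (\<lambda>xs. w (take p xs) (drop p xs)) ls)"

lemma grass_mult_gpair: "grass_mult l m = gpair (\<lambda>a b. l a * m b)"
  by (simp add: fun_eq_iff grass_mult_def gpair_def)

lemma slam_pair_gpair: "slam_pair J X Y = gpair (\<lambda>a b. fock_pair J (X a) (Y b))"
  by (simp add: fun_eq_iff slam_pair_def gpair_def)

definition rfac :: "'a list \<Rightarrow> complex" where
  "rfac ls = complex_of_real (sqrt (fact (length ls)))"

lemma rfac_nz [simp]: "rfac ls \<noteq> 0"
  by (simp add: rfac_def)

lemma rfac_sq: "rfac ls * rfac ls = fact (length ls)"
  unfolding rfac_def by (simp flip: of_real_mult)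

text \<open>The coefficient identity is (n choose p) sqrt (p!) sqrt ((n - p)!) = sqrt (n!) sqrt (n!
  / (p! (n - p)!)). Since the shuffle of skew forms is skew, \<open>alt\<close> can be inserted on
  the shuffle side and expanded by \<open>alt_shuf\<close>.\<close>

lemma gpair_shuf:
  assumes w: "\<And>b. skew (\<lambda>a. w a b)" "\<And>a. skew (w a)"
  shows "rfac ls * gpair w ls = shuf (\<lambda>a b. rfac a * rfac b * w a b) ls"
proof -
  let ?w = "\<lambda>a b. rfac a * rfac b * w a b"
  let ?n = "length ls"
  have s: "skew (shuf ?w)"
  proof (rule skew_shuf)
    show "skew (\<lambda>a. ?w a b)" for b
      using skew_weight[OF w(1), of "\<lambda>n. complex_of_real (sqrt (fact n)) * rfac b"]
      by (simp add: rfac_def)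
    show "skew (?w a)" for a
      using skew_weight[OF w(2), of "\<lambda>n. rfac a * complex_of_real (sqrt (fact n))"]
      by (simp add: rfac_def)
  qed
  have "shuf ?w ls = alt (shuf ?w) ls" by (simp only: iffD2[OF alt_eq_iff_skew s])
  also have "\<dots> = (\<Sum>p\<le>?n. of_nat (?n choose p) * alt (\<lambda>xs. ?w (take p xs) (drop p xs)) ls)"
    by (rule alt_shuf)
  also have "\<dots> = (\<Sum>p\<le>?n. rfac ls * (complex_of_real (sqrt (fact ?n / (fact p * fact (?n - p)))) *
     alt (\<lambda>xs. w (take p xs) (drop p xs)) ls))"
  proof (rule sum.cong)
    fix p assume p: "p \<in> {..?n}"
    have "alt (\<lambda>xs. ?w (take p xs) (drop p xs)) ls =
        alt (\<lambda>xs. complex_of_real (sqrt (fact p) * sqrt (fact (?n - p))) * w (take p xs) (drop p xs)) ls"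
      by (rule alt_cong) (use p in \<open>simp add: rfac_def min_def\<close>)
    moreover have "real (?n choose p) * (sqrt (fact p) * sqrt (fact (?n - p))) =
        sqrt (fact ?n) * sqrt (fact ?n / (fact p * fact (?n - p)))"
      using p by (simp add: binomial_fact real_sqrt_divide real_sqrt_mult field_simps)
    from arg_cong[OF this, of complex_of_real]
    have "of_nat (?n choose p) * complex_of_real (sqrt (fact p) * sqrt (fact (?n - p))) =
        rfac ls * complex_of_real (sqrt (fact ?n / (fact p * fact (?n - p))))"
      by (simp add: rfac_def del: real_sqrt_divide)
    ultimately show "of_nat (?n choose p) * alt (\<lambda>xs. ?w (take p xs) (drop p xs)) ls =
      rfac ls * (complex_of_real (sqrt (fact ?n / (fact p * fact (?n - p)))) *
       alt (\<lambda>xs. w (take p xs) (drop p xs)) ls)"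
      by (simp only: alt_cmult flip: mult.assoc)
  qed simp
  finally show ?thesis by (simp add: gpair_def sum_distrib_left)
qed

section \<open>The graded algebra of skew forms\<close>

definition wedge :: "('a list \<Rightarrow> complex) \<Rightarrow> ('a list \<Rightarrow> complex) \<Rightarrow> 'a list \<Rightarrow> complex" where
  "wedge f g = shuf (\<lambda>a b. f a * g b)"

lemma wedge_Nil: "wedge f g [] = f [] * g []"
  by (simp add: wedge_def)

lemma wedge_Cons:
  "wedge f g (x # xs) =
     wedge (\<lambda>a. f (x # a)) g xs + wedge (\<lambda>a. (- 1) ^ length a * f a) (\<lambda>b. g (x # b)) xs"
  by (simp add: wedge_def mult_ac)

lemma wedge_add_left: "wedge (\<lambda>a. f a + f' a) g ls = wedge f g ls + wedge f' g ls"
  by (simp add: wedge_def distrib_right shuf_add)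

lemma wedge_add_right: "wedge f (\<lambda>a. g a + g' a) ls = wedge f g ls + wedge f g' ls"
  by (simp add: wedge_def distrib_left shuf_add)

lemma wedge_cmult_left: "wedge (\<lambda>a. c * f a) g ls = c * wedge f g ls"
  by (simp add: wedge_def mult.assoc shuf_cmult)

lemma wedge_zero_left [simp]: "wedge (\<lambda>a. 0) g ls = 0"
  by (simp add: wedge_def)

lemma wedge_zero_right [simp]: "wedge f (\<lambda>a. 0) ls = 0"
  by (simp add: wedge_def)

text \<open>The degree involution is multiplicative. \<open>wedge_Cons\<close> applies it to the
  left factor, so associativity needs it on a product.\<close>

lemma wedge_degree:
  "(- 1) ^ length ls * wedge f g ls =
     wedge (\<lambda>a. (- 1) ^ length a * f a) (\<lambda>b. (- 1) ^ length b * g b) ls"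
proof -
  have "wedge (\<lambda>a. (- 1) ^ length a * f a) (\<lambda>b. (- 1) ^ length b * g b) ls =
      shuf (\<lambda>a b. (- 1) ^ length ls * (f a * g b)) ls"
    unfolding wedge_def by (rule shuf_cong) (simp add: power_add flip: mult.assoc, simp add: mult_ac flip: power_add)
  then show ?thesis by (simp add: shuf_cmult wedge_def)
qed

text \<open>Contracted with the leading argument, both sides give the same three terms, so induction
  on the argument list works for all functions on lists at once.\<close>

lemma wedge_assoc: "wedge (wedge f g) h ls = wedge f (wedge g h) ls"
proof (induction ls arbitrary: f g h)
  case Nil
  show ?case by (simp add: wedge_Nil)
next
  case (Cons x ls)
  have "wedge (wedge f g) h (x # ls) =
      wedge (\<lambda>a. wedge f g (x # a)) h ls + wedge (\<lambda>a. (- 1) ^ length a * wedge f g a) (\<lambda>b. h (x # b)) ls"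
    by (rule wedge_Cons)
  also have "\<dots> = wedge (wedge (\<lambda>a. f (x # a)) g) h ls +
      wedge (wedge (\<lambda>a. (- 1) ^ length a * f a) (\<lambda>b. g (x # b))) h ls +
      wedge (wedge (\<lambda>a. (- 1) ^ length a * f a) (\<lambda>b. (- 1) ^ length b * g b)) (\<lambda>b. h (x # b)) ls"
    by (simp only: wedge_Cons wedge_degree wedge_add_left)
  also have "\<dots> = wedge f (wedge g h) (x # ls)"
    by (simp only: Cons wedge_Cons wedge_add_right add.assoc)
  finally show ?case .
qed

definition has_parity :: "bit \<Rightarrow> ('a list \<Rightarrow> complex) \<Rightarrow> bool" where
  "has_parity k f \<longleftrightarrow> (\<forall>ls. f ls \<noteq> 0 \<longrightarrow> of_nat (length ls) = k)"

definition comm_sign :: "bit \<Rightarrow> bit \<Rightarrow> complex" where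
  "comm_sign k k' = (if k = 1 \<and> k' = 1 then - 1 else 1)"

lemma comm_sign_sq [simp]: "comm_sign k k' * comm_sign k k' = 1"
  by (simp add: comm_sign_def)

lemma comm_sign_commute: "comm_sign k k' = comm_sign k' k"
  by (simp add: comm_sign_def conj_commute)

lemma cnj_comm_sign [simp]: "cnj (comm_sign k k') = comm_sign k k'"
  by (simp add: comm_sign_def)

lemma has_parity_Cons:
  assumes "has_parity k f"
  shows "has_parity (k + 1) (\<lambda>a. f (x # a))"
  unfolding has_parity_def
proof (intro allI impI)
  fix a assume "f (x # a) \<noteq> 0"
  then have "of_nat (length (x # a)) = k" using assms unfolding has_parity_def by blast
  then show "of_nat (length a) = k + 1" by auto
qed

lemma has_parity_degree:
  assumes "has_parity k f"
  shows "(- 1) ^ length a * f a = (if k = 1 then - 1 else 1) * f a"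
proof (cases "f a = 0")
  case False
  then have k: "of_nat (length a) = k" using assms unfolding has_parity_def by blast
  have "(of_nat n :: bit) = (if even n then 0 else 1)" for n
    by (induction n) auto
  then have "k = (if even (length a) then 0 else 1)" using k by simp
  then show ?thesis by simp
qed simp

text \<open>Contraction flips the parity of one factor; the resulting change of
  \<open>comm_sign\<close> is compensated by the degree involution in
  \<open>wedge_Cons\<close>.\<close>

lemma wedge_comm:
  assumes "has_parity k f" "has_parity k' g"
  shows "wedge f g ls = comm_sign k k' * wedge g f ls"
  using assms
proof (induction ls arbitrary: f g k k')
  case Nil
  then show ?case
  proof (cases "f [] = 0 \<or> g [] = 0")
    case False
    then have "k = 0" "k' = 0" using Nil unfolding has_parity_def by force+
    then show ?thesis by (simp add: wedge_Nil comm_sign_def)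
  qed (auto simp: wedge_Nil)
next
  case (Cons x ls)
  have 1: "wedge (\<lambda>a. f (x # a)) g ls = comm_sign (k + 1) k' * wedge g (\<lambda>a. f (x # a)) ls"
    by (rule Cons.IH[OF has_parity_Cons]) (use Cons in auto)
  have 2: "wedge f (\<lambda>b. g (x # b)) ls = comm_sign k (k' + 1) * wedge (\<lambda>b. g (x # b)) f ls"
    by (rule Cons.IH[OF _ has_parity_Cons]) (use Cons in auto)
  have bit: "b = 0 \<or> b = 1" for b :: bit by (cases b) auto
  show ?case
    unfolding wedge_Cons has_parity_degree[OF Cons.prems(1)] has_parity_degree[OF Cons.prems(2)]
      wedge_cmult_left 1 2
    using bit[of k] bit[of k'] by (auto simp: comm_sign_def)
qed

text \<open>Degreewise rescaling that carries the Grassmann product to \<open>wedge\<close>. It is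
  injective, so identities for \<open>wedge\<close> pull back.\<close>

definition hat :: "('a list \<Rightarrow> complex) \<Rightarrow> 'a list \<Rightarrow> complex" where
  "hat l ls = rfac ls * l ls"

lemma hat_inject: "hat l = hat m \<longleftrightarrow> l = m"
  by (auto simp: hat_def fun_eq_iff)

lemma skew_gpair: "skew (gpair w)"
  unfolding skew_def
proof (intro allI)
  fix xs ys :: "'a list" and x y :: 'a
  show "gpair w (xs @ x # y # ys) = - gpair w (xs @ y # x # ys)"
    by (simp add: gpair_def skewD[OF skew_alt, of _ xs x y] flip: sum_negf)
qed

lemma skew_grass_mult: "skew (grass_mult l m)"
  by (simp add: grass_mult_gpair skew_gpair)

lemma skew_cmult: "skew f \<Longrightarrow> skew (\<lambda>a. c * f a)"
  using skew_weight[of f "\<lambda>_. c"] .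

lemma skew_mult_right: "skew f \<Longrightarrow> skew (\<lambda>a. f a * c)"
  using skew_cmult[of f c] by (simp add: mult.commute)

lemma hat_grass_mult:
  assumes "skew l" "skew m"
  shows "hat (grass_mult l m) = wedge (hat l) (hat m)"
proof
  fix ls
  have "hat (grass_mult l m) ls = shuf (\<lambda>a b. rfac a * rfac b * (l a * m b)) ls"
    unfolding hat_def grass_mult_gpair
    by (rule gpair_shuf) (intro skew_cmult skew_mult_right assms)+
  also have "\<dots> = wedge (hat l) (hat m) ls"
    by (simp add: wedge_def hat_def mult_ac)
  finally show "hat (grass_mult l m) ls = wedge (hat l) (hat m) ls" .
qed

lemma grass_mult_assoc:
  assumes "skew l" "skew m" "skew n"
  shows "grass_mult (grass_mult l m) n = grass_mult l (grass_mult m n)"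
proof -
  have "hat (grass_mult (grass_mult l m) n) = hat (grass_mult l (grass_mult m n))"
    using assms by (simp add: hat_grass_mult skew_grass_mult wedge_assoc fun_eq_iff)
  then show ?thesis by (simp only: hat_inject)
qed

lemma has_parity_hat: "has_parity k l \<Longrightarrow> has_parity k (hat l)"
  by (simp add: has_parity_def hat_def)

lemma grass_mult_comm:
  assumes "skew l" "skew m" "has_parity k l" "has_parity k' m"
  shows "grass_mult l m ls = comm_sign k k' * grass_mult m l ls"
proof -
  have "rfac ls * grass_mult l m ls = rfac ls * (comm_sign k k' * grass_mult m l ls)"
    using wedge_comm[OF assms(3,4)[THEN has_parity_hat], of ls]
      fun_cong[OF hat_grass_mult[OF assms(1,2)], of ls] fun_cong[OF hat_grass_mult[OF assms(2,1)], of ls]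
    by (simp add: hat_def)
  then show ?thesis by simp
qed

lemma skew_vac: "skew vac"
  by (simp add: skew_def vac_def)

lemma hat_vac: "hat vac = vac"
  by (auto simp: hat_def vac_def rfac_def fun_eq_iff)

lemma wedge_vac_left: "wedge vac f ls = f ls"
proof (induction ls arbitrary: f)
  case Nil
  show ?case by (simp add: wedge_Nil vac_def)
next
  case (Cons x ls)
  have "(\<lambda>a. (- 1) ^ length a * vac a) = (vac :: 'a list \<Rightarrow> complex)" by (auto simp: vac_def)
  then have "wedge vac f (x # ls) = wedge (\<lambda>a. 0) f ls + wedge vac (\<lambda>b. f (x # b)) ls"
    unfolding wedge_Cons by (simp add: vac_def)
  then show ?case by (simp add: Cons)
qed

lemma wedge_vac_right: "wedge f vac ls = f ls"
proof (induction ls arbitrary: f)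
  case Nil
  show ?case by (simp add: wedge_Nil vac_def)
next
  case (Cons x ls)
  have "wedge f vac (x # ls) = wedge (\<lambda>a. f (x # a)) vac ls + wedge (\<lambda>a. (- 1) ^ length a * f a) (\<lambda>b. 0) ls"
    unfolding wedge_Cons by (simp add: vac_def)
  then show ?case by (simp add: Cons)
qed

lemma grass_mult_vac:
  assumes "skew l"
  shows grass_mult_vac_left: "grass_mult vac l = l"
    and grass_mult_vac_right: "grass_mult l vac = l"
proof -
  have "hat (grass_mult vac l) = hat l" "hat (grass_mult l vac) = hat l"
    using assms by (simp_all add: hat_grass_mult skew_vac hat_vac wedge_vac_left wedge_vac_right fun_eq_iff)
  then show "grass_mult vac l = l" "grass_mult l vac = l" by (simp_all only: hat_inject)
qed

lemma gpair_add: "gpair (\<lambda>a b. w a b + v a b) ls = gpair w ls + gpair v ls"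
  by (simp add: gpair_def alt_add distrib_left sum.distrib)

lemma gpair_cmult: "gpair (\<lambda>a b. c * w a b) ls = c * gpair w ls"
  unfolding gpair_def sum_distrib_left by (rule sum.cong) (simp_all add: alt_cmult)

lemma grass_mult_add_left: "grass_mult (\<lambda>a. l a + l' a) m = (\<lambda>ls. grass_mult l m ls + grass_mult l' m ls)"
  by (simp add: grass_mult_gpair distrib_right gpair_add fun_eq_iff)

lemma grass_mult_add_right: "grass_mult l (\<lambda>a. m a + m' a) = (\<lambda>ls. grass_mult l m ls + grass_mult l m' ls)"
  by (simp add: grass_mult_gpair distrib_left gpair_add fun_eq_iff)

lemma grass_mult_cmult_left: "grass_mult (\<lambda>a. c * l a) m = (\<lambda>ls. c * grass_mult l m ls)"
  by (simp add: grass_mult_gpair mult.assoc gpair_cmult fun_eq_iff)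

lemma grass_mult_cmult_right: "grass_mult l (\<lambda>a. c * m a) = (\<lambda>ls. c * grass_mult l m ls)"
  by (simp add: grass_mult_gpair mult.left_commute[of _ c] gpair_cmult fun_eq_iff)

section \<open>Ordered products of Grassmann elements\<close>

definition gprod :: "('a list \<Rightarrow> complex) list \<Rightarrow> 'a list \<Rightarrow> complex" where
  "gprod ms = foldr grass_mult ms vac"

lemma gprod_simps [simp]: "gprod [] = vac" "gprod (m # ms) = grass_mult m (gprod ms)"
  by (simp_all add: gprod_def)

lemma skew_gprod: "skew (gprod ms)"
  by (cases ms) (simp_all add: skew_vac skew_grass_mult)

lemma gprod_append:
  assumes "\<And>m. m \<in> set ms \<Longrightarrow> skew m"
  shows "gprod (ms @ ms') = grass_mult (gprod ms) (gprod ms')"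
  using assms
  by (induction ms) (simp_all add: grass_mult_vac_left skew_gprod grass_mult_assoc)

lemma gprod_swap:
  assumes "skew l" "skew m" "has_parity k l" "has_parity k' m"
  shows "gprod (ms @ l # m # ms') ls = comm_sign k k' * gprod (ms @ m # l # ms') ls"
proof -
  have "grass_mult l (grass_mult m (gprod ms')) =
      (\<lambda>ls. comm_sign k k' * grass_mult m (grass_mult l (gprod ms')) ls)"
    using assms grass_mult_comm[OF assms, abs_def]
    by (simp add: skew_gprod grass_mult_cmult_left fun_eq_iff[of "grass_mult l m"]
        flip: grass_mult_assoc)
  then have "gprod (ms @ l # m # ms') = (\<lambda>ls. comm_sign k k' * gprod (ms @ m # l # ms') ls)"
    by (induction ms) (simp_all add: grass_mult_cmult_right)
  then show ?thesis by simp
qed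

lemma gprod_add:
  "gprod (ms @ (\<lambda>a. l a + l' a) # ms') ls = gprod (ms @ l # ms') ls + gprod (ms @ l' # ms') ls"
proof -
  have "gprod (ms @ (\<lambda>a. l a + l' a) # ms') = (\<lambda>ls. gprod (ms @ l # ms') ls + gprod (ms @ l' # ms') ls)"
    by (induction ms) (simp_all add: grass_mult_add_left grass_mult_add_right)
  then show ?thesis by simp
qed

lemma gprod_cmult: "gprod (ms @ (\<lambda>a. c * l a) # ms') ls = c * gprod (ms @ l # ms') ls"
proof -
  have "gprod (ms @ (\<lambda>a. c * l a) # ms') = (\<lambda>ls. c * gprod (ms @ l # ms') ls)"
    by (induction ms) (simp_all add: grass_mult_cmult_left grass_mult_cmult_right)
  then show ?thesis by simp
qed


section \<open>Antilinear forms\<close>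

lemma multi_antilinear_add:
  "multi_antilinear F \<Longrightarrow> F (xs @ (x + y) # ys) = F (xs @ x # ys) + F (xs @ y # ys)"
  by (simp add: multi_antilinear_def)

lemma multi_antilinear_scaleC:
  "multi_antilinear F \<Longrightarrow> F (xs @ (c *\<^sub>C x) # ys) = cnj c * F (xs @ x # ys)"
  by (simp add: multi_antilinear_def)

lemma multi_antilinear_zero:
  assumes "multi_antilinear F"
  shows "F (xs @ 0 # ys) = 0"
proof -
  have "F (xs @ (0 + 0) # ys) = F (xs @ 0 # ys) + F (xs @ 0 # ys)"
    by (rule multi_antilinear_add[OF assms])
  then show ?thesis by simp
qed

lemma multi_antilinear_Cons:
  assumes "multi_antilinear F"
  shows "multi_antilinear (\<lambda>a. F (x # a))"
  using assms unfolding multi_antilinear_def by (metis append_Cons)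

lemma multi_antilinear_weight:
  assumes "multi_antilinear F"
  shows "multi_antilinear (\<lambda>a. c (length a) * F a)"
  unfolding multi_antilinear_def
  by (simp add: multi_antilinear_add[OF assms] multi_antilinear_scaleC[OF assms] distrib_left)

lemma multi_antilinear_cmult: "multi_antilinear F \<Longrightarrow> multi_antilinear (\<lambda>a. c * F a)"
  using multi_antilinear_weight[of F "\<lambda>_. c"] .

lemma multi_antilinear_plus:
  assumes "multi_antilinear F" "multi_antilinear G"
  shows "multi_antilinear (\<lambda>a. F a + G a)"
  using assms unfolding multi_antilinear_def by (simp add: distrib_left)

lemma multi_antilinear_shuf:
  assumes "\<And>b. multi_antilinear (\<lambda>a. w a b)" "\<And>a. multi_antilinear (w a)"
  shows "multi_antilinear (shuf w)"
proof -
  have step: "multi_antilinear (\<lambda>a. w (z # a) b)" "multi_antilinear (w (z # a))"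
    "multi_antilinear (\<lambda>a. (- 1) ^ length a * w a (z # b))"
    "multi_antilinear (\<lambda>b. (- 1) ^ length a * w a (z # b))"
    if "\<And>b. multi_antilinear (\<lambda>a. w a b)" "\<And>a. multi_antilinear (w a)"
    for w :: "'a list \<Rightarrow> 'a list \<Rightarrow> complex" and z a b
    using that multi_antilinear_Cons[OF that(1)] multi_antilinear_Cons[OF that(2)]
      multi_antilinear_weight[OF that(1)] multi_antilinear_cmult by blast+
  have "shuf w (xs @ (x + y) # ys) = shuf w (xs @ x # ys) + shuf w (xs @ y # ys)" for xs x y ys
    using assms
  proof (induction xs arbitrary: w)
    case Nil
    have "w ((x + y) # a) b = w (x # a) b + w (y # a) b" "w a ((x + y) # b) = w a (x # b) + w a (y # b)" for a b
      using multi_antilinear_add[OF Nil(1), of "[]" x y] multi_antilinear_add[OF Nil(2), of _ "[]" x y]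
      by simp_all
    then have "(\<lambda>a. w ((x + y) # a)) = (\<lambda>a b. w (x # a) b + w (y # a) b)"
      "(\<lambda>a b. (- 1) ^ length a * w a ((x + y) # b)) =
       (\<lambda>a b. (- 1) ^ length a * w a (x # b) + (- 1) ^ length a * w a (y # b))"
      by (simp_all add: fun_eq_iff distrib_left)
    then show ?case by (simp add: shuf_add)
  next
    case (Cons z xs)
    show ?case using Cons.IH[OF step(1)[OF Cons.prems] step(2)[OF Cons.prems]]
        Cons.IH[OF step(3)[OF Cons.prems] step(4)[OF Cons.prems]] by simp
  qed
  moreover have "shuf w (xs @ (c *\<^sub>C x) # ys) = cnj c * shuf w (xs @ x # ys)" for xs x c ys
    using assms
  proof (induction xs arbitrary: w)
    case Nil
    have *: "w ((c *\<^sub>C x) # a) b = cnj c * w (x # a) b" "w a ((c *\<^sub>C x) # b) = cnj c * w a (x # b)" for a b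
      using multi_antilinear_scaleC[OF Nil(1), of "[]" c x] multi_antilinear_scaleC[OF Nil(2), of _ "[]" c x]
      by simp_all
    then have "(\<lambda>a. w ((c *\<^sub>C x) # a)) = (\<lambda>a b. cnj c * w (x # a) b)"
      "(\<lambda>a b. (- 1) ^ length a * w a ((c *\<^sub>C x) # b)) =
       (\<lambda>a b. cnj c * ((- 1) ^ length a * w a (x # b)))"
      by (simp_all add: fun_eq_iff)
    then show ?case by (simp add: shuf_cmult distrib_left)
  next
    case (Cons z xs)
    show ?case using Cons.IH[OF step(1)[OF Cons.prems] step(2)[OF Cons.prems]]
        Cons.IH[OF step(3)[OF Cons.prems] step(4)[OF Cons.prems]]
      by (simp add: distrib_left)
  qed
  ultimately show ?thesis unfolding multi_antilinear_def by blast
qed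

abbreviation pnorm :: "'a::real_normed_vector list \<Rightarrow> real" where
  "pnorm xs \<equiv> prod_list (map norm xs)"

text \<open>The constant depends only on \<open>c\<close> and the length. The factor
  \<open>r\<close> is there for the induction: fixing the leading argument x replaces it by
  \<open>r * norm x\<close>.\<close>

lemma shuf_bound:
  fixes c :: "nat \<Rightarrow> nat \<Rightarrow> real"
  shows "\<exists>C. \<forall>(w :: 'a list \<Rightarrow> 'a list \<Rightarrow> complex) r. 0 \<le> r \<longrightarrow> (\<forall>a b. norm (w a b) \<le> r * c (length a) (length b) *
       (pnorm a * pnorm b)) \<longrightarrow>
     (\<forall>ls. length ls = n \<longrightarrow> norm (shuf w ls) \<le> r * C * pnorm (ls :: 'a::real_normed_vector list))"
proof (induction n arbitrary: c)
  case 0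
  show ?case
  proof (rule exI[of _ "c 0 0"], intro allI impI)
    fix w :: "'a list \<Rightarrow> 'a list \<Rightarrow> complex" and r and ls :: "'a list"
    assume *: "\<forall>a b. norm (w a b) \<le> r * c (length a) (length b) *
       (pnorm a * pnorm b)" and ls: "length ls = 0"
    show "norm (shuf w ls) \<le> r * c 0 0 * pnorm ls"
      using *[THEN spec, of "[]", THEN spec, of "[]"] ls by simp
  qed
next
  case (Suc n)
  obtain C where C: "\<And>w r ls. 0 \<le> r \<Longrightarrow> (\<forall>a b. norm (w a b) \<le> r * c (Suc (length a)) (length b) *
       (pnorm a * pnorm b)) \<Longrightarrow> length ls = n \<Longrightarrow>
     norm (shuf w ls) \<le> r * C * pnorm (ls :: 'a list)"
    using Suc[of "\<lambda>m k. c (Suc m) k"] by blast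
  obtain C' where C': "\<And>w r ls. 0 \<le> r \<Longrightarrow> (\<forall>a b. norm (w a b) \<le> r * c (length a) (Suc (length b)) *
       (pnorm a * pnorm b)) \<Longrightarrow> length ls = n \<Longrightarrow>
     norm (shuf w ls) \<le> r * C' * pnorm (ls :: 'a list)"
    using Suc[of "\<lambda>m k. c m (Suc k)"] by blast
  show ?case
  proof (rule exI[of _ "C + C'"], intro allI impI)
    fix w :: "'a list \<Rightarrow> 'a list \<Rightarrow> complex" and r and ls :: "'a list"
    assume r: "0 \<le> r" and w: "\<forall>a b. norm (w a b) \<le> r * c (length a) (length b) *
       (pnorm a * pnorm b)" and ls: "length ls = Suc n"
    obtain x xs where x: "ls = x # xs" "length xs = n" using ls by (cases ls) auto
    have "norm (shuf (\<lambda>a b. w (x # a) b) xs) \<le> (r * norm x) * C * pnorm xs"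
    proof (rule C)
      show "\<forall>a b. norm (w (x # a) b) \<le> r * norm x * c (Suc (length a)) (length b) *
         (pnorm a * pnorm b)"
        using w[THEN spec, of "x # _"] by (simp add: mult_ac)
    qed (use r x in auto)
    moreover have "norm (shuf (\<lambda>a b. (- 1) ^ length a * w a (x # b)) xs) \<le>
        (r * norm x) * C' * pnorm xs"
    proof (rule C')
      show "\<forall>a b. norm ((- 1) ^ length a * w a (x # b)) \<le> r * norm x * c (length a) (Suc (length b)) *
         (pnorm a * pnorm b)"
        using w[THEN spec, THEN spec, of _ "x # _"] by (simp add: mult_ac norm_mult norm_power)
    qed (use r x in auto)
    moreover have "norm (shuf w ls) \<le> norm (shuf (\<lambda>a b. w (x # a) b) xs) +
        norm (shuf (\<lambda>a b. (- 1) ^ length a * w a (x # b)) xs)"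
      unfolding x by (simp add: norm_triangle_ineq)
    ultimately show "norm (shuf w ls) \<le> r * (C + C') * pnorm ls"
      by (simp add: x algebra_simps)
  qed
qed

section \<open>Graded symmetry\<close>

lemma bit_cases: "b = 0 \<or> b = (1::bit)"
  by (cases b) auto

lemma UNIV_bit: "(UNIV :: bit set) = {0, 1}"
  using bit_cases by auto

lemma finite_bit_lists [simp]: "finite {ks :: bit list. length ks = n}"
proof -
  have "finite (UNIV :: bit set)" by (simp add: UNIV_bit)
  from finite_lists_length_eq[OF this, of n] show ?thesis by simp
qed

lemma minus_one_power_toggle:
  assumes "finite A" "finite B" "A - {p} = B - {p}" "p \<in> A \<longleftrightarrow> p \<notin> B"
  shows "(- 1 :: complex) ^ card A = - ((- 1) ^ card B)"
proof (cases "p \<in> A")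
  case True
  have "card A = Suc (card (A - {p}))" by (rule card.remove[OF assms(1) True])
  moreover have "B - {p} = B" using True assms(4) by simp
  ultimately show ?thesis by (simp add: assms(3))
next
  case False
  then have "card B = Suc (card (B - {p}))" using card.remove[OF assms(2)] assms(4) by simp
  moreover have "A - {p} = A" using False by simp
  ultimately show ?thesis by (simp flip: assms(3))
qed

lemma sum_bit_lists_Suc:
  fixes f :: "bit list \<Rightarrow> complex"
  shows "(\<Sum>ks | length ks = Suc n. f ks) = (\<Sum>ks | length ks = n. f (0 # ks) + f (1 # ks))"
proof -
  have "{ks. length ks = Suc n} = (#) (0::bit) ` {ks. length ks = n} \<union> (#) 1 ` {ks. length ks = n}"
    (is "?L = ?A \<union> ?B")
    using bit_cases by (auto simp: length_Suc_conv)
  moreover have "sum f (?A \<union> ?B) = sum f ?A + sum f ?B"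
    by (rule sum.union_disjoint) auto
  ultimately show ?thesis by (simp add: sum.reindex sum.distrib)
qed

context
  fixes H E :: "bit \<Rightarrow> 'h::complex_hilbert set" and J :: "'h \<Rightarrow> 'h"
  assumes sh: "super_hilbert H E J"
begin

lemma orth_parity: "a \<in> H k \<Longrightarrow> b \<in> H k' \<Longrightarrow> k \<noteq> k' \<Longrightarrow> cinner a b = 0"
proof -
  have *: "\<And>a b. a \<in> H 0 \<Longrightarrow> b \<in> H 1 \<Longrightarrow> cinner a b = 0"
    using sh by (auto simp: super_hilbert_def orth_sum_def)
  assume "a \<in> H k" "b \<in> H k'" "k \<noteq> k'"
  then show ?thesis using * bit_cases[of k] bit_cases[of k'] cinner_commute[of a b] by auto
qed

lemma parity_decomp: obtains a b where "h = a + b" "a \<in> H 0" "b \<in> H 1"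
proof -
  have "h \<in> {a + b | a b. a \<in> H 0 \<and> b \<in> H 1}"
    using sh unfolding super_hilbert_def orth_sum_def by (metis UNIV_I)
  then show thesis using that by auto
qed

lemma cinner_diff_left: "cinner (x - y) (z::'h) = cinner x z - cinner y z"
  using cinner_add_left[of "x - y" y z] by simp

lemma cinner_eq_zero_parity:
  assumes "\<And>k f. f \<in> H k \<Longrightarrow> cinner d f = 0"
  shows "d = 0"
proof -
  obtain a b where "d = a + b" "a \<in> H 0" "b \<in> H 1" by (rule parity_decomp)
  then have "cinner d d = 0" using assms by (metis add.right_neutral cinner_add_right)
  then show ?thesis by (simp add: cinner_self)
qed

lemma hpart_parity: "h \<in> H k' \<Longrightarrow> hpart H k h = (if k = k' then h else 0)"
proof -
  assume h: "h \<in> H k'"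
  have "cinner (hpart H k h - (if k = k' then h else 0)) f = 0" if f: "f \<in> H k''" for k'' f
    using h f orth_parity[OF h f] by (auto simp: cinner_diff_left hpart_orth[OF sh f])
  from cinner_eq_zero_parity[OF this] show ?thesis by simp
qed

lemma hpart_sum: "hpart H 0 h + hpart H 1 h = h"
proof -
  have "cinner (hpart H 0 h + hpart H 1 h - h) f = 0" if f: "f \<in> H k" for k f
    using bit_cases[of k] by (auto simp: cinner_diff_left cinner_add_left hpart_orth[OF sh f])
  from cinner_eq_zero_parity[OF this] show ?thesis by simp
qed

text \<open>The prefix \<open>xs\<close> holds the arguments already split, so that the induction
  can proceed through the list.\<close>

lemma sum_hparts:
  assumes "multi_antilinear F"
  shows "(\<Sum>ks | length ks = length hs. F (xs @ map2 (hpart H) ks hs)) = F (xs @ hs)"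
proof (induction hs arbitrary: xs)
  case Nil
  show ?case by simp
next
  case (Cons h hs)
  have "(\<Sum>ks | length ks = length (h # hs). F (xs @ map2 (hpart H) ks (h # hs))) =
      (\<Sum>ks | length ks = length hs. F ((xs @ [hpart H 0 h]) @ map2 (hpart H) ks hs)) +
      (\<Sum>ks | length ks = length hs. F ((xs @ [hpart H 1 h]) @ map2 (hpart H) ks hs))"
    by (simp add: sum_bit_lists_Suc sum.distrib)
  also have "\<dots> = F (xs @ (hpart H 0 h + hpart H 1 h) # hs)"
    by (simp only: Cons multi_antilinear_add[OF assms]) simp
  finally show ?case by (simp add: hpart_sum)
qed

definition homog :: "bit list \<Rightarrow> 'h list \<Rightarrow> bool" where
  "homog ks hs \<longleftrightarrow> list_all2 (\<lambda>k h. h \<in> H k) ks hs"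

lemma homog_length: "homog ks hs \<Longrightarrow> length ks = length hs"
  by (simp add: homog_def list_all2_lengthD)

lemma homog_hparts: "length ks = length hs \<Longrightarrow> homog ks (map2 (hpart H) ks hs)"
  by (simp add: homog_def list_all2_conv_all_nth hpart_in[OF sh])

lemma homog_permute:
  assumes "homog ks hs" "\<sigma> permutes {..<length hs}"
  shows "homog (permute_list \<sigma> ks) (permute_list \<sigma> hs)"
  unfolding homog_def list_all2_conv_all_nth
proof (intro conjI allI impI)
  show "length (permute_list \<sigma> ks) = length (permute_list \<sigma> hs)"
    using homog_length[OF assms(1)] by simp
  fix i assume "i < length (permute_list \<sigma> ks)"
  then have i: "i < length ks" by simp
  then have "\<sigma> i < length ks" using permutes_in_image[OF assms(2), of i] homog_length[OF assms(1)] by simp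
  then have "hs ! \<sigma> i \<in> H (ks ! \<sigma> i)" using assms(1) by (simp add: homog_def list_all2_conv_all_nth)
  then show "permute_list \<sigma> hs ! i \<in> H (permute_list \<sigma> ks ! i)"
    using i assms(2) homog_length[OF assms(1)] by (simp add: permute_list_nth)
qed

lemma map2_hpart_homog:
  assumes "homog ks hs"
  shows "map2 (hpart H) ks hs = hs"
  using assms unfolding homog_def
  by (induction rule: list_all2_induct) (simp_all add: hpart_parity)

text \<open>Composition with the adjacent transposition affects the inversion relation only at the
  pair of positions that \<open>q\<close> sends to \<open>i\<close> and \<open>Suc i\<close>. That
  pair enters or leaves the set of odd inversions exactly when both entries are odd.\<close>

lemma koszul_adjacent:
  assumes q: "q permutes {..<length ks}" and i: "Suc i < length ks"
  shows "koszul (Transposition.transpose i (Suc i) \<circ> q) ks =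
    comm_sign (ks ! i) (ks ! Suc i) * koszul q (permute_list (Transposition.transpose i (Suc i)) ks)"
proof -
  let ?t = "Transposition.transpose i (Suc i)"
  let ?n = "length ks"
  have t: "?t permutes {..<?n}" by (rule adjacent_permutes[OF i])
  have qi: "inv q permutes {..<?n}" by (rule permutes_inv[OF q])
  have lt: "q x < ?n \<longleftrightarrow> x < ?n" "inv q x < ?n \<longleftrightarrow> x < ?n" for x
    using permutes_in_image[OF q, of x] permutes_in_image[OF qi, of x] by auto
  have inv: "q (inv q x) = x" "inv q (q x) = x" for x using permutes_inverses[OF q] by auto
  define A where "A = {(a, b). a < b \<and> b < ?n \<and> ?t (q b) < ?t (q a) \<and> ks ! ?t (q a) = 1 \<and> ks ! ?t (q b) = 1}"
  define B where "B = {(a, b). a < b \<and> b < ?n \<and> q b < q a \<and> ks ! ?t (q a) = 1 \<and> ks ! ?t (q b) = 1}"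
  define a0 where "a0 = min (inv q i) (inv q (Suc i))"
  define b0 where "b0 = max (inv q i) (inv q (Suc i))"
  have fin: "finite A" "finite B"
    by (rule finite_subset[of _ "{..<?n} \<times> {..<?n}"]; auto simp: A_def B_def)+
  have ne: "inv q i \<noteq> inv q (Suc i)" using inv(1)[of i] inv(1)[of "Suc i"] by auto
  have ab: "a0 < b0" "b0 < ?n" using ne i lt(2)[of i] lt(2)[of "Suc i"] by (auto simp: a0_def b0_def)
  have qab: "(q a0 = i \<and> q b0 = Suc i) \<or> (q a0 = Suc i \<and> q b0 = i)"
    unfolding a0_def b0_def using ne by (cases "inv q i < inv q (Suc i)") (auto simp: inv min_def max_def)
  have eq: "(a, b) \<in> A \<longleftrightarrow> (a, b) \<in> B" if ne: "(a, b) \<noteq> (a0, b0)" for a b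
  proof (cases "a < b \<and> b < ?n")
    case True
    have "\<not> (q a = i \<and> q b = Suc i) \<and> \<not> (q a = Suc i \<and> q b = i)"
    proof (rule ccontr)
      assume "\<not> ?thesis"
      then have "(a = inv q i \<and> b = inv q (Suc i)) \<or> (a = inv q (Suc i) \<and> b = inv q i)"
        using inv(2)[of a] inv(2)[of b] by auto
      then show False using ne True by (auto simp: a0_def b0_def min_def max_def)
    qed
    moreover have "q a \<noteq> q b" using True inv(2)[of a] inv(2)[of b] by auto
    ultimately have "?t (q b) < ?t (q a) \<longleftrightarrow> q b < q a"
      by (auto simp: Transposition.transpose_def)
    then show ?thesis by (simp add: A_def B_def)
  qed (auto simp: A_def B_def)
  define pr where "pr = (a0, b0)"
  have eq': "z \<in> A \<longleftrightarrow> z \<in> B" if "z \<noteq> pr" for z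
    using eq[of "fst z" "snd z"] that by (simp add: pr_def)
  have AB: "A - {pr} = B - {pr}" using eq' by auto
  have k1: "koszul (?t \<circ> q) ks = (- 1) ^ card A"
    by (simp add: koszul_def A_def)
  have k2: "koszul q (permute_list ?t ks) = (- 1) ^ card B"
  proof -
    have "{(a, b). a < b \<and> b < length (permute_list ?t ks) \<and> q b < q a \<and>
        permute_list ?t ks ! q a = 1 \<and> permute_list ?t ks ! q b = 1} = B"
      by (auto simp: B_def permute_list_nth[OF t] lt)
    then show ?thesis by (simp add: koszul_def)
  qed
  show ?thesis
  proof (cases "ks ! i = 1 \<and> ks ! Suc i = 1")
    case True
    have "pr \<in> A \<longleftrightarrow> pr \<notin> B"
      using qab ab True unfolding pr_def A_def B_def mem_Collect_eq prod.case by auto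
    from minus_one_power_toggle[OF fin AB this] show ?thesis
      unfolding k1 k2 using True by (simp add: comm_sign_def)
  next
    case False
    have "pr \<notin> A" "pr \<notin> B"
      using qab False unfolding pr_def A_def B_def mem_Collect_eq prod.case by auto
    then have "A = B" using AB by (simp add: set_eq_iff)
    then show ?thesis unfolding k1 k2 using False by (simp add: comm_sign_def)
  qed
qed

lemma koszul_sq [simp]: "koszul \<sigma> ks * koszul \<sigma> ks = 1"
  unfolding koszul_def power_mult_distrib[symmetric] by simp

lemma koszul_id [simp]: "koszul id ks = 1"
proof -
  have "{(i, j). i < j \<and> j < length ks \<and> id j < id i \<and> ks ! id i = 1 \<and> ks ! id j = 1} = {}" by auto
  then show ?thesis unfolding koszul_def by (simp only: card.empty) simp
qed

text \<open>Only entries of definite parity are tested, where the sign is determined. For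
  multi-antilinear forms the expansion into homogeneous parts covers all other arguments, see
  \<open>sym_proj_eq_iff_graded_sym\<close>.\<close>

definition graded_sym :: "('h list \<Rightarrow> complex) \<Rightarrow> bool" where
  "graded_sym F \<longleftrightarrow> (\<forall>xs ys x y k k'. set xs \<subseteq> H 0 \<union> H 1 \<longrightarrow> set ys \<subseteq> H 0 \<union> H 1 \<longrightarrow>
     x \<in> H k \<longrightarrow> y \<in> H k' \<longrightarrow> F (xs @ x # y # ys) = comm_sign k k' * F (xs @ y # x # ys))"

lemma homog_split:
  assumes "homog ks (xs @ x # y # ys)"
  shows "set xs \<subseteq> H 0 \<union> H 1" "set ys \<subseteq> H 0 \<union> H 1"
    "x \<in> H (ks ! length xs)" "y \<in> H (ks ! Suc (length xs))"
proof -
  have *: "(xs @ x # y # ys) ! i \<in> H (ks ! i)" if "i < length (xs @ x # y # ys)" for i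
    using assms that by (auto simp: homog_def list_all2_conv_all_nth)
  have H: "h \<in> H 0 \<union> H 1" if "h \<in> H k" for h k using that bit_cases[of k] by auto
  show "set xs \<subseteq> H 0 \<union> H 1"
  proof
    fix z assume "z \<in> set xs"
    then obtain i where "i < length xs" "z = xs ! i" by (auto simp: in_set_conv_nth)
    then show "z \<in> H 0 \<union> H 1" using *[of i] H by (simp add: nth_append)
  qed
  show "set ys \<subseteq> H 0 \<union> H 1"
  proof
    fix z assume "z \<in> set ys"
    then obtain i where "i < length ys" "z = ys ! i" by (auto simp: in_set_conv_nth)
    then show "z \<in> H 0 \<union> H 1" using *[of "length xs + Suc (Suc i)"] H by (simp add: nth_append)
  qed
  show "x \<in> H (ks ! length xs)" "y \<in> H (ks ! Suc (length xs))"
    using *[of "length xs"] *[of "Suc (length xs)"] by (simp_all add: nth_append)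
qed

lemma graded_sym_permute:
  assumes F: "graded_sym F" and hs: "homog ks hs" and p: "\<sigma> permutes {..<length hs}"
  shows "F (permute_list \<sigma> hs) = koszul \<sigma> ks * F hs"
proof -
  have "\<forall>ks hs. length hs = n \<longrightarrow> homog ks hs \<longrightarrow> F (permute_list \<sigma> hs) = koszul \<sigma> ks * F hs"
    if "\<sigma> permutes {..<n}" for n
    using that
  proof (induction rule: permutes_adjacent_induct)
    case id
    then show ?case by (simp add: koszul_id[unfolded id_def])
  next
    case (adjacent i q)
    show ?case
    proof (intro allI impI)
      fix ks hs assume l: "length hs = n" and h: "homog ks hs"
      let ?t = "Transposition.transpose i (Suc i)"
      obtain xs x y ys where *: "hs = xs @ x # y # ys" "length xs = i"
        using split_adjacent adjacent l by metis
      have t: "?t permutes {..<length hs}" by (rule adjacent_permutes) (use adjacent l in simp)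
      have th: "permute_list ?t hs = xs @ y # x # ys"
        using permute_list_adjacent[of xs x y ys] * by simp
      have "F (permute_list (?t \<circ> q) hs) = F (permute_list q (permute_list ?t hs))"
        using adjacent l by (simp add: permute_list_compose)
      also have "\<dots> = koszul q (permute_list ?t ks) * F (permute_list ?t hs)"
        using adjacent l homog_permute[OF h t] by simp
      also have "F (permute_list ?t hs) = comm_sign (ks ! i) (ks ! Suc i) * F hs"
        using F homog_split[OF h[unfolded *(1)]] unfolding th unfolding * graded_sym_def
        by (metis comm_sign_commute *(2))
      also have "koszul q (permute_list ?t ks) * (comm_sign (ks ! i) (ks ! Suc i) * F hs) =
          koszul (?t \<circ> q) ks * F hs"
        using koszul_adjacent[of q ks i] adjacent homog_length[OF h] l by (simp del: o_apply)
      finally show "F (permute_list (?t \<circ> q) hs) = koszul (?t \<circ> q) ks * F hs" .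
    qed
  qed
  then show ?thesis using p hs by blast
qed

text \<open>Any parity word other than \<open>ks\<close> makes some \<open>hpart\<close> of the
  arguments zero, and a multi-antilinear form vanishes there.\<close>

lemma sym_proj_homog:
  assumes F: "multi_antilinear F" and hs: "homog ks hs"
  shows "sym_proj H F hs = (1 / fact (length hs)) *
    (\<Sum>\<sigma> | \<sigma> permutes {..<length hs}. koszul \<sigma> ks * F (permute_list \<sigma> hs))"
proof -
  have "(\<Sum>qs | length qs = length hs. koszul \<sigma> qs * F (permute_list \<sigma> (map2 (hpart H) qs hs))) =
      koszul \<sigma> ks * F (permute_list \<sigma> hs)" if s: "\<sigma> permutes {..<length hs}" for \<sigma>
  proof -
    have "koszul \<sigma> qs * F (permute_list \<sigma> (map2 (hpart H) qs hs)) =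
       (if qs = ks then koszul \<sigma> ks * F (permute_list \<sigma> hs) else 0)" if l: "length qs = length hs" for qs
    proof (cases "qs = ks")
      case True
      then show ?thesis using map2_hpart_homog[OF hs] by simp
    next
      case False
      then obtain j where j: "j < length hs" "qs ! j \<noteq> ks ! j"
        using l homog_length[OF hs] by (auto simp: list_eq_iff_nth_eq)
      have "hs ! j \<in> H (ks ! j)" using hs j homog_length[OF hs]
        by (simp add: homog_def list_all2_conv_all_nth)
      then have z: "map2 (hpart H) qs hs ! j = 0" using j l by (simp add: hpart_parity)
      have "0 \<in> set (permute_list \<sigma> (map2 (hpart H) qs hs))"
        using z j l s set_permute_list[of \<sigma> "map2 (hpart H) qs hs"] by (metis length_map length_zip min.idem nth_mem)
      then obtain as bs where "permute_list \<sigma> (map2 (hpart H) qs hs) = as @ 0 # bs"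
        by (meson split_list)
      then show ?thesis using False by (simp add: multi_antilinear_zero[OF F])
    qed
    then have "(\<Sum>qs | length qs = length hs. koszul \<sigma> qs * F (permute_list \<sigma> (map2 (hpart H) qs hs))) =
      (\<Sum>qs | length qs = length hs. if qs = ks then koszul \<sigma> ks * F (permute_list \<sigma> hs) else 0)"
      by (intro sum.cong) auto
    then show ?thesis using homog_length[OF hs] by (simp add: sum.delta)
  qed
  then show ?thesis unfolding sym_proj_def by (auto intro!: sum.cong)
qed

text \<open>One direction translates the sum over permutations by an adjacent transposition and
  takes the sign from \<open>koszul_adjacent\<close>. The other splits the arguments into
  homogeneous parts; in each summand the sign in \<open>sym_proj\<close> meets the equal sign from
  \<open>graded_sym_permute\<close>, and the product is 1.\<close>

lemma sym_proj_eq_iff_graded_sym: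
  assumes F: "multi_antilinear F"
  shows "sym_proj H F = F \<longleftrightarrow> graded_sym F"
proof
  assume eq: "sym_proj H F = F"
  show "graded_sym F" unfolding graded_sym_def
  proof (intro allI impI)
    fix xs ys x y k k'
    assume xs: "set xs \<subseteq> H 0 \<union> H 1" "set ys \<subseteq> H 0 \<union> H 1" and x: "x \<in> H k" and y: "y \<in> H k'"
    have ex: "\<exists>ks. homog ks zs" if "set zs \<subseteq> H 0 \<union> H 1" for zs
      using that unfolding homog_def
    proof (induction zs)
      case (Cons z zs)
      then obtain ks where "list_all2 (\<lambda>k h. h \<in> H k) ks zs" by auto
      moreover obtain k where "z \<in> H k" using Cons by auto
      ultimately show ?case by (intro exI[of _ "k # ks"]) simp
    qed simp
    obtain ks ks' where ks: "homog ks xs" "homog ks' ys" using ex xs by blast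
    let ?hs = "xs @ y # x # ys" and ?ks = "ks @ k' # k # ks'"
    let ?i = "length xs"
    let ?t = "Transposition.transpose ?i (Suc ?i)"
    have h: "homog ?ks ?hs" using ks x y by (auto simp: homog_def intro!: list_all2_appendI)
    have t: "?t permutes {..<length ?hs}" by (rule adjacent_permutes) simp
    let ?P = "{\<sigma>. \<sigma> permutes {..<length ?hs}}"
    have "F (xs @ x # y # ys) = F (permute_list ?t ?hs)" by (simp add: permute_list_adjacent)
    also have "\<dots> = sym_proj H F (permute_list ?t ?hs)" by (simp only: eq)
    also have "\<dots> = (1 / fact (length ?hs)) *
        (\<Sum>\<sigma>\<in>?P. koszul \<sigma> (permute_list ?t ?ks) * F (permute_list \<sigma> (permute_list ?t ?hs)))"
      using sym_proj_homog[OF F homog_permute[OF h t]] by simp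
    also have "(\<Sum>\<sigma>\<in>?P. koszul \<sigma> (permute_list ?t ?ks) * F (permute_list \<sigma> (permute_list ?t ?hs))) =
       (\<Sum>\<sigma>\<in>?P. comm_sign k k' * (koszul (?t \<circ> \<sigma>) ?ks * F (permute_list (?t \<circ> \<sigma>) ?hs)))"
    proof (rule sum.cong)
      fix \<sigma> assume s: "\<sigma> \<in> ?P"
      have len: "length ?ks = length ?hs" using homog_length[OF h] by simp
      have "?ks ! ?i = k'" "?ks ! Suc ?i = k" using homog_length[OF ks(1)] by (simp_all add: nth_append)
      then have "koszul (?t \<circ> \<sigma>) ?ks = comm_sign k k' * koszul \<sigma> (permute_list ?t ?ks)"
        using koszul_adjacent[of \<sigma> ?ks ?i] s len by (simp add: comm_sign_commute del: o_apply)
      then have "koszul \<sigma> (permute_list ?t ?ks) = comm_sign k k' * koszul (?t \<circ> \<sigma>) ?ks"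
        by (simp del: o_apply flip: mult.assoc)
      moreover have "permute_list \<sigma> (permute_list ?t ?hs) = permute_list (?t \<circ> \<sigma>) ?hs"
        using s by (simp add: permute_list_compose)
      ultimately show "koszul \<sigma> (permute_list ?t ?ks) * F (permute_list \<sigma> (permute_list ?t ?hs)) =
         comm_sign k k' * (koszul (?t \<circ> \<sigma>) ?ks * F (permute_list (?t \<circ> \<sigma>) ?hs))"
        by (simp del: o_apply)
    qed simp
    also have "\<dots> = comm_sign k k' * (\<Sum>\<sigma>\<in>?P. koszul \<sigma> ?ks * F (permute_list \<sigma> ?hs))"
      unfolding sum_distrib_left
      by (rule sum.reindex_bij_witness[of _ "\<lambda>\<sigma>. inv ?t \<circ> \<sigma>" "\<lambda>\<sigma>. ?t \<circ> \<sigma>"])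
        (use t in \<open>auto simp: permutes_inv_o permutes_inv permutes_compose o_assoc simp del: o_apply inv_transpose_eq\<close>)
    also have "(1 / fact (length ?hs)) * \<dots> = comm_sign k k' * F ?hs"
      using sym_proj_homog[OF F h] eq by simp
    finally show "F (xs @ x # y # ys) = comm_sign k k' * F (xs @ y # x # ys)" .
  qed
next
  assume gs: "graded_sym F"
  show "sym_proj H F = F"
  proof
    fix hs :: "'h list"
    have "sym_proj H F hs = (1 / fact (length hs)) *
        (\<Sum>\<sigma> | \<sigma> permutes {..<length hs}. \<Sum>ks | length ks = length hs. F ([] @ map2 (hpart H) ks hs))"
      unfolding sym_proj_def
    proof (intro arg_cong2[where f = "(*)"] sum.cong refl)
      fix \<sigma> and ks :: "bit list"
      assume *: "\<sigma> \<in> {\<sigma>. \<sigma> permutes {..<length hs}}" "ks \<in> {ks. length ks = length hs}"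
      have "F (permute_list \<sigma> (map2 (hpart H) ks hs)) = koszul \<sigma> ks * F (map2 (hpart H) ks hs)"
        by (rule graded_sym_permute[OF gs homog_hparts]) (use * in auto)
      then show "koszul \<sigma> ks * F (permute_list \<sigma> (map2 (hpart H) ks hs)) = F ([] @ map2 (hpart H) ks hs)"
        by (simp flip: mult.assoc)
    qed
    also have "\<dots> = F hs"
      unfolding sum_hparts[OF F] by (simp add: card_permutations)
    finally show "sym_proj H F hs = F hs" .
  qed
qed

end

section \<open>Sums of nonnegative terms\<close>

text \<open>In \<open>ennreal\<close> every family is summable, so sums can be interchanged freely;
  \<open>summable_iff_esum\<close> returns to real series.\<close>

lemma esummable: "f summable_on A" for f :: "_ \<Rightarrow> ennreal"
  by (rule nonneg_summable_on_complete) simp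

lemma esum_SUP: "infsum f A = (SUP F\<in>{F. finite F \<and> F \<subseteq> A}. (sum f F :: ennreal))"
  by (rule nonneg_infsum_complete) auto

lemma esum_mono: "(\<And>x. x \<in> A \<Longrightarrow> f x \<le> g x) \<Longrightarrow> infsum f A \<le> infsum g A"
  for f g :: "_ \<Rightarrow> ennreal"
  by (intro infsum_mono esummable)

lemma esum_finite_le: "finite F \<Longrightarrow> F \<subseteq> A \<Longrightarrow> sum f F \<le> infsum f A"
  for f :: "_ \<Rightarrow> ennreal"
  unfolding esum_SUP by (rule SUP_upper) auto

lemma esum_cmult: "infsum (\<lambda>x. c * f x) A = c * infsum f A"
  for f :: "_ \<Rightarrow> ennreal"
proof -
  have "(SUP F\<in>{F. finite F \<and> F \<subseteq> A}. c * sum f F) = c * (SUP F\<in>{F. finite F \<and> F \<subseteq> A}. sum f F)"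
    by (rule SUP_mult_left_ennreal[symmetric])
  then show ?thesis by (simp add: esum_SUP sum_distrib_left)
qed

lemma esum_cmult_right: "infsum (\<lambda>x. f x * c) A = infsum f A * c"
  for f :: "_ \<Rightarrow> ennreal"
  using esum_cmult[of c f A] by (simp add: mult.commute)

lemma esum_add: "infsum (\<lambda>x. f x + g x) A = infsum f A + infsum g A"
  for f g :: "_ \<Rightarrow> ennreal"
  by (intro infsum_add esummable)

lemma esum_Sigma_finite:
  fixes f :: "_ \<Rightarrow> ennreal"
  assumes "finite X"
  shows "infsum f (Sigma X B) = (\<Sum>x\<in>X. infsum (\<lambda>y. f (x, y)) (B x))"
  using assms
proof induction
  case (insert x X)
  have "Sigma (insert x X) B = Pair x ` B x \<union> Sigma X B" by auto
  then have "infsum f (Sigma (insert x X) B) = infsum f (Pair x ` B x) + infsum f (Sigma X B)"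
    unfolding \<open>Sigma (insert x X) B = Pair x ` B x \<union> Sigma X B\<close>
    by (intro infsum_Un_disjoint esummable) (use insert in auto)
  also have "infsum f (Pair x ` B x) = infsum (\<lambda>y. f (x, y)) (B x)"
    by (subst infsum_reindex) (auto simp: inj_on_def o_def)
  finally show ?case using insert by simp
qed simp

text \<open>A finite set of pairs lies over finitely many indices, so each side is approximated from
  the other through \<open>esum_Sigma_finite\<close>.\<close>

lemma esum_Sigma:
  "infsum f (Sigma A B) = infsum (\<lambda>x. infsum (\<lambda>y. f (x, y)) (B x)) A" for f :: "_ \<Rightarrow> ennreal"
proof (rule antisym)
  show "infsum f (Sigma A B) \<le> infsum (\<lambda>x. infsum (\<lambda>y. f (x, y)) (B x)) A"
    unfolding esum_SUP[of f]
  proof (rule SUP_least)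
    fix F assume "F \<in> {F. finite F \<and> F \<subseteq> Sigma A B}"
    then have F: "finite F" "F \<subseteq> Sigma A B" by auto
    have "sum f F \<le> infsum f (Sigma (fst ` F) B)" by (rule esum_finite_le) (use F in force)+
    also have "\<dots> = (\<Sum>x\<in>fst ` F. infsum (\<lambda>y. f (x, y)) (B x))"
      by (rule esum_Sigma_finite) (use F in auto)
    also have "\<dots> \<le> infsum (\<lambda>x. infsum (\<lambda>y. f (x, y)) (B x)) A"
      by (rule esum_finite_le) (use F in auto)
    finally show "sum f F \<le> infsum (\<lambda>x. infsum (\<lambda>y. f (x, y)) (B x)) A" .
  qed
  show "infsum (\<lambda>x. infsum (\<lambda>y. f (x, y)) (B x)) A \<le> infsum f (Sigma A B)"
    unfolding esum_SUP[of _ A]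
  proof (rule SUP_least)
    fix X assume "X \<in> {X. finite X \<and> X \<subseteq> A}"
    then have X: "finite X" "X \<subseteq> A" by auto
    have "(\<Sum>x\<in>X. infsum (\<lambda>y. f (x, y)) (B x)) = infsum f (Sigma X B)"
      by (rule esum_Sigma_finite[OF X(1), symmetric])
    also have "\<dots> \<le> infsum f (Sigma A B)"
      by (intro infsum_mono_neutral esummable) (use X in auto)
    finally show "(\<Sum>x\<in>X. infsum (\<lambda>y. f (x, y)) (B x)) \<le> infsum f (Sigma A B)" .
  qed
qed

lemma esum_swap:
  "infsum (\<lambda>x. infsum (f x) B) A = infsum (\<lambda>y. infsum (\<lambda>x. f x y) A) B" for f :: "_ \<Rightarrow> _ \<Rightarrow> ennreal"
proof -
  have "infsum (\<lambda>x. infsum (f x) B) A = infsum (\<lambda>z. f (fst z) (snd z)) (A \<times> B)"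
    by (simp add: esum_Sigma)
  also have "\<dots> = infsum (\<lambda>z. f (snd z) (fst z)) (B \<times> A)"
    by (rule infsum_reindex_bij_witness[of _ prod.swap prod.swap]) auto
  also have "\<dots> = infsum (\<lambda>y. infsum (\<lambda>x. f x y) A) B"
    by (simp add: esum_Sigma)
  finally show ?thesis .
qed

lemma esum_ennreal:
  assumes "\<And>x. x \<in> A \<Longrightarrow> 0 \<le> f x" "f summable_on A"
  shows "infsum (\<lambda>x. ennreal (f x)) A = ennreal (infsum f A)"
proof -
  have "ennreal (infsum f A) = (SUP F\<in>{F. finite F \<and> F \<subseteq> A}. ennreal (sum f F))"
    by (rule infsum_nonneg_is_SUPREMUM_ennreal) (use assms in auto)
  also have "\<dots> = (SUP F\<in>{F. finite F \<and> F \<subseteq> A}. sum (\<lambda>x. ennreal (f x)) F)"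
    by (intro SUP_cong refl) (use assms in \<open>auto intro!: sum_ennreal[symmetric]\<close>)
  finally show ?thesis by (simp add: esum_SUP)
qed

lemma summable_iff_esum:
  assumes nn: "\<And>x. x \<in> A \<Longrightarrow> 0 \<le> f x"
  shows "f summable_on A \<longleftrightarrow> infsum (\<lambda>x. ennreal (f x)) A < top"
proof
  show "infsum (\<lambda>x. ennreal (f x)) A < top" if "f summable_on A"
    using esum_ennreal[OF nn that] by simp
  assume *: "infsum (\<lambda>x. ennreal (f x)) A < top"
  define C where "C = enn2real (infsum (\<lambda>x. ennreal (f x)) A)"
  have C0: "0 \<le> C" by (simp add: C_def)
  have "sum f F \<le> C" if F: "F \<subseteq> A" "finite F" for F
  proof -
    have "ennreal (sum f F) = (\<Sum>x\<in>F. ennreal (f x))" using F nn by (intro sum_ennreal[symmetric]) auto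
    also have "\<dots> \<le> infsum (\<lambda>x. ennreal (f x)) A" by (rule esum_finite_le) (use F in auto)
    also have "\<dots> = ennreal C" unfolding C_def by (rule ennreal_enn2real[OF *, symmetric])
    finally show ?thesis using C0 by (simp add: ennreal_le_iff)
  qed
  then show "f summable_on A" by (intro nonneg_bdd_above_summable_on nn) (auto intro!: bdd_aboveI)
qed

lemma l2_product_summable:
  fixes f g :: "'a \<Rightarrow> complex"
  assumes "(\<lambda>x. (cmod (f x))\<^sup>2) summable_on A" "(\<lambda>x. (cmod (g x))\<^sup>2) summable_on A"
  shows "(\<lambda>x. norm (f x * g x)) summable_on A"
  by (rule abs_summable_product)
    (use assms in \<open>simp_all add: norm_mult norm_power flip: power2_eq_square\<close>)

lemma cauchy_schwarz_infsum:
  fixes f g :: "'a \<Rightarrow> complex"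
  assumes f: "(\<lambda>x. (cmod (f x))\<^sup>2) summable_on A" and g: "(\<lambda>x. (cmod (g x))\<^sup>2) summable_on A"
  shows "cmod (infsum (\<lambda>x. f x * g x) A) \<le>
    sqrt (infsum (\<lambda>x. (cmod (f x))\<^sup>2) A) * sqrt (infsum (\<lambda>x. (cmod (g x))\<^sup>2) A)"
proof -
  have s: "(\<lambda>x. norm (f x * g x)) summable_on A" by (rule l2_product_summable[OF f g])
  have "cmod (infsum (\<lambda>x. f x * g x) A) \<le> infsum (\<lambda>x. cmod (f x * g x)) A"
    by (rule norm_infsum_bound[OF s])
  also have "\<dots> \<le> sqrt (infsum (\<lambda>x. (cmod (f x))\<^sup>2) A) * sqrt (infsum (\<lambda>x. (cmod (g x))\<^sup>2) A)"
  proof (rule infsum_le_finite_sums[OF s])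
    fix F assume F: "finite F" "F \<subseteq> A"
    have "(\<Sum>x\<in>F. cmod (f x * g x)) = (\<Sum>x\<in>F. \<bar>cmod (f x)\<bar> * \<bar>cmod (g x)\<bar>)"
      by (simp add: norm_mult)
    also have "\<dots> \<le> L2_set (\<lambda>x. cmod (f x)) F * L2_set (\<lambda>x. cmod (g x)) F"
      by (rule L2_set_mult_ineq)
    also have "\<dots> \<le> sqrt (infsum (\<lambda>x. (cmod (f x))\<^sup>2) A) * sqrt (infsum (\<lambda>x. (cmod (g x))\<^sup>2) A)"
      unfolding L2_set_def
      by (intro mult_mono real_sqrt_le_mono finite_sum_le_infsum f g F)
        (auto intro!: real_sqrt_ge_zero infsum_nonneg sum_nonneg)
    finally show "(\<Sum>x\<in>F. cmod (f x * g x)) \<le>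
       sqrt (infsum (\<lambda>x. (cmod (f x))\<^sup>2) A) * sqrt (infsum (\<lambda>x. (cmod (g x))\<^sup>2) A)" .
  qed
  finally show ?thesis .
qed


section \<open>Orthonormal bases\<close>

lemma scaleC_one [simp]: "1 *\<^sub>C x = (x :: 'a::complex_hilbert)"
  using scaleR_scaleC[of 1 x] by simp

lemma cinner_sum_right: "cinner x (\<Sum>i\<in>I. f i) = (\<Sum>i\<in>I. cinner x (f i :: 'a::complex_hilbert))"
  by (induction I rule: infinite_finite_induct) (simp_all add: cinner_add_right)

lemma cinner_sum_left: "cinner (\<Sum>i\<in>I. f i) x = (\<Sum>i\<in>I. cinner (f i :: 'a::complex_hilbert) x)"
  by (induction I rule: infinite_finite_induct) (simp_all add: cinner_add_left)

lemma cinner_diff_right: "cinner x (y - z) = cinner x y - cinner x (z :: 'a::complex_hilbert)"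
  using cinner_add_right[of x "y - z" z] by simp

lemma norm_scaleC: "norm (c *\<^sub>C x) = cmod c * norm (x :: 'a::complex_hilbert)"
proof -
  have "complex_of_real ((norm (c *\<^sub>C x))\<^sup>2) = (cnj c * c) * complex_of_real ((norm x)\<^sup>2)"
    unfolding cinner_self[symmetric] by (simp add: cinner_scaleC_left cinner_scaleC_right)
  also have "cnj c * c = complex_of_real ((cmod c)\<^sup>2)"
    by (metis complex_norm_square mult.commute)
  finally have "(norm (c *\<^sub>C x))\<^sup>2 = (cmod c * norm x)\<^sup>2"
    by (simp only: power_mult_distrib of_real_mult[symmetric] of_real_eq_iff)
  then show ?thesis by simp
qed

lemma cinner_bound: "cmod (cinner x y) \<le> norm x * norm (y :: 'a::complex_hilbert)"
proof (cases "cinner x y = 0")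
  case False
  \<comment> \<open>The unimodular factor makes the inner product real, so that the real
    Cauchy-Schwarz inequality applies.\<close>
  define c where "c = cnj (cinner x y) / complex_of_real (cmod (cinner x y))"
  have c: "cmod c = 1" using False by (simp add: c_def norm_divide)
  have "cinner x (c *\<^sub>C y) = complex_of_real (cmod (cinner x y))"
    using False by (simp add: c_def cinner_scaleC_right power2_eq_square complex_norm_square[symmetric]
        mult.commute[of "cnj _"] del: of_real_power flip: of_real_mult of_real_divide)
  then have "cmod (cinner x y) = inner x (c *\<^sub>C y)" by (simp add: inner_cinner)
  also have "\<dots> \<le> norm x * norm (c *\<^sub>C y)" by (rule norm_cauchy_schwarz)
  finally show ?thesis by (simp add: norm_scaleC c)
qed simp

lemma bounded_linear_cinner: "bounded_linear (cinner (x :: 'a::complex_hilbert))"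
proof (rule bounded_linear_intro)
  show "cinner x (y + z) = cinner x y + cinner x z" for y z by (rule cinner_add_right)
  show "cinner x (r *\<^sub>R y) = r *\<^sub>R cinner x y" for r y
    by (simp add: scaleR_scaleC cinner_scaleC_right scaleR_conv_of_real)
  show "norm (cinner x y) \<le> norm y * norm x" for y
    using cinner_bound[of x y] by (simp add: mult.commute)
qed

lemma norm_sum_onb:
  assumes B: "is_onb B" and F: "finite F" "F \<subseteq> B"
  shows "(norm (\<Sum>b\<in>F. a b *\<^sub>C b))\<^sup>2 = (\<Sum>b\<in>F. (cmod (a b))\<^sup>2)"
proof -
  have "cinner (\<Sum>b\<in>F. a b *\<^sub>C b) (\<Sum>b\<in>F. a b *\<^sub>C b) =
      (\<Sum>b\<in>F. \<Sum>c\<in>F. cnj (a b) * (a c * cinner b c))"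
    unfolding cinner_sum_left
    by (simp add: cinner_sum_right cinner_scaleC_left cinner_scaleC_right mult.left_commute sum_distrib_left)
  also have "\<dots> = (\<Sum>b\<in>F. \<Sum>c\<in>F. if b = c then cnj (a b) * a b else 0)"
    by (intro sum.cong refl) (use B F in \<open>auto simp: is_onb_def subset_iff\<close>)
  also have "\<dots> = (\<Sum>b\<in>F. cnj (a b) * a b)" using F by simp
  also have "\<dots> = complex_of_real (\<Sum>b\<in>F. (cmod (a b))\<^sup>2)"
    by (simp add: complex_norm_square mult.commute del: of_real_power)
  finally show ?thesis by (simp only: cinner_self of_real_eq_iff)
qed

text \<open>By orthonormality the squared norm of a difference of nested partial sums is a piece of
  the scalar series, so the net of partial sums is Cauchy.\<close>

lemma onb_summable:
  assumes B: "is_onb B" and a: "(\<lambda>b. (cmod (a b))\<^sup>2) summable_on B"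
  shows "(\<lambda>b. a b *\<^sub>C b) summable_on (B :: 'a::complex_hilbert set)"
proof -
  let ?f = "\<lambda>b. a b *\<^sub>C b" and ?g = "\<lambda>b. (cmod (a b))\<^sup>2"
  have Cauchy: "\<exists>P. eventually P (finite_subsets_at_top B) \<and>
      (\<forall>F F'. P F \<and> P F' \<longrightarrow> dist (sum ?f F) (sum ?f F') < e)" if e: "e > 0" for e
  proof -
    define d where "d = (e / 2)\<^sup>2"
    have "d > 0" using e by (simp add: d_def)
    from infsum_finite_approximation[OF a, of "d / 2"] obtain F0
      where F0: "finite F0" "F0 \<subseteq> B" "dist (sum ?g F0) (infsum ?g B) \<le> d / 2" using \<open>d > 0\<close> by auto
    define P where "P F \<longleftrightarrow> finite F \<and> F0 \<subseteq> F \<and> F \<subseteq> B" for F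
    have ev: "eventually P (finite_subsets_at_top B)"
      unfolding eventually_finite_subsets_at_top P_def using F0 by blast
    have half: "dist (sum ?f F) (sum ?f F0) < e / 2" if P: "P F" for F
    proof -
      have F: "finite F" "F0 \<subseteq> F" "F \<subseteq> B" using P by (auto simp: P_def)
      have "(dist (sum ?f F) (sum ?f F0))\<^sup>2 = (norm (sum ?f (F - F0)))\<^sup>2"
        unfolding dist_norm using F by (subst sum_diff) auto
      also have "\<dots> = sum ?g (F - F0)" by (rule norm_sum_onb[OF B]) (use F in auto)
      also have "\<dots> = sum ?g F - sum ?g F0" using F by (subst sum_diff) auto
      also have "\<dots> \<le> infsum ?g B - sum ?g F0"
        using finite_sum_le_infsum[OF a F(1,3)] by simp
      also have "\<dots> < (e / 2)\<^sup>2" using F0(3) \<open>d > 0\<close> unfolding dist_real_def d_def by arith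
      finally show ?thesis by (rule power2_less_imp_less) (use e in simp)
    qed
    have "dist (sum ?f F) (sum ?f F') < e" if "P F \<and> P F'" for F F'
      by (rule dist_triangle_half_l[OF half half]) (use that in auto)
    then show ?thesis using ev by blast
  qed
  have "cauchy_filter (filtermap (sum ?f) (finite_subsets_at_top B))"
    unfolding cauchy_filter_metric_filtermap by (intro allI impI, rule Cauchy)
  moreover have "complete (UNIV::'a set)"
    by (rule complete_UNIV)
  ultimately obtain L' where "(sum ?f \<longlongrightarrow> L') (finite_subsets_at_top B)"
    using complete_uniform[where S=UNIV] by (force simp add: filterlim_def)
  then show ?thesis using summable_on_def has_sum_def by blast
qed

lemma bessel:
  assumes B: "is_onb B"
  shows "(\<lambda>b. (cmod (cinner b x))\<^sup>2) summable_on (B :: 'a::complex_hilbert set)"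
proof (rule nonneg_bdd_above_summable_on)
  have "(\<Sum>b\<in>F. (cmod (cinner b x))\<^sup>2) \<le> (norm x)\<^sup>2" if F: "F \<subseteq> B" "finite F" for F
  proof -
    \<comment> \<open>The truncated expansion of x; the inequality comes from the squared norm of x
      - y being nonnegative.\<close>
    define y where "y = (\<Sum>b\<in>F. cinner b x *\<^sub>C b)"
    have "cinner y y = complex_of_real (\<Sum>b\<in>F. (cmod (cinner b x))\<^sup>2)"
      using norm_sum_onb[OF B F(2,1), of "\<lambda>b. cinner b x"] by (simp add: cinner_self y_def)
    moreover have "cinner y x = complex_of_real (\<Sum>b\<in>F. (cmod (cinner b x))\<^sup>2)"
      by (simp add: y_def cinner_sum_left cinner_scaleC_left complex_norm_square mult.commute del: of_real_power)
    ultimately have "inner y y = (\<Sum>b\<in>F. (cmod (cinner b x))\<^sup>2)" "inner y x = (\<Sum>b\<in>F. (cmod (cinner b x))\<^sup>2)"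
      by (simp_all add: inner_cinner)
    moreover have "0 \<le> inner (x - y) (x - y)" by simp
    ultimately show ?thesis
      by (simp add: inner_diff_left inner_diff_right inner_commute power2_norm_eq_inner)
  qed
  then show "bdd_above (sum (\<lambda>b. (cmod (cinner b x))\<^sup>2) ` {F. F \<subseteq> B \<and> finite F})"
    by (intro bdd_aboveI[of _ "(norm x)\<^sup>2"]) auto
qed simp

lemma cinner_onb_sum:
  assumes B: "is_onb B" and a: "((\<lambda>b. a b *\<^sub>C b) has_sum y) B" and c: "c \<in> B"
  shows "cinner c y = a c"
proof -
  have "((\<lambda>b. cinner c (a b *\<^sub>C b)) has_sum cinner c y) B"
    using has_sum_bounded_linear[OF bounded_linear_cinner a] .
  moreover have "((\<lambda>b. cinner c (a b *\<^sub>C b)) has_sum a c) B"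
  proof -
    have *: "cinner c (a b *\<^sub>C b) = (if b = c then a c else 0)" if "b \<in> B" for b
      using B c that by (auto simp: cinner_scaleC_right is_onb_def)
    have "((\<lambda>b. if b = c then a c else 0) has_sum a c) B"
      by (rule has_sum_finite_neutralI[of "{c}"]) (use c in auto)
    then show ?thesis by (subst has_sum_cong[OF *])
  qed
  ultimately show ?thesis by (rule has_sum_unique)
qed

text \<open>Bessel's inequality makes the series converge, and the difference between x and its sum
  is orthogonal to the whole basis.\<close>

lemma onb_expansion:
  assumes B: "is_onb B"
  shows "((\<lambda>b. cinner b x *\<^sub>C b) has_sum x) (B :: 'a::complex_hilbert set)"
proof -
  obtain y where y: "((\<lambda>b. cinner b x *\<^sub>C b) has_sum y) B"
    using onb_summable[OF B bessel[OF B]] summable_on_def by blast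
  have "cinner b (x - y) = 0" if "b \<in> B" for b
    using cinner_onb_sum[OF B y that] by (simp add: cinner_diff_right)
  then have "x - y = 0" using B unfolding is_onb_def by blast
  then show ?thesis using y by simp
qed

lemma cinner_expansion:
  assumes B: "is_onb B"
  shows "((\<lambda>b. cinner x b * cinner b y) has_sum cinner x y) (B :: 'a::complex_hilbert set)"
  using has_sum_bounded_linear[OF bounded_linear_cinner onb_expansion[OF B, of y], of x]
  by (simp add: cinner_scaleC_right mult.commute)

lemma parseval:
  assumes B: "is_onb B"
  shows "((\<lambda>b. (cmod (cinner b x))\<^sup>2) has_sum (norm x)\<^sup>2) (B :: 'a::complex_hilbert set)"
proof -
  have "((\<lambda>b. complex_of_real ((cmod (cinner b x))\<^sup>2)) has_sum complex_of_real ((norm x)\<^sup>2)) B"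
    using cinner_expansion[OF B, of x x] unfolding cinner_self
    by (subst has_sum_cong[where g = "\<lambda>b. cinner x b * cinner b x"])
      (simp_all add: complex_norm_square cinner_commute[of x] mult.commute del: of_real_power)
  then show ?thesis by (simp only: has_sum_of_real_iff)
qed

lemma riesz:
  assumes add: "\<And>x y. f (x + y) = f x + f y" and scale: "\<And>c x. f (c *\<^sub>C x) = cnj c * f x"
    and bound: "\<And>x. cmod (f x) \<le> C * norm x"
  shows "\<exists>u :: 'a::complex_hilbert. \<forall>x. f x = cinner x u"
proof -
  have B: "is_onb (onb :: 'a set)" by (rule is_onb_onb)
  have f0: "f 0 = 0" using add[of 0 0] by simp
  have fsum: "f (\<Sum>i\<in>I. g i) = (\<Sum>i\<in>I. f (g i))" for g and I :: "'a set"
    by (induction I rule: infinite_finite_induct) (simp_all add: add f0)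
  have "(\<lambda>b. (cmod (f b))\<^sup>2) summable_on (onb :: 'a set)"
  proof (rule nonneg_bdd_above_summable_on)
    have "(\<Sum>b\<in>F. (cmod (f b))\<^sup>2) \<le> C\<^sup>2" if F: "F \<subseteq> onb" "finite F" for F :: "'a set"
    proof -
      \<comment> \<open>Testing \<open>f\<close> on its own truncated representing vector: the
        squared norm of u equals the modulus of f u, which is at most C times the norm of u. The
        bound on the coefficients is thus independent of F.\<close>
      define u where "u = (\<Sum>b\<in>F. f b *\<^sub>C b)"
      have n: "(norm u)\<^sup>2 = (\<Sum>b\<in>F. (cmod (f b))\<^sup>2)" unfolding u_def by (rule norm_sum_onb[OF B F(2,1)])
      have "f u = complex_of_real (\<Sum>b\<in>F. (cmod (f b))\<^sup>2)"
        by (simp add: u_def fsum scale complex_norm_square mult.commute del: of_real_power)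
      then have "(norm u)\<^sup>2 = cmod (f u)" unfolding n by (simp only: norm_of_real) (simp add: sum_nonneg)
      also have "\<dots> \<le> C * norm u" by (rule bound)
      finally have "norm u = 0 \<or> norm u \<le> C" by (auto simp: power2_eq_square mult_le_cancel_right)
      then have "(norm u)\<^sup>2 \<le> C\<^sup>2" by (auto intro: power_mono)
      then show ?thesis by (simp add: n)
    qed
    then show "bdd_above (sum (\<lambda>b. (cmod (f b))\<^sup>2) ` {F. F \<subseteq> onb \<and> finite F})"
      by (intro bdd_aboveI[of _ "C\<^sup>2"]) auto
  qed simp
  then obtain u where u: "((\<lambda>b. f b *\<^sub>C b) has_sum u) onb"
    using onb_summable[OF B] summable_on_def by blast
  have C: "cmod (f x) \<le> \<bar>C\<bar> * norm x" for x
    using bound[of x] by (meson abs_ge_self mult_right_mono norm_ge_zero order_trans)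
  have "f x = cinner x u" for x
  proof -
    \<comment> \<open>The conjugate is linear, so it commutes with the convergent basis
      expansion.\<close>
    have "bounded_linear (\<lambda>x. cnj (f x))"
    proof (rule bounded_linear_intro)
      show "cnj (f (x + y)) = cnj (f x) + cnj (f y)" for x y by (simp add: add)
      show "cnj (f (r *\<^sub>R x)) = r *\<^sub>R cnj (f x)" for r x
        by (simp add: scaleR_scaleC scale scaleR_conv_of_real)
      show "norm (cnj (f x)) \<le> norm x * C" for x using bound by (simp add: mult.commute)
    qed
    from has_sum_bounded_linear[OF this onb_expansion[OF B, of x]]
    have "((\<lambda>b. cnj (f (cinner b x *\<^sub>C b))) has_sum cnj (f x)) onb" .
    then have "((\<lambda>b. cnj (cinner x b * f b)) has_sum cnj (f x)) onb"
      by (simp add: scale cinner_commute[of _ x])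
    then have "((\<lambda>b. cinner x b * f b) has_sum f x) onb" by (simp only: has_sum_cnj_iff)
    moreover have "((\<lambda>b. cinner x (f b *\<^sub>C b)) has_sum cinner x u) onb"
      using has_sum_bounded_linear[OF bounded_linear_cinner u] .
    then have "((\<lambda>b. cinner x b * f b) has_sum cinner x u) onb"
      by (simp add: cinner_scaleC_right mult.commute)
    ultimately show ?thesis by (rule has_sum_unique)
  qed
  then show ?thesis by blast
qed

lemma infinite_onb:
  assumes "infinite_dimensional TYPE('a::complex_hilbert)"
  shows "infinite (onb :: 'a set)"
proof
  assume fin: "finite (onb :: 'a set)"
  interpret cm: module "scaleC :: complex \<Rightarrow> 'a \<Rightarrow> 'a"
    by unfold_locales (simp_all add: scaleC_add_right scaleC_add_left scaleC_scaleC)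
  have "x \<in> cm.span onb" for x :: 'a
  proof -
    have "x = (\<Sum>b\<in>onb. cinner b x *\<^sub>C b)"
      using onb_expansion[OF is_onb_onb, of x] fin by (metis has_sum_finite has_sum_unique)
    also have "\<dots> \<in> cm.span onb" by (intro cm.span_sum cm.span_scale cm.span_base)
    finally show ?thesis .
  qed
  then have "cm.span (onb :: 'a set) = UNIV" by blast
  then show False using assms fin unfolding infinite_dimensional_def by blast
qed

section \<open>Hilbert--Schmidt forms\<close>

definition bform :: "('a::complex_hilbert list \<Rightarrow> complex) \<Rightarrow> bool" where
  "bform F \<longleftrightarrow> multi_antilinear F \<and> bounded_form F"

lemma bform_Cons:
  assumes "bform F"
  shows "bform (\<lambda>a. F (x # a))"
proof -
  have "\<exists>C. \<forall>xs. length xs = n \<longrightarrow> cmod (F (x # xs)) \<le> C * pnorm xs" for n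
  proof -
    obtain C where "\<And>xs. length xs = Suc n \<Longrightarrow> cmod (F xs) \<le> C * pnorm xs"
      using assms unfolding bform_def bounded_form_def by blast
    from this[of "x # _"] show ?thesis by (intro exI[of _ "C * norm x"]) (simp add: mult_ac)
  qed
  then show ?thesis using assms by (simp add: bform_def bounded_form_def multi_antilinear_Cons)
qed

text \<open>Fixing all arguments but the leading one leaves a vector, so basis independence, bounds
  and expansions can be proved one slot at a time.\<close>

lemma bform_riesz:
  assumes F: "bform F"
  obtains u where "\<And>x. F (x # ys) = cinner x u"
proof -
  obtain C where C: "\<And>xs. length xs = Suc (length ys) \<Longrightarrow> cmod (F xs) \<le> C * pnorm xs"
    using F unfolding bform_def bounded_form_def by blast
  have m: "multi_antilinear F" using F by (simp add: bform_def)
  have "\<exists>u. \<forall>x. F (x # ys) = cinner x u"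
  proof (rule riesz)
    show "F ((x + y) # ys) = F (x # ys) + F (y # ys)" for x y
      using multi_antilinear_add[OF m, of "[]"] by simp
    show "F ((c *\<^sub>C x) # ys) = cnj c * F (x # ys)" for c x
      using multi_antilinear_scaleC[OF m, of "[]"] by simp
    show "cmod (F (x # ys)) \<le> (C * pnorm ys) * norm x" for x
      using C[of "x # ys"] by (simp add: mult_ac)
  qed
  then show thesis using that by blast
qed

lemma bform_slot_norm:
  assumes B: "is_onb B" and u: "\<And>x. F (x # ys) = cinner x u"
  shows "infsum (\<lambda>b. ennreal ((cmod (F (b # ys)))\<^sup>2)) B = ennreal ((norm u)\<^sup>2)"
proof -
  have "infsum (\<lambda>b. ennreal ((cmod (cinner b u))\<^sup>2)) B = ennreal (infsum (\<lambda>b. (cmod (cinner b u))\<^sup>2) B)"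
    by (rule esum_ennreal) (use bessel[OF B] in auto)
  then show ?thesis using infsumI[OF parseval[OF B]] by (simp add: u)
qed

lemma bform_slot_expansion:
  assumes B: "is_onb B" and F: "bform F"
  shows "((\<lambda>b. cinner x b * F (b # ys)) has_sum F (x # ys)) B"
proof -
  obtain u where u: "\<And>x. F (x # ys) = cinner x u" by (rule bform_riesz[OF F]) blast
  show ?thesis unfolding u by (rule cinner_expansion[OF B])
qed

definition tuples :: "'a set \<Rightarrow> nat \<Rightarrow> 'a list set" where
  "tuples B n = {hs. set hs \<subseteq> B \<and> length hs = n}"

lemma tuples_0 [simp]: "tuples B 0 = {[]}"
  by (auto simp: tuples_def)

lemma bij_tuples_Suc: "bij_betw (\<lambda>(b, hs). b # hs) (B \<times> tuples B n) (tuples B (Suc n))"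
  by (rule bij_betwI[of _ _ _ "\<lambda>hs. (hd hs, tl hs)"]) (auto simp: tuples_def length_Suc_conv)

lemma bij_tuples_lists: "bij_betw snd (Sigma UNIV (tuples B)) (lists B)"
  by (rule bij_betwI[of _ _ _ "\<lambda>hs. (length hs, hs)"]) (auto simp: tuples_def)

lemma esum_tuples_Suc:
  "infsum f (tuples B (Suc n)) = infsum (\<lambda>b. infsum (\<lambda>hs. f (b # hs)) (tuples B n)) B"
  for f :: "_ \<Rightarrow> ennreal"
proof -
  have "infsum f (tuples B (Suc n)) = infsum (\<lambda>(b, hs). f (b # hs)) (B \<times> tuples B n)"
    using infsum_reindex_bij_betw[OF bij_tuples_Suc, of f] by (simp add: case_prod_unfold)
  then show ?thesis by (simp add: esum_Sigma)
qed

lemma esum_lists: "infsum f (lists B) = infsum (\<lambda>n. infsum f (tuples B n)) UNIV"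
  for f :: "_ \<Rightarrow> ennreal"
proof -
  have "infsum f (lists B) = infsum (\<lambda>z. f (snd z)) (Sigma UNIV (tuples B))"
    using infsum_reindex_bij_betw[OF bij_tuples_lists, of f] by simp
  then show ?thesis by (simp add: esum_Sigma)
qed

definition sqn :: "complex \<Rightarrow> ennreal" where
  "sqn z = ennreal ((cmod z)\<^sup>2)"

lemma sqn_mult: "sqn (a * b) = sqn a * sqn b"
  by (simp add: sqn_def norm_mult power_mult_distrib ennreal_mult)

lemma sqn_cnj [simp]: "sqn (cnj z) = sqn z"
  by (simp add: sqn_def)

text \<open>The bases are exchanged slot by slot: the induction hypothesis treats the tail, and
  after interchanging the sums Parseval treats the leading slot.\<close>

lemma esum_tuples_indep:
  assumes B: "is_onb B" "is_onb B'" and F: "bform F"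
  shows "infsum (\<lambda>hs. sqn (F hs)) (tuples B n) = infsum (\<lambda>hs. sqn (F hs)) (tuples B' n)"
  using F
proof (induction n arbitrary: F)
  case 0
  show ?case by simp
next
  case (Suc n)
  have slot: "infsum (\<lambda>b. sqn (F (b # hs))) B = infsum (\<lambda>b. sqn (F (b # hs))) B'" for hs
  proof -
    obtain u where u: "\<And>x. F (x # hs) = cinner x u" by (rule bform_riesz[OF Suc.prems]) blast
    show ?thesis unfolding sqn_def bform_slot_norm[OF B(1) u] bform_slot_norm[OF B(2) u] ..
  qed
  have "infsum (\<lambda>hs. sqn (F hs)) (tuples B (Suc n)) =
      infsum (\<lambda>b. infsum (\<lambda>hs. sqn (F (b # hs))) (tuples B' n)) B"
    unfolding esum_tuples_Suc using Suc.IH[OF bform_Cons[OF Suc.prems]] by simp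
  also have "\<dots> = infsum (\<lambda>hs. infsum (\<lambda>b. sqn (F (b # hs))) B) (tuples B' n)"
    by (rule esum_swap)
  also have "\<dots> = infsum (\<lambda>hs. infsum (\<lambda>b. sqn (F (b # hs))) B') (tuples B' n)"
    by (simp only: slot)
  also have "\<dots> = infsum (\<lambda>b. infsum (\<lambda>hs. sqn (F (b # hs))) (tuples B' n)) B'"
    by (rule esum_swap)
  finally show ?case by (simp only: esum_tuples_Suc)
qed

lemma esum_lists_indep:
  assumes "is_onb B" "is_onb B'" "bform F"
  shows "infsum (\<lambda>hs. sqn (F hs)) (lists B) = infsum (\<lambda>hs. sqn (F hs)) (lists B')"
  unfolding esum_lists using esum_tuples_indep[OF assms] by simp

text \<open>Cauchy-Schwarz iterated over the slots. Besides continuity this yields that a form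
  vanishing on basis words vanishes everywhere.\<close>

lemma bform_bound:
  assumes B: "is_onb B" and F: "bform F"
  shows "sqn (F xs) \<le> ennreal ((pnorm xs)\<^sup>2) * infsum (\<lambda>hs. sqn (F hs)) (tuples B (length xs))"
  using F
proof (induction xs arbitrary: F)
  case Nil
  show ?case by simp
next
  case (Cons x xs)
  have slot: "sqn (F (x # hs)) \<le> ennreal ((norm x)\<^sup>2) * infsum (\<lambda>b. sqn (F (b # hs))) B" for hs
  proof -
    obtain u where u: "\<And>x. F (x # hs) = cinner x u" by (rule bform_riesz[OF Cons.prems]) blast
    have "(cmod (cinner x u))\<^sup>2 \<le> (norm x * norm u)\<^sup>2"
      by (rule power_mono[OF cinner_bound]) simp
    moreover have "infsum (\<lambda>b. sqn (F (b # hs))) B = ennreal ((norm u)\<^sup>2)"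
      unfolding sqn_def by (rule bform_slot_norm[OF B u])
    ultimately show ?thesis
      by (simp add: u[of x] sqn_def power_mult_distrib ennreal_mult[symmetric])
  qed
  have "sqn (F (x # xs)) \<le> ennreal ((pnorm xs)\<^sup>2) *
      infsum (\<lambda>hs. sqn (F (x # hs))) (tuples B (length xs))"
    by (rule Cons.IH[OF bform_Cons[OF Cons.prems]])
  also have "\<dots> \<le> ennreal ((pnorm xs)\<^sup>2) *
      infsum (\<lambda>hs. ennreal ((norm x)\<^sup>2) * infsum (\<lambda>b. sqn (F (b # hs))) B) (tuples B (length xs))"
    by (intro mult_left_mono esum_mono slot) auto
  also have "\<dots> = ennreal ((pnorm xs)\<^sup>2) * (ennreal ((norm x)\<^sup>2) *
      infsum (\<lambda>b. infsum (\<lambda>hs. sqn (F (b # hs))) (tuples B (length xs))) B)"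
    by (subst esum_swap) (simp add: esum_cmult)
  also have "\<dots> = ennreal ((pnorm (x # xs))\<^sup>2) *
      infsum (\<lambda>hs. sqn (F hs)) (tuples B (length (x # xs)))"
    by (simp add: esum_tuples_Suc power_mult_distrib ennreal_mult mult_ac)
  finally show ?case .
qed

lemma simple_tensor_Nil [simp]: "simple_tensor [] = vac"
  by (auto simp: simple_tensor_def vac_def fun_eq_iff)

lemma simple_tensor_Cons: "simple_tensor (f # fs) (h # hs) = cinner h f * simple_tensor fs hs"
  by (simp add: simple_tensor_def prod.lessThan_Suc_shift del: prod.lessThan_Suc)

lemma esum_simple_tensor:
  assumes B: "is_onb B"
  shows "infsum (\<lambda>hs. sqn (simple_tensor fs hs)) (tuples B (length fs)) < top"
proof (induction fs)
  case Nil
  show ?case by (simp add: sqn_def)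
next
  case (Cons f fs)
  have "infsum (\<lambda>b. sqn (cinner b f)) B = ennreal (infsum (\<lambda>b. (cmod (cinner b f))\<^sup>2) B)"
    unfolding sqn_def by (rule esum_ennreal) (use bessel[OF B] in auto)
  then have "infsum (\<lambda>b. sqn (cinner b f)) B < top" by simp
  then show ?case using Cons
    by (simp add: esum_tuples_Suc simple_tensor_Cons sqn_mult esum_cmult esum_cmult_right ennreal_mult_less_top)
qed

lemma summable_sqn_iff: "(\<lambda>x. (cmod (f x))\<^sup>2) summable_on A \<longleftrightarrow> infsum (\<lambda>x. sqn (f x)) A < top"
  unfolding sqn_def by (rule summable_iff_esum) simp

text \<open>The reproducing property: the value at \<open>fs\<close> is the inner product of the
  elementary tensor with \<open>F\<close>. Both factors are square-summable, which justifies the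
  iterated sum.\<close>

lemma bform_expansion:
  assumes B: "is_onb B" and F: "bform F"
    and fin: "infsum (\<lambda>hs. sqn (F hs)) (tuples B (length fs)) < top"
  shows "((\<lambda>hs. cnj (simple_tensor fs hs) * F hs) has_sum F fs) (tuples B (length fs))"
  using F fin
proof (induction fs arbitrary: F)
  case Nil
  then show ?case by (simp add: vac_def has_sum_finite_iff)
next
  case (Cons f fs)
  let ?S = "B \<times> tuples B (length fs)"
  let ?g = "\<lambda>(b, hs). cnj (simple_tensor (f # fs) (b # hs)) * F (b # hs)"
  have fin: "infsum (\<lambda>b. infsum (\<lambda>hs. sqn (F (b # hs))) (tuples B (length fs))) B < top"
    using Cons.prems by (simp add: esum_tuples_Suc)
  have "((\<lambda>b. cinner f b * F (b # fs)) has_sum F (f # fs)) B"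
    by (rule bform_slot_expansion[OF B Cons.prems(1)])
  moreover have "((\<lambda>hs. ?g (b, hs)) has_sum cinner f b * F (b # fs)) (tuples B (length fs))" if b: "b \<in> B" for b
  proof -
    have "infsum (\<lambda>hs. sqn (F (b # hs))) (tuples B (length fs)) \<le>
        infsum (\<lambda>b. infsum (\<lambda>hs. sqn (F (b # hs))) (tuples B (length fs))) B"
      using esum_finite_le[of "{b}" B "\<lambda>b. infsum (\<lambda>hs. sqn (F (b # hs))) (tuples B (length fs))"] b by simp
    then have "infsum (\<lambda>hs. sqn (F (b # hs))) (tuples B (length fs)) < top" using fin by (rule le_less_trans)
    from has_sum_cmult_right[OF Cons.IH[OF bform_Cons[OF Cons.prems(1)] this], of "cinner f b"]
    show ?thesis by (simp add: simple_tensor_Cons mult_ac flip: cinner_commute)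
  qed
  moreover have "?g summable_on ?S"
  proof -
    have "(\<lambda>z. (cmod (cnj (simple_tensor (f # fs) (fst z # snd z))))\<^sup>2) summable_on ?S"
      unfolding summable_sqn_iff using esum_simple_tensor[OF B, of "f # fs"]
      by (simp add: esum_tuples_Suc esum_Sigma)
    moreover have "(\<lambda>z. (cmod (F (fst z # snd z)))\<^sup>2) summable_on ?S"
      unfolding summable_sqn_iff using fin by (simp add: esum_Sigma)
    ultimately have "(\<lambda>z. norm (cnj (simple_tensor (f # fs) (fst z # snd z)) * F (fst z # snd z))) summable_on ?S"
      by (rule l2_product_summable)
    from abs_summable_summable[OF this] show ?thesis by (simp add: case_prod_unfold)
  qed
  ultimately have "(?g has_sum F (f # fs)) ?S" by (intro has_sum_SigmaI)
  then show ?case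
    using has_sum_reindex_bij_betw[OF bij_tuples_Suc[of B "length fs"],
        where f = "\<lambda>hs. cnj (simple_tensor (f # fs) hs) * F hs" and S = "F (f # fs)"]
    by (simp add: case_prod_unfold)
qed


section \<open>Square-summable forms\<close>

definition l2form :: "('a::complex_hilbert list \<Rightarrow> complex) \<Rightarrow> bool" where
  "l2form F \<longleftrightarrow> bform F \<and> (\<lambda>hs. (cmod (F hs))\<^sup>2) summable_on lists onb"

definition l2norm :: "('a::complex_hilbert list \<Rightarrow> complex) \<Rightarrow> real" where
  "l2norm F = sqrt (infsum (\<lambda>hs. (cmod (F hs))\<^sup>2) (lists onb))"

lemma l2norm_nonneg [simp]: "0 \<le> l2norm F"
  by (simp add: l2norm_def infsum_nonneg)

lemma l2form_summable: "l2form F \<Longrightarrow> (\<lambda>hs. (cmod (F hs))\<^sup>2) summable_on lists onb"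
  by (simp add: l2form_def)

lemma l2form_summable_onb:
  assumes F: "l2form F" and B: "is_onb B"
  shows "(\<lambda>hs. (cmod (F hs))\<^sup>2) summable_on lists B"
  using F esum_lists_indep[OF B is_onb_onb, of F] by (simp add: l2form_def summable_sqn_iff)

lemma esum_l2norm: "l2form F \<Longrightarrow> infsum (\<lambda>hs. sqn (F hs)) (lists onb) = ennreal ((l2norm F)\<^sup>2)"
  unfolding sqn_def l2norm_def
  by (subst esum_ennreal) (auto simp: l2form_def infsum_nonneg)

lemma esum_tuples_le_lists: "infsum f (tuples B n) \<le> infsum f (lists B)" for f :: "_ \<Rightarrow> ennreal"
  by (intro infsum_mono_neutral esummable) (auto simp: tuples_def)

lemma l2form_bound:
  assumes F: "l2form F"
  shows "cmod (F xs) \<le> l2norm F * pnorm xs"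
proof -
  have nn: "0 \<le> pnorm xs" by (rule prod_list_nonneg) auto
  have "sqn (F xs) \<le> ennreal ((pnorm xs)\<^sup>2) * infsum (\<lambda>hs. sqn (F hs)) (tuples onb (length xs))"
    by (rule bform_bound[OF is_onb_onb]) (use F in \<open>simp add: l2form_def\<close>)
  also have "\<dots> \<le> ennreal ((pnorm xs)\<^sup>2) * infsum (\<lambda>hs. sqn (F hs)) (lists onb)"
    by (intro mult_left_mono esum_tuples_le_lists) auto
  also have "\<dots> = ennreal ((l2norm F * pnorm xs)\<^sup>2)"
    by (simp add: esum_l2norm[OF F] power_mult_distrib ennreal_mult mult.commute)
  finally have "(cmod (F xs))\<^sup>2 \<le> (l2norm F * pnorm xs)\<^sup>2"
    unfolding sqn_def by (simp add: ennreal_le_iff)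
  then show ?thesis by (rule power2_le_imp_le) (simp add: nn)
qed

lemma bform_add: 
  assumes "bform F" "bform G"
  shows "bform (\<lambda>hs. F hs + G hs)"
proof -
  have "\<exists>C. \<forall>xs. length xs = n \<longrightarrow> cmod (F xs + G xs) \<le> C * pnorm xs" for n
  proof -
    obtain C where C: "\<And>xs. length xs = n \<Longrightarrow> cmod (F xs) \<le> C * pnorm xs"
      using assms unfolding bform_def bounded_form_def by blast
    obtain D where D: "\<And>xs. length xs = n \<Longrightarrow> cmod (G xs) \<le> D * pnorm xs"
      using assms unfolding bform_def bounded_form_def by blast
    have "cmod (F xs + G xs) \<le> (C + D) * pnorm xs" if "length xs = n" for xs
      using norm_triangle_ineq[of "F xs" "G xs"] C[OF that] D[OF that] by (simp add: distrib_right)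
    then show ?thesis by blast
  qed
  then show ?thesis using assms by (simp add: bform_def bounded_form_def multi_antilinear_plus)
qed

lemma bform_cmult:
  assumes "bform F"
  shows "bform (\<lambda>hs. c * F hs)"
proof -
  have "\<exists>C. \<forall>xs. length xs = n \<longrightarrow> cmod (c * F xs) \<le> C * pnorm xs" for n
  proof -
    obtain C where C: "\<And>xs. length xs = n \<Longrightarrow> cmod (F xs) \<le> C * pnorm xs"
      using assms unfolding bform_def bounded_form_def by blast
    have "cmod (c * F xs) \<le> (cmod c * C) * pnorm xs" if "length xs = n" for xs
      using mult_left_mono[OF C[OF that], of "cmod c"] by (simp add: norm_mult mult.assoc)
    then show ?thesis by blast
  qed
  then show ?thesis using assms by (simp add: bform_def bounded_form_def multi_antilinear_cmult)
qed

lemma sqn_add_le: "sqn (a + b) \<le> 2 * (sqn a + sqn b)"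
proof -
  have "(cmod (a + b))\<^sup>2 \<le> (cmod a + cmod b)\<^sup>2" by (rule power_mono[OF norm_triangle_ineq]) simp
  also have "\<dots> \<le> 2 * ((cmod a)\<^sup>2 + (cmod b)\<^sup>2)" using sum_squares_bound[of "cmod a" "cmod b"] by (simp add: power2_sum)
  finally show ?thesis unfolding sqn_def
    by (simp flip: ennreal_plus ennreal_mult ennreal_numeral)
qed

lemma l2form_add:
  assumes "l2form F" "l2form G"
  shows "l2form (\<lambda>hs. F hs + G hs)"
proof -
  have "infsum (\<lambda>hs. sqn (F hs + G hs)) (lists onb) \<le> infsum (\<lambda>hs. 2 * (sqn (F hs) + sqn (G hs))) (lists onb)"
    by (rule esum_mono) (rule sqn_add_le)
  also have "\<dots> < top" using assms
    by (simp add: esum_cmult esum_add l2form_def summable_sqn_iff ennreal_mult_less_top)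
  finally show ?thesis using assms by (simp add: l2form_def summable_sqn_iff bform_add)
qed

lemma l2form_cmult:
  assumes "l2form F"
  shows "l2form (\<lambda>hs. c * F hs)"
proof -
  have "infsum (\<lambda>hs. sqn (c * F hs)) (lists onb) < top"
    using assms by (simp add: sqn_mult esum_cmult l2form_def summable_sqn_iff ennreal_mult_less_top)
      (simp add: sqn_def)
  then show ?thesis using assms by (simp add: l2form_def summable_sqn_iff bform_cmult)
qed

text \<open>The arguments have the shape a + c b with c a fourth root of unity, matching
  \<open>l2form_add\<close> and \<open>l2form_cmult\<close>.\<close>

lemma polarization_complex:
  "4 * (cnj a * b) = complex_of_real ((cmod (a + b))\<^sup>2) - complex_of_real ((cmod (a + - 1 * b))\<^sup>2)
     - \<i> * complex_of_real ((cmod (a + \<i> * b))\<^sup>2) + \<i> * complex_of_real ((cmod (a + - \<i> * b))\<^sup>2)"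
  unfolding cmod_power2 by (simp add: complex_eq_iff power2_eq_square algebra_simps)

text \<open>Polarisation reduces the inner product to four sums of squares, to which
  \<open>esum_lists_indep\<close> applies.\<close>

lemma fock_inner_indep:
  assumes F: "l2form F" and G: "l2form G" and B: "is_onb B"
  shows "infsum (\<lambda>hs. cnj (F hs) * G hs) (lists B) = fock_inner F G"
proof -
  have l2: "l2form (\<lambda>hs. F hs + c * G hs)" for c by (intro l2form_add l2form_cmult F G)
  have expand: "4 * infsum (\<lambda>hs. cnj (F hs) * G hs) (lists B) =
     complex_of_real (infsum (\<lambda>hs. (cmod (F hs + 1 * G hs))\<^sup>2) (lists B))
     - complex_of_real (infsum (\<lambda>hs. (cmod (F hs + - 1 * G hs))\<^sup>2) (lists B))
     - \<i> * complex_of_real (infsum (\<lambda>hs. (cmod (F hs + \<i> * G hs))\<^sup>2) (lists B))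
     + \<i> * complex_of_real (infsum (\<lambda>hs. (cmod (F hs + - \<i> * G hs))\<^sup>2) (lists B))"
    if B: "is_onb B" for B
  proof -
    have hs: "((\<lambda>hs. complex_of_real ((cmod (F hs + c * G hs))\<^sup>2)) has_sum
        complex_of_real (infsum (\<lambda>hs. (cmod (F hs + c * G hs))\<^sup>2) (lists B))) (lists B)" for c
      by (intro has_sum_of_real has_sum_infsum l2form_summable_onb[OF l2 B])
    have "((\<lambda>hs. 4 * (cnj (F hs) * G hs)) has_sum
       (complex_of_real (infsum (\<lambda>hs. (cmod (F hs + 1 * G hs))\<^sup>2) (lists B))
       + - complex_of_real (infsum (\<lambda>hs. (cmod (F hs + - 1 * G hs))\<^sup>2) (lists B))
       + - (\<i> * complex_of_real (infsum (\<lambda>hs. (cmod (F hs + \<i> * G hs))\<^sup>2) (lists B)))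
       + \<i> * complex_of_real (infsum (\<lambda>hs. (cmod (F hs + - \<i> * G hs))\<^sup>2) (lists B)))) (lists B)"
      unfolding polarization_complex diff_conv_add_uminus
      by (intro has_sum_add has_sum_uminusI has_sum_cmult_right hs) (use hs[of 1] in simp)
    then show ?thesis
      using infsumI[of "\<lambda>hs. 4 * (cnj (F hs) * G hs)"] by (simp add: infsum_cmult_right')
  qed
  have eq: "infsum (\<lambda>hs. (cmod (F hs + c * G hs))\<^sup>2) (lists B) =
      infsum (\<lambda>hs. (cmod (F hs + c * G hs))\<^sup>2) (lists onb)" for c
  proof -
    have "ennreal (infsum (\<lambda>hs. (cmod (F hs + c * G hs))\<^sup>2) (lists B)) =
        ennreal (infsum (\<lambda>hs. (cmod (F hs + c * G hs))\<^sup>2) (lists onb))"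
      using esum_lists_indep[OF B is_onb_onb, of "\<lambda>hs. F hs + c * G hs"] l2[of c]
        l2form_summable_onb[OF l2 B] l2form_summable_onb[OF l2 is_onb_onb]
      unfolding sqn_def by (simp add: esum_ennreal l2form_def)
    then show ?thesis by (simp add: ennreal_inj infsum_nonneg)
  qed
  have "4 * infsum (\<lambda>hs. cnj (F hs) * G hs) (lists B) = 4 * fock_inner F G"
    unfolding fock_inner_def expand[OF B] expand[OF is_onb_onb] eq ..
  then show ?thesis by simp
qed

lemma fock_inner_summable:
  assumes "l2form F" "l2form G"
  shows "(\<lambda>hs. cnj (F hs) * G hs) summable_on lists onb"
  by (rule abs_summable_summable[OF l2_product_summable]) (use assms in \<open>simp_all add: l2form_def\<close>)

lemma fock_inner_bound:
  assumes "l2form F" "l2form G"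
  shows "cmod (fock_inner F G) \<le> l2norm F * l2norm G"
  using cauchy_schwarz_infsum[of "\<lambda>hs. cnj (F hs)" "lists onb" G] assms
  by (simp add: fock_inner_def l2norm_def l2form_def)

lemma fock_inner_self:
  assumes "l2form F"
  shows "fock_inner F F = complex_of_real ((l2norm F)\<^sup>2)"
proof -
  have "((\<lambda>hs. complex_of_real ((cmod (F hs))\<^sup>2)) has_sum complex_of_real ((l2norm F)\<^sup>2)) (lists onb)"
    unfolding l2norm_def using assms
    by (intro has_sum_of_real) (simp add: l2form_def infsum_nonneg)
  then show ?thesis
    unfolding fock_inner_def complex_norm_square by (intro infsumI) (simp add: mult.commute)
qed

lemma l2norm_triangle:
  assumes F: "l2form F" and G: "l2form G"
  shows "l2norm (\<lambda>hs. F hs + G hs) \<le> l2norm F + l2norm G"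
proof -
  have "infsum (\<lambda>hs. (cmod (F hs + G hs))\<^sup>2) (lists onb) \<le> (l2norm F + l2norm G)\<^sup>2"
  proof (rule infsum_le_finite_sums)
    show "(\<lambda>hs. (cmod (F hs + G hs))\<^sup>2) summable_on lists onb"
      using l2form_add[OF F G] by (simp add: l2form_def)
    fix X :: "'a list set" assume X: "finite X" "X \<subseteq> lists onb"
    have le: "L2_set (\<lambda>hs. cmod (K hs)) X \<le> l2norm K" if "l2form K" for K
      unfolding L2_set_def l2norm_def
      by (intro real_sqrt_le_mono finite_sum_le_infsum) (use that X in \<open>auto simp: l2form_def\<close>)
    have "L2_set (\<lambda>hs. cmod (F hs + G hs)) X \<le> L2_set (\<lambda>hs. cmod (F hs) + cmod (G hs)) X"
      by (rule L2_set_mono) (auto intro: norm_triangle_ineq)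
    also have "\<dots> \<le> L2_set (\<lambda>hs. cmod (F hs)) X + L2_set (\<lambda>hs. cmod (G hs)) X"
      by (rule L2_set_triangle_ineq)
    also have "\<dots> \<le> l2norm F + l2norm G" by (intro add_mono le F G)
    finally show "(\<Sum>hs\<in>X. (cmod (F hs + G hs))\<^sup>2) \<le> (l2norm F + l2norm G)\<^sup>2"
      unfolding L2_set_def by (rule sqrt_le_D)
  qed
  then show ?thesis unfolding l2norm_def[of "\<lambda>hs. F hs + G hs"]
    by (intro real_le_lsqrt) (simp_all add: infsum_nonneg)
qed

lemma l2norm_cmult: "l2norm (\<lambda>hs. c * F hs) = cmod c * l2norm F"
  by (simp add: l2norm_def norm_mult power_mult_distrib infsum_cmult_right' real_sqrt_mult)

lemma l2norm_zero_imp: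
  assumes "l2form F" "l2norm F = 0"
  shows "F = (\<lambda>hs. 0)"
  using l2form_bound[OF assms(1)] assms(2) by (auto simp: fun_eq_iff)

lemma fock_pair_cmult_right: "fock_pair J F (\<lambda>hs. c * G hs) = c * fock_pair J F G"
  by (simp add: fock_pair_def fock_inner_def mult.left_commute[of _ c] infsum_cmult_right')

lemma fock_pair_cmult_left: "fock_pair J (\<lambda>hs. c * F hs) G = c * fock_pair J F G"
  by (simp add: fock_pair_def fock_inner_def fock_star_def mult.assoc infsum_cmult_right')

section \<open>The antiunitary involution and the bilinear pairing\<close>

context
  fixes J :: "'h::complex_hilbert \<Rightarrow> 'h"
  assumes J: "antiunitary_involution J"
begin

lemma J_add: "J (x + y) = J x + J y"
  and J_scaleC: "J (c *\<^sub>C x) = cnj c *\<^sub>C J x"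
  and J_J: "J (J x) = x"
  and cinner_J: "cinner (J x) (J y) = cnj (cinner x y)"
  using J by (auto simp: antiunitary_involution_def)

lemma norm_J: "norm (J x) = norm x"
proof -
  have "complex_of_real ((norm (J x))\<^sup>2) = complex_of_real ((norm x)\<^sup>2)"
    unfolding cinner_self[symmetric] cinner_J by (simp flip: cinner_commute)
  then show ?thesis by (simp only: of_real_eq_iff) (simp add: power2_eq_iff_nonneg)
qed

lemma onb_J:
  assumes B: "is_onb B"
  shows "is_onb (J ` B)"
  unfolding is_onb_def
proof (intro conjI ballI allI impI)
  fix b c assume "b \<in> J ` B" "c \<in> J ` B"
  then obtain b' c' where bc: "b = J b'" "c = J c'" "b' \<in> B" "c' \<in> B" by blast
  then have "cinner b c = cnj (if b' = c' then 1 else 0)" using B by (simp add: cinner_J is_onb_def)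
  moreover have "b = c \<longleftrightarrow> b' = c'" using bc J_J by metis
  ultimately show "cinner b c = (if b = c then 1 else 0)" by simp
next
  fix x assume x: "\<forall>b\<in>J ` B. cinner b x = 0"
  have "cinner b (J x) = 0" if "b \<in> B" for b
    using x that cinner_J[of "J b" x] by (simp add: J_J)
  then have "J x = 0" using B by (simp add: is_onb_def)
  moreover have "J 0 = 0" using J_add[of 0 0] by simp
  ultimately show "x = 0" using J_J by metis
qed

lemma prod_norm_J: "pnorm (map J (rev hs)) = pnorm hs"
proof -
  have "map norm (map J (rev hs)) = rev (map norm hs)" by (simp add: norm_J rev_map o_def)
  then show ?thesis by (simp only: prod_list.rev)
qed

lemma bform_fock_star:
  assumes F: "bform F"
  shows "bform (fock_star J F)"
proof -
  have m: "multi_antilinear F" using F by (simp add: bform_def)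
  have "multi_antilinear (fock_star J F)"
    unfolding multi_antilinear_def fock_star_def
    by (simp add: J_add J_scaleC multi_antilinear_add[OF m] multi_antilinear_scaleC[OF m])
  moreover have "bounded_form (fock_star J F)"
    unfolding bounded_form_def
  proof
    fix n
    obtain C where C: "\<And>xs. length xs = n \<Longrightarrow> cmod (F xs) \<le> C * pnorm xs"
      using F unfolding bform_def bounded_form_def by blast
    have "cmod (fock_star J F xs) \<le> C * pnorm xs" if "length xs = n" for xs
      using C[of "map J (rev xs)"] that by (simp only: prod_norm_J) (simp add: fock_star_def)
    then show "\<exists>C. \<forall>xs. length xs = n \<longrightarrow> cmod (fock_star J F xs) \<le> C * pnorm xs" by blast
  qed
  ultimately show ?thesis by (simp add: bform_def)
qed

lemma bij_J_rev: "bij_betw (\<lambda>hs. map J (rev hs)) (lists B) (lists (J ` B))"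
  by (rule bij_betwI[of _ _ _ "\<lambda>hs. map J (rev hs)"]) (auto simp: rev_map o_def J_J, metis J_J imageE)

lemma esum_fock_star:
  assumes F: "bform F"
  shows "infsum (\<lambda>hs. sqn (fock_star J F hs)) (lists onb) = infsum (\<lambda>hs. sqn (F hs)) (lists onb)"
proof -
  have "infsum (\<lambda>hs. sqn (fock_star J F hs)) (lists onb) = infsum (\<lambda>hs. sqn (F (map J (rev hs)))) (lists onb)"
    by (simp add: fock_star_def)
  also have "\<dots> = infsum (\<lambda>hs. sqn (F hs)) (lists (J ` onb))"
    by (rule infsum_reindex_bij_betw[OF bij_J_rev])
  also have "\<dots> = infsum (\<lambda>hs. sqn (F hs)) (lists onb)"
    by (rule esum_lists_indep[OF onb_J[OF is_onb_onb] is_onb_onb F])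
  finally show ?thesis .
qed

lemma l2form_fock_star: "l2form F \<Longrightarrow> l2form (fock_star J F)"
  by (simp add: l2form_def bform_fock_star summable_sqn_iff esum_fock_star)

lemma l2norm_fock_star:
  assumes F: "l2form F"
  shows "l2norm (fock_star J F) = l2norm F"
proof -
  have "ennreal ((l2norm (fock_star J F))\<^sup>2) = ennreal ((l2norm F)\<^sup>2)"
    unfolding esum_l2norm[OF F, symmetric] esum_l2norm[OF l2form_fock_star[OF F], symmetric]
    by (rule esum_fock_star) (use F in \<open>simp add: l2form_def\<close>)
  then show ?thesis by (simp add: ennreal_inj power2_eq_iff_nonneg)
qed

lemma fock_pair_commute:
  assumes F: "l2form F" and G: "l2form G"
  shows "fock_pair J F G = fock_pair J G F"
proof -
  have "fock_pair J F G = infsum (\<lambda>hs. F (map J (rev hs)) * G (map J (rev (map J (rev hs))))) (lists onb)"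
    by (simp add: fock_pair_def fock_inner_def fock_star_def rev_map o_def J_J)
  \<comment> \<open>The substitution replaces the basis by its image under \<open>J\<close>, so the
    return to \<open>onb\<close> is a change of basis.\<close>
  also have "\<dots> = infsum (\<lambda>hs. F hs * G (map J (rev hs))) (lists (J ` onb))"
    by (rule infsum_reindex_bij_betw[OF bij_J_rev])
  also have "\<dots> = infsum (\<lambda>hs. cnj (fock_star J G hs) * F hs) (lists (J ` onb))"
    by (simp add: fock_star_def mult.commute)
  also have "\<dots> = fock_pair J G F"
    unfolding fock_pair_def
    by (rule fock_inner_indep[OF l2form_fock_star[OF G] F onb_J[OF is_onb_onb]])
  finally show ?thesis .
qed

lemma fock_pair_bound:
  assumes "l2form F" "l2form G"
  shows "cmod (fock_pair J F G) \<le> l2norm F * l2norm G"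
  using fock_inner_bound[OF l2form_fock_star[OF assms(1)] assms(2)] l2norm_fock_star[OF assms(1)]
  by (simp add: fock_pair_def)

lemma fock_pair_has_sum:
  assumes "l2form F" "l2form G"
  shows "((\<lambda>hs. F (map J (rev hs)) * G hs) has_sum fock_pair J F G) (lists onb)"
  using fock_inner_summable[OF l2form_fock_star[OF assms(1)] assms(2)]
  by (simp add: fock_pair_def fock_inner_def fock_star_def)

lemma fock_pair_add_right:
  assumes "l2form F" "l2form G" "l2form G'"
  shows "fock_pair J F (\<lambda>hs. G hs + G' hs) = fock_pair J F G + fock_pair J F G'"
proof -
  have "((\<lambda>hs. F (map J (rev hs)) * (G hs + G' hs)) has_sum (fock_pair J F G + fock_pair J F G')) (lists onb)"
    unfolding distrib_left by (intro has_sum_add fock_pair_has_sum assms)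
  then show ?thesis using fock_pair_has_sum[OF assms(1) l2form_add[OF assms(2,3)]] has_sum_unique by blast
qed

lemma fock_pair_add_left:
  assumes "l2form F" "l2form F'" "l2form G"
  shows "fock_pair J (\<lambda>hs. F hs + F' hs) G = fock_pair J F G + fock_pair J F' G"
  using fock_pair_add_right[OF assms(3,1,2)] assms
  by (simp add: fock_pair_commute[of _ G] l2form_add)

text \<open>This identity makes the pairing nondegenerate and shows that the bound
  \<open>fock_pair_bound\<close> is attained.\<close>

lemma fock_pair_star_self:
  assumes F: "l2form F"
  shows "fock_pair J F (fock_star J F) = complex_of_real ((l2norm F)\<^sup>2)"
  unfolding fock_pair_def fock_inner_self[OF l2form_fock_star[OF F]] l2norm_fock_star[OF F] ..

end

section \<open>The Fock space and transposed operators\<close>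

context
  fixes H E :: "bit \<Rightarrow> 'h::complex_hilbert set" and J :: "'h \<Rightarrow> 'h"
  assumes sh: "super_hilbert H E J"
begin

lemma J_antiunitary: "antiunitary_involution J"
  using sh by (simp add: super_hilbert_def)

lemma J_parity: "h \<in> H k \<Longrightarrow> J h \<in> H k"
proof -
  have H: "H k = {a + b | a b. a \<in> E k \<and> b \<in> J ` E k}"
    using sh by (auto simp: super_hilbert_def orth_sum_def)
  assume "h \<in> H k"
  then obtain a b where ab: "h = a + J b" "a \<in> E k" "b \<in> E k" unfolding H by auto
  have "J h = b + J a" by (simp add: ab J_add[OF J_antiunitary] J_J[OF J_antiunitary] add.commute)
  then show "J h \<in> H k" unfolding H using ab by blast
qed

lemma fock_iff: "F \<in> fock H \<longleftrightarrow> l2form F \<and> graded_sym H F"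
  using sym_proj_eq_iff_graded_sym[OF sh, of F]
  by (auto simp: fock_def l2form_def bform_def)

lemma fock_l2form: "F \<in> fock H \<Longrightarrow> l2form F"
  by (simp add: fock_iff)

lemma graded_symD:
  "graded_sym H F \<Longrightarrow> set xs \<subseteq> H 0 \<union> H 1 \<Longrightarrow> set ys \<subseteq> H 0 \<union> H 1 \<Longrightarrow> x \<in> H k \<Longrightarrow> y \<in> H k' \<Longrightarrow>
    F (xs @ x # y # ys) = comm_sign k k' * F (xs @ y # x # ys)"
  unfolding graded_sym_def[OF sh] by blast

lemma graded_sym_add:
  assumes "graded_sym H F" "graded_sym H G"
  shows "graded_sym H (\<lambda>hs. F hs + G hs)"
  unfolding graded_sym_def[OF sh]
proof (intro allI impI)
  fix xs ys x y k k'
  assume *: "set xs \<subseteq> H 0 \<union> H 1" "set ys \<subseteq> H 0 \<union> H 1" "x \<in> H k" "y \<in> H k'"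
  show "F (xs @ x # y # ys) + G (xs @ x # y # ys) =
      comm_sign k k' * (F (xs @ y # x # ys) + G (xs @ y # x # ys))"
    unfolding graded_symD[OF assms(1) *] graded_symD[OF assms(2) *] by (simp add: distrib_left)
qed

lemma graded_sym_cmult:
  assumes "graded_sym H F"
  shows "graded_sym H (\<lambda>hs. c * F hs)"
  unfolding graded_sym_def[OF sh]
proof (intro allI impI)
  fix xs ys x y k k'
  assume *: "set xs \<subseteq> H 0 \<union> H 1" "set ys \<subseteq> H 0 \<union> H 1" "x \<in> H k" "y \<in> H k'"
  show "c * F (xs @ x # y # ys) = comm_sign k k' * (c * F (xs @ y # x # ys))"
    unfolding graded_symD[OF assms *] by simp
qed

lemma fock_add: "F \<in> fock H \<Longrightarrow> G \<in> fock H \<Longrightarrow> (\<lambda>hs. F hs + G hs) \<in> fock H"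
  by (simp add: fock_iff l2form_add graded_sym_add)

lemma fock_cmult: "F \<in> fock H \<Longrightarrow> (\<lambda>hs. c * F hs) \<in> fock H"
  by (simp add: fock_iff l2form_cmult graded_sym_cmult)

lemma fock_star_fock: "F \<in> fock H \<Longrightarrow> fock_star J F \<in> fock H"
proof -
  assume F: "F \<in> fock H"
  then have gs: "graded_sym H F" by (simp add: fock_iff)
  have "graded_sym H (fock_star J F)"
    unfolding graded_sym_def[OF sh] fock_star_def
  proof (intro allI impI)
    fix xs ys x y k k'
    assume *: "set xs \<subseteq> H 0 \<union> H 1" "set ys \<subseteq> H 0 \<union> H 1" "x \<in> H k" "y \<in> H k'"
    have "set (map J (rev zs)) \<subseteq> H 0 \<union> H 1" if "set zs \<subseteq> H 0 \<union> H 1" for zs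
      using that J_parity by fastforce
    then have "F (map J (rev ys) @ J y # J x # map J (rev xs)) =
        comm_sign k' k * F (map J (rev ys) @ J x # J y # map J (rev xs))"
      using * by (intro graded_symD[OF gs] J_parity)
    then have "cnj (F (map J (rev ys) @ J y # J x # map J (rev xs))) =
        comm_sign k k' * cnj (F (map J (rev ys) @ J x # J y # map J (rev xs)))"
      unfolding comm_sign_commute[of k' k] by simp
    then show "cnj (F (map J (rev (xs @ x # y # ys)))) = comm_sign k k' * cnj (F (map J (rev (xs @ y # x # ys))))"
      by simp
  qed
  then show ?thesis using F by (simp add: fock_iff l2form_fock_star[OF J_antiunitary])
qed

text \<open>Testing the difference against its own star gives its squared norm.\<close>

lemma fock_nondegenerate:
  assumes F: "F \<in> fock H" "F' \<in> fock H" and eq: "\<And>G. G \<in> fock H \<Longrightarrow> fock_pair J F G = fock_pair J F' G"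
  shows "F = F'"
proof -
  let ?D = "\<lambda>hs. F hs + (- 1) * F' hs"
  have D: "?D \<in> fock H" by (intro fock_add fock_cmult F)
  have "fock_pair J ?D G = 0" if G: "G \<in> fock H" for G
  proof -
    have "fock_pair J ?D G = fock_pair J F G + fock_pair J (\<lambda>hs. - 1 * F' hs) G"
      by (intro fock_pair_add_left[OF J_antiunitary] fock_l2form F G fock_cmult)
    then show ?thesis using eq[OF G] fock_pair_cmult_left[of J "-1" F' G] by simp
  qed
  from this[OF fock_star_fock[OF D]] have "l2norm ?D = 0"
    unfolding fock_pair_star_self[OF J_antiunitary fock_l2form[OF D]] by simp
  from l2norm_zero_imp[OF fock_l2form[OF D] this] show ?thesis by (simp add: fun_eq_iff)
qed

text \<open>Additivity and homogeneity of \<open>T'\<close> hold inside the pairing, and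
  nondegeneracy removes the pairing.\<close>

lemma transposed_linear:
  assumes T: "T \<in> fock H \<rightarrow> fock H" and tr: "is_transposed H J T T'"
  shows "linear_on_fock H T'"
proof -
  have T': "\<And>F. F \<in> fock H \<Longrightarrow> T' F \<in> fock H"
    and eq: "\<And>F G. F \<in> fock H \<Longrightarrow> G \<in> fock H \<Longrightarrow> fock_pair J (T' F) G = fock_pair J F (T G)"
    using tr by (auto simp: is_transposed_def)
  have "T' (\<lambda>hs. F hs + G hs) = (\<lambda>hs. T' F hs + T' G hs)" if FG: "F \<in> fock H" "G \<in> fock H" for F G
  proof (rule fock_nondegenerate)
    fix K assume K: "K \<in> fock H"
    have TK: "T K \<in> fock H" using T K by auto
    have "fock_pair J (T' (\<lambda>hs. F hs + G hs)) K = fock_pair J F (T K) + fock_pair J G (T K)"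
      unfolding eq[OF fock_add[OF FG] K]
      by (intro fock_pair_add_left[OF J_antiunitary] fock_l2form FG TK)
    also have "\<dots> = fock_pair J (\<lambda>hs. T' F hs + T' G hs) K"
      unfolding eq[OF FG(1) K, symmetric] eq[OF FG(2) K, symmetric]
      by (intro fock_pair_add_left[OF J_antiunitary, symmetric] fock_l2form T' FG K)
    finally show "fock_pair J (T' (\<lambda>hs. F hs + G hs)) K = fock_pair J (\<lambda>hs. T' F hs + T' G hs) K" .
  qed (intro T' fock_add FG)+
  moreover have "T' (\<lambda>hs. c * F hs) = (\<lambda>hs. c * T' F hs)" if F: "F \<in> fock H" for F c
    by (rule fock_nondegenerate)
      (simp_all add: T' fock_cmult F eq fock_pair_cmult_left[of J])
  ultimately show ?thesis using T' by (auto simp: linear_on_fock_def)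
qed

text \<open>The limit is taken pointwise, where antilinearity and graded symmetry are closed
  conditions. Bounds on finite sums of squares survive the limit and give the norm estimate with the
  same rate \<open>e\<close>.\<close>

lemma fock_complete:
  fixes S :: "nat \<Rightarrow> 'h list \<Rightarrow> complex" and e :: "nat \<Rightarrow> real"
  assumes S: "\<And>n. S n \<in> fock H" and e: "e \<longlonglongrightarrow> 0"
    and Cauchy: "\<And>m n. n \<le> m \<Longrightarrow> l2norm (\<lambda>hs. S m hs + - 1 * S n hs) \<le> e n"
  shows "\<exists>G\<in>fock H. \<forall>n. l2norm (\<lambda>hs. G hs + - 1 * S n hs) \<le> e n"
proof -
  have diff: "l2form (\<lambda>hs. S m hs + - 1 * S n hs)" for m n
    by (intro fock_l2form fock_add fock_cmult S)
  have e_nn: "0 \<le> e n" for n using Cauchy[of n n] l2norm_nonneg order_trans by blast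
  have prod_nn: "0 \<le> pnorm xs" for xs :: "'h list" by (rule prod_list_nonneg) auto
  have bound: "cmod (S m xs - S n xs) \<le> e n * pnorm xs" if "n \<le> m" for m n xs
  proof -
    have "cmod (S m xs - S n xs) \<le> l2norm (\<lambda>hs. S m hs + - 1 * S n hs) * pnorm xs"
      using l2form_bound[OF diff[of m n], of xs] by simp
    also have "\<dots> \<le> e n * pnorm xs" by (intro mult_right_mono Cauchy that prod_nn)
    finally show ?thesis .
  qed
  have "\<exists>l. (\<lambda>n. S n xs) \<longlonglongrightarrow> l" for xs
  proof -
    have lim: "(\<lambda>n. e n * pnorm xs) \<longlonglongrightarrow> 0" using tendsto_mult_right[OF e] by simp
    have "Cauchy (\<lambda>n. S n xs)"
    proof (rule CauchyI')
      fix \<epsilon> :: real assume "\<epsilon> > 0"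
      then obtain N where N: "\<And>n. n \<ge> N \<Longrightarrow> norm (e n * pnorm xs - 0) < \<epsilon>"
        using LIMSEQ_D[OF lim] by blast
      have "dist (S m xs) (S n xs) < \<epsilon>" if "n \<ge> N" "n > m" "m \<ge> N" for m n
      proof -
        have "norm (S n xs - S m xs) \<le> e m * pnorm xs" using bound that by simp
        also have "\<dots> < \<epsilon>" using N[of m] that by simp
        finally show ?thesis by (simp add: dist_norm norm_minus_commute)
      qed
      then show "\<exists>M. \<forall>m\<ge>M. \<forall>n>m. dist (S m xs) (S n xs) < \<epsilon>" by (intro exI[of _ N]) auto
    qed
    then show ?thesis using Cauchy_convergent convergent_def by blast
  qed
  then obtain G where G: "\<And>xs. (\<lambda>n. S n xs) \<longlonglongrightarrow> G xs" by metis
  have Sm: "multi_antilinear (S n)" for n using fock_l2form[OF S] by (simp add: l2form_def bform_def)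
  have "multi_antilinear G" unfolding multi_antilinear_def
  proof (intro conjI allI)
    fix xs ys x y
    have "(\<lambda>n. S n (xs @ (x + y) # ys)) \<longlonglongrightarrow> G (xs @ x # ys) + G (xs @ y # ys)"
      unfolding multi_antilinear_add[OF Sm] by (intro tendsto_add G)
    then show "G (xs @ (x + y) # ys) = G (xs @ x # ys) + G (xs @ y # ys)" using G LIMSEQ_unique by blast
  next
    fix xs ys c x
    have "(\<lambda>n. S n (xs @ (c *\<^sub>C x) # ys)) \<longlonglongrightarrow> cnj c * G (xs @ x # ys)"
      unfolding multi_antilinear_scaleC[OF Sm] by (intro tendsto_mult_left G)
    then show "G (xs @ (c *\<^sub>C x) # ys) = cnj c * G (xs @ x # ys)" using G LIMSEQ_unique by blast
  qed
  have "bounded_form G" unfolding bounded_form_def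
  proof (intro allI exI impI)
    fix n and xs :: "'h list" assume "length xs = n"
    have "cmod (S m xs) \<le> (l2norm (S 0) + e 0) * pnorm xs" for m
      using bound[of 0 m xs] l2form_bound[OF fock_l2form[OF S[of 0]], of xs]
        norm_triangle_ineq[of "S m xs - S 0 xs" "S 0 xs"] by (simp add: distrib_right)
    then show "cmod (G xs) \<le> (l2norm (S 0) + e 0) * pnorm xs"
      by (intro LIMSEQ_le_const2[OF tendsto_norm[OF G]]) auto
  qed
  have "graded_sym H G" unfolding graded_sym_def[OF sh]
  proof (intro allI impI)
    fix xs ys x y k k'
    assume *: "set xs \<subseteq> H 0 \<union> H 1" "set ys \<subseteq> H 0 \<union> H 1" "x \<in> H k" "y \<in> H k'"
    have "S n (xs @ x # y # ys) = comm_sign k k' * S n (xs @ y # x # ys)" for n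
      by (rule graded_symD) (use S[of n] * in \<open>auto simp: fock_iff\<close>)
    then have "(\<lambda>n. S n (xs @ x # y # ys)) \<longlonglongrightarrow> comm_sign k k' * G (xs @ y # x # ys)"
      by (simp only:) (intro tendsto_mult_left G)
    then show "G (xs @ x # y # ys) = comm_sign k k' * G (xs @ y # x # ys)" using G LIMSEQ_unique by blast
  qed
  have fin: "(\<Sum>hs\<in>X. (cmod (G hs + - 1 * S n hs))\<^sup>2) \<le> (e n)\<^sup>2" if X: "finite X" "X \<subseteq> lists onb" for X n
  proof -
    have "(\<Sum>hs\<in>X. (cmod (S m hs + - 1 * S n hs))\<^sup>2) \<le> (e n)\<^sup>2" if "n \<le> m" for m
    proof -
      have "(\<Sum>hs\<in>X. (cmod (S m hs + - 1 * S n hs))\<^sup>2) \<le> (l2norm (\<lambda>hs. S m hs + - 1 * S n hs))\<^sup>2"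
        unfolding l2norm_def using finite_sum_le_infsum[OF l2form_summable[OF diff] X] 
        by (subst real_sqrt_pow2) (auto intro: infsum_nonneg)
      also have "\<dots> \<le> (e n)\<^sup>2" by (intro power_mono Cauchy that) simp
      finally show ?thesis .
    qed
    moreover have "(\<lambda>m. \<Sum>hs\<in>X. (cmod (S m hs + - 1 * S n hs))\<^sup>2) \<longlonglongrightarrow> (\<Sum>hs\<in>X. (cmod (G hs + - 1 * S n hs))\<^sup>2)"
      by (intro tendsto_sum tendsto_power tendsto_norm tendsto_add G tendsto_const)
    ultimately show ?thesis by (intro LIMSEQ_le_const2) auto
  qed
  have sum: "(\<lambda>hs. (cmod (G hs + - 1 * S n hs))\<^sup>2) summable_on lists onb" for n
    by (rule nonneg_bdd_above_summable_on) (use fin in \<open>auto intro!: bdd_aboveI[of _ "(e n)\<^sup>2"]\<close>)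
  have norm: "l2norm (\<lambda>hs. G hs + - 1 * S n hs) \<le> e n" for n
  proof -
    have "infsum (\<lambda>hs. (cmod (G hs + - 1 * S n hs))\<^sup>2) (lists onb) \<le> (e n)\<^sup>2"
      by (rule infsum_le_finite_sums[OF sum fin])
    then show ?thesis unfolding l2norm_def by (intro real_le_lsqrt e_nn) 
  qed
  have bG: "bform G" using \<open>multi_antilinear G\<close> \<open>bounded_form G\<close> by (simp add: bform_def)
  have S0: "bform (S 0)" using fock_l2form[OF S] by (simp add: l2form_def)
  have "l2form (\<lambda>hs. G hs + - 1 * S 0 hs)"
    using sum[of 0] bform_add[OF bG bform_cmult[OF S0, of "-1"]] by (simp add: l2form_def)
  from l2form_add[OF this fock_l2form[OF S[of 0]]] have "l2form G" by simp
  then have "G \<in> fock H" using \<open>graded_sym H G\<close> by (simp add: fock_iff)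
  then show ?thesis using norm by blast
qed

text \<open>The Hellinger--Toeplitz theorem, by a gliding hump.\<close>

lemma transposed_bounded:
  assumes T: "T \<in> fock H \<rightarrow> fock H" and tr: "is_transposed H J T T'"
  shows "\<exists>C. \<forall>F\<in>fock H. l2norm (T' F) \<le> C * l2norm F"
proof (rule ccontr)
  assume "\<not> ?thesis"
  \<comment> \<open>The factor 6 matches the margin 1/2 - 1/3 = 1/6 that remains at the end,
    \<open>4 ^ n\<close> is the scale of the n-th correction, and \<open>Suc n\<close> is the lower
    bound for the norm of \<open>T G\<close> that becomes contradictory.\<close>
  then have "\<exists>F\<in>fock H. l2norm (T' F) > 6 * real (Suc n) * 4 ^ n * l2norm F" for n
    by (meson not_le)
  then obtain F where F: "\<And>n. F n \<in> fock H"
    and big: "\<And>n. l2norm (T' (F n)) > 6 * real (Suc n) * 4 ^ n * l2norm (F n)" by metis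
  have T': "\<And>F. F \<in> fock H \<Longrightarrow> T' F \<in> fock H"
    and eq: "\<And>F G. F \<in> fock H \<Longrightarrow> G \<in> fock H \<Longrightarrow> fock_pair J (T' F) G = fock_pair J F (T G)"
    using tr by (auto simp: is_transposed_def)
  define t where "t n = l2norm (T' (F n))" for n
  have t: "0 < t n" for n
    unfolding t_def using big[of n] by (rule le_less_trans[rotated]) simp
  define \<phi> where "\<phi> n G = fock_pair J (T' (F n)) G" for n G
  \<comment> \<open>The unit vector at which the functional \<phi> n attains its norm
    \<open>t n\<close>.\<close>
  define K where "K n = (\<lambda>hs. complex_of_real (1 / t n) * fock_star J (T' (F n)) hs)" for n
  have K: "K n \<in> fock H" for n unfolding K_def by (intro fock_cmult fock_star_fock T' F)
  have nK: "l2norm (K n) = 1" for n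
    unfolding K_def l2norm_cmult l2norm_fock_star[OF J_antiunitary fock_l2form[OF T'[OF F]]]
    using t[of n] by (simp add: t_def[symmetric] norm_divide)
  have \<phi>K: "\<phi> n (K n) = complex_of_real (t n)" for n
    unfolding \<phi>_def K_def fock_pair_cmult_right
      fock_pair_star_self[OF J_antiunitary fock_l2form[OF T'[OF F]]]
    using t[of n] by (simp add: t_def[symmetric] power2_eq_square)
  have \<phi>_add: "\<phi> n (\<lambda>hs. G hs + G' hs) = \<phi> n G + \<phi> n G'" if "G \<in> fock H" "G' \<in> fock H" for n G G'
    unfolding \<phi>_def by (intro fock_pair_add_right[OF J_antiunitary] fock_l2form T' F that)
  have \<phi>_cmult: "\<phi> n (\<lambda>hs. c * G hs) = c * \<phi> n G" for n c G
    unfolding \<phi>_def by (rule fock_pair_cmult_right)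
  have \<phi>_bound: "cmod (\<phi> n G) \<le> t n * l2norm G" if "G \<in> fock H" for n G
    unfolding \<phi>_def t_def by (intro fock_pair_bound[OF J_antiunitary] fock_l2form T' F that)
  \<comment> \<open>The values of \<phi> n at the two candidates differ by t n / 4 ^ n, so at least
    one of them has modulus at least half of that. The correction is added only when the current
    vector fails.\<close>
  define S where "S = rec_nat (\<lambda>hs. 0) (\<lambda>n G. if cmod (\<phi> n G) \<ge> t n / (2 * 4 ^ n) then G
      else (\<lambda>hs. G hs + complex_of_real (1 / 4 ^ n) * K n hs))"
  have S_0: "S 0 = (\<lambda>hs. 0)" and S_Suc: "S (Suc n) = (if cmod (\<phi> n (S n)) \<ge> t n / (2 * 4 ^ n) then S n
      else (\<lambda>hs. S n hs + complex_of_real (1 / 4 ^ n) * K n hs))" for n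
    by (simp_all add: S_def)
  have zero: "(\<lambda>hs. 0) \<in> fock H" using fock_cmult[OF F[of 0], of 0] by simp
  have S: "S n \<in> fock H" for n
  proof (induction n)
    case (Suc n)
    then show ?case unfolding S_Suc by (auto simp del: of_real_divide intro!: fock_add fock_cmult K)
  qed (simp add: S_0 zero)
  have hump: "cmod (\<phi> n (S (Suc n))) \<ge> t n / (2 * 4 ^ n)" for n
  proof (cases "cmod (\<phi> n (S n)) \<ge> t n / (2 * 4 ^ n)")
    case False
    have "\<phi> n (S (Suc n)) = \<phi> n (S n) + complex_of_real (t n / 4 ^ n)"
      unfolding S_Suc if_not_P[OF False] \<phi>_add[OF S fock_cmult[OF K]] \<phi>_cmult \<phi>K by simp
    then have "cmod (complex_of_real (t n / 4 ^ n)) \<le> cmod (\<phi> n (S (Suc n))) + cmod (\<phi> n (S n))"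
      using norm_triangle_ineq4[of "\<phi> n (S (Suc n))" "\<phi> n (S n)"] by (simp del: of_real_divide)
    then have "t n / 4 ^ n \<le> cmod (\<phi> n (S (Suc n))) + cmod (\<phi> n (S n))"
      using t[of n] by (simp add: norm_divide norm_power)
    then show ?thesis using False by (simp add: field_simps)
  qed (simp add: S_Suc)
  have step: "l2norm (\<lambda>hs. S (Suc n) hs + - 1 * S n hs) \<le> 1 / 4 ^ n" for n
  proof (cases "cmod (\<phi> n (S n)) \<ge> t n / (2 * 4 ^ n)")
    case True
    then show ?thesis by (simp add: S_Suc l2norm_def)
  next
    case False
    then have "(\<lambda>hs. S (Suc n) hs + - 1 * S n hs) = (\<lambda>hs. complex_of_real (1 / 4 ^ n) * K n hs)"
      by (simp add: S_Suc)
    then show ?thesis by (simp only: l2norm_cmult nK) (simp add: norm_divide norm_power)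
  qed
  \<comment> \<open>A geometric series of ratio 1/4; stating its exact partial sum lets the
    induction close.\<close>
  have "l2norm (\<lambda>hs. S (n + d) hs + - 1 * S n hs) \<le> (4 / 3) / 4 ^ n - (4 / 3) / 4 ^ (n + d)" for n d
  proof (induction d)
    case 0
    show ?case by (simp add: l2norm_def)
  next
    case (Suc d)
    have l2: "l2form (\<lambda>hs. S i hs + - 1 * S j hs)" for i j by (intro fock_l2form fock_add fock_cmult S)
    have "l2norm (\<lambda>hs. S (n + Suc d) hs + - 1 * S n hs) \<le>
        l2norm (\<lambda>hs. S (Suc (n + d)) hs + - 1 * S (n + d) hs) + l2norm (\<lambda>hs. S (n + d) hs + - 1 * S n hs)"
      using l2norm_triangle[OF l2[of "Suc (n + d)" "n + d"] l2[of "n + d" n]] by simp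
    also have "\<dots> \<le> 1 / 4 ^ (n + d) + ((4 / 3) / 4 ^ n - (4 / 3) / 4 ^ (n + d))"
      by (rule add_mono[OF step Suc])
    also have "\<dots> = (4 / 3) / 4 ^ n - (4 / 3) / 4 ^ (n + Suc d)" by (simp add: field_simps)
    finally show ?case .
  qed
  then have Cauchy: "l2norm (\<lambda>hs. S m hs + - 1 * S n hs) \<le> (4 / 3) / 4 ^ n" if "n \<le> m" for m n
  proof -
    have "l2norm (\<lambda>hs. S m hs + - 1 * S n hs) \<le> (4 / 3) / 4 ^ n - (4 / 3) / 4 ^ m"
      using \<open>\<And>n d. l2norm (\<lambda>hs. S (n + d) hs + - 1 * S n hs) \<le> (4 / 3) / 4 ^ n - (4 / 3) / 4 ^ (n + d)\<close>[of n "m - n"] that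
      by simp
    also have "\<dots> \<le> (4 / 3) / 4 ^ n" by simp
    finally show ?thesis .
  qed
  have "(\<lambda>n. (4 / 3) / 4 ^ n :: real) \<longlonglongrightarrow> 0"
    using tendsto_mult_right[OF LIMSEQ_realpow_zero[of "1 / 4"], of "4 / 3"] by (simp add: power_one_over mult.commute)
  from fock_complete[OF S this Cauchy] obtain G where G: "G \<in> fock H"
    and dist: "\<And>n. l2norm (\<lambda>hs. G hs + - 1 * S n hs) \<le> (4 / 3) / 4 ^ n" by blast
  have large: "real (Suc n) < l2norm (T G)" for n
  proof -
    have TG: "T G \<in> fock H" using T G by auto
    let ?D = "\<lambda>hs. G hs + - 1 * S (Suc n) hs"
    have D: "?D \<in> fock H" by (intro fock_add fock_cmult G S)
    have "\<phi> n G = \<phi> n (S (Suc n)) + \<phi> n ?D"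
      using \<phi>_add[OF S[of "Suc n"] D, of n] by simp
    then have "cmod (\<phi> n G) \<ge> cmod (\<phi> n (S (Suc n))) - cmod (\<phi> n ?D)"
      by (metis norm_diff_ineq)
    \<comment> \<open>The corrections after the n-th change \<phi> n by at most t n / (3 * 4 ^ n),
      which is below the height t n / (2 * 4 ^ n) of the hump.\<close>
    moreover have "cmod (\<phi> n ?D) \<le> t n * ((4 / 3) / 4 ^ Suc n)"
      by (rule order_trans[OF \<phi>_bound[OF D]]) (intro mult_left_mono dist less_imp_le[OF t])
    ultimately have "cmod (\<phi> n G) \<ge> t n / (2 * 4 ^ n) - t n * ((4 / 3) / 4 ^ Suc n)" using hump[of n] by linarith
    also have "t n / (2 * 4 ^ n) - t n * ((4 / 3) / 4 ^ Suc n) = t n / (6 * 4 ^ n)" by (simp add: field_simps)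
    finally have "t n / (6 * 4 ^ n) \<le> cmod (\<phi> n G)" .
    also have "\<dots> \<le> l2norm (F n) * l2norm (T G)"
      unfolding \<phi>_def eq[OF F G] by (intro fock_pair_bound[OF J_antiunitary] fock_l2form F TG)
    finally have "t n \<le> (6 * 4 ^ n) * (l2norm (F n) * l2norm (T G))" by (simp add: field_simps)
    then have "6 * real (Suc n) * 4 ^ n * l2norm (F n) < (6 * 4 ^ n) * (l2norm (F n) * l2norm (T G))"
      using big[of n] unfolding t_def by linarith
    then have "(6 * 4 ^ n * l2norm (F n)) * real (Suc n) < (6 * 4 ^ n * l2norm (F n)) * l2norm (T G)"
      by (simp only: mult_ac)
    then show ?thesis by (rule mult_left_less_imp_less) simp
  qed
  obtain n where "l2norm (T G) < real n" using reals_Archimedean2 by blast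
  with large[of n] show False by simp
qed

end

section \<open>Norms in the Grassmann algebra\<close>

definition wt :: "'a list \<Rightarrow> ennreal" where
  "wt ls = ennreal (1 / (fact (length ls))\<^sup>2)"

lemma wt_less_top [simp]: "wt ls < top"
  by (simp add: wt_def)

lemma wt_Nil [simp]: "wt [] = 1"
  by (simp add: wt_def)

definition gsum :: "('a::complex_hilbert list \<Rightarrow> complex) \<Rightarrow> ennreal" where
  "gsum l = infsum (\<lambda>ls. wt ls * sqn (l ls)) (lists onb)"

lemma ennreal_wt: "ennreal ((cmod z)\<^sup>2 / (fact (length ls))\<^sup>2) = wt ls * sqn z"
  by (simp add: wt_def sqn_def flip: ennreal_mult)

lemma grass_iff: "l \<in> grass \<longleftrightarrow> bform l \<and> skew l \<and> gsum l < top"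
  by (auto simp: grass_def bform_def alt_eq_iff_skew gsum_def summable_iff_esum ennreal_wt)

lemma choose_ge: "0 < p \<Longrightarrow> p < n \<Longrightarrow> n \<le> n choose p"
proof (induction n arbitrary: p)
  case (Suc m)
  obtain r where r: "p = Suc r" "r < m" using Suc.prems by (cases p) auto
  show ?case
  proof (cases "Suc r < m")
    case True
    then have "m \<le> m choose Suc r" using Suc.IH[of "Suc r"] by simp
    moreover have "1 \<le> m choose r" using r by (simp add: Suc_le_eq)
    ultimately show ?thesis unfolding r(1) binomial_Suc_Suc by linarith
  next
    case False
    then have "m = Suc r" using r by simp
    then show ?thesis by (simp add: r)
  qed
qed simp

text \<open>For positive n the two end terms are 1, and the n - 1 inner ones are at most 1 / n by
  \<open>choose_ge\<close>.\<close>

lemma sum_inverse_choose: "(\<Sum>p\<le>n. 1 / real (n choose p)) \<le> 3"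
proof (cases "n = 0")
  case False
  show ?thesis
  proof -
    have "(\<Sum>p\<le>n. 1 / real (n choose p)) = 1 + (\<Sum>p\<in>{1..n}. 1 / real (n choose p))"
      using sum.atMost_shift[of "\<lambda>p. 1 / real (n choose p)" n]
      by (simp add: atLeast0AtMost[symmetric] sum.atLeast_Suc_atMost)
    also have "(\<Sum>p\<in>{1..n}. 1 / real (n choose p)) = 1 + (\<Sum>p\<in>{1..<n}. 1 / real (n choose p))"
      using False by (simp add: sum.last_plus)
    also have "(\<Sum>p\<in>{1..<n}. 1 / real (n choose p)) \<le> (\<Sum>p\<in>{1..<n}. 1 / real n)"
      by (rule sum_mono) (use choose_ge[of _ n] in \<open>auto intro!: divide_left_mono\<close>)
    also have "\<dots> \<le> 1" by (simp add: divide_le_eq)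
    finally show ?thesis by simp
  qed
qed simp

lemma norm_sum_squared_le:
  "(cmod (\<Sum>i\<in>I. complex_of_real (f i) * g i))\<^sup>2 \<le> (\<Sum>i\<in>I. (f i)\<^sup>2) * (\<Sum>i\<in>I. (cmod (g i))\<^sup>2)"
proof -
  have "cmod (\<Sum>i\<in>I. complex_of_real (f i) * g i) \<le> (\<Sum>i\<in>I. \<bar>f i\<bar> * \<bar>cmod (g i)\<bar>)"
    by (rule order_trans[OF norm_sum]) (simp add: norm_mult)
  also have "\<dots> \<le> L2_set f I * L2_set (\<lambda>i. cmod (g i)) I"
    by (rule L2_set_mult_ineq)
  finally have "(cmod (\<Sum>i\<in>I. complex_of_real (f i) * g i))\<^sup>2 \<le> (L2_set f I * L2_set (\<lambda>i. cmod (g i)) I)\<^sup>2"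
    by (rule power_mono) simp
  then show ?thesis by (simp add: power_mult_distrib L2_set_def sum_nonneg)
qed

lemma esum_sum: "infsum (\<lambda>x. \<Sum>i\<in>I. f i x) A = (\<Sum>i\<in>I. infsum (f i) A)" for f :: "_ \<Rightarrow> _ \<Rightarrow> ennreal"
  by (induction I rule: infinite_finite_induct) (simp_all add: esum_add)

text \<open>\<open>alt\<close> averages over permutations of the slots, each of which preserves the
  sum over basis words. Cauchy-Schwarz over the n! terms turns the squared factor 1 / n! into a
  single 1 / n!, which the sum over permutations absorbs.\<close>

lemma esum_alt_le:
  "infsum (\<lambda>ls. sqn (alt \<phi> ls)) (tuples B n) \<le> infsum (\<lambda>ls. sqn (\<phi> ls)) (tuples B n)"
proof -
  let ?P = "{\<sigma>. \<sigma> permutes {..<n}}"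
  have fin: "finite ?P" by (simp add: finite_permutations)
  have sgn: "\<bar>real_of_int (sign \<sigma>)\<bar> = 1" for \<sigma> :: "nat \<Rightarrow> nat"
    by (metis abs_sign of_int_1 of_int_abs)
  have le: "sqn (alt \<phi> ls) \<le> (\<Sum>\<sigma>\<in>?P. ennreal (1 / fact n) * sqn (\<phi> (permute_list \<sigma> ls)))"
    if ls: "ls \<in> tuples B n" for ls
  proof -
    have l: "length ls = n" using ls by (simp add: tuples_def)
    have "alt \<phi> ls = (\<Sum>\<sigma>\<in>?P. complex_of_real (1 / fact n) * (of_int (sign \<sigma>) * \<phi> (permute_list \<sigma> ls)))"
      by (simp add: alt_def l sum_distrib_left)
    then have "(cmod (alt \<phi> ls))\<^sup>2 \<le> (\<Sum>\<sigma>\<in>?P. (1 / fact n)\<^sup>2) *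
        (\<Sum>\<sigma>\<in>?P. (cmod (of_int (sign \<sigma>) * \<phi> (permute_list \<sigma> ls)))\<^sup>2)"
      by (simp only: norm_sum_squared_le)
    also have "\<dots> = (\<Sum>\<sigma>\<in>?P. (1 / fact n) * (cmod (\<phi> (permute_list \<sigma> ls)))\<^sup>2)"
      by (simp add: card_permutations norm_mult sgn power2_eq_square sum_distrib_left)
    finally have "sqn (alt \<phi> ls) \<le> ennreal (\<Sum>\<sigma>\<in>?P. (1 / fact n) * (cmod (\<phi> (permute_list \<sigma> ls)))\<^sup>2)"
      unfolding sqn_def by (rule ennreal_leI)
    also have "\<dots> = (\<Sum>\<sigma>\<in>?P. ennreal ((1 / fact n) * (cmod (\<phi> (permute_list \<sigma> ls)))\<^sup>2))"
      by (rule sum_ennreal[symmetric]) simp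
    also have "\<dots> = (\<Sum>\<sigma>\<in>?P. ennreal (1 / fact n) * sqn (\<phi> (permute_list \<sigma> ls)))"
      unfolding sqn_def by (intro sum.cong refl ennreal_mult) auto
    finally show ?thesis .
  qed
  have perm: "infsum (\<lambda>ls. sqn (\<phi> (permute_list \<sigma> ls))) (tuples B n) = infsum (\<lambda>ls. sqn (\<phi> ls)) (tuples B n)"
    if s: "\<sigma> \<in> ?P" for \<sigma>
  proof (rule infsum_reindex_bij_betw)
    have i: "inv \<sigma> permutes {..<n}" using s by (simp add: permutes_inv)
    show "bij_betw (permute_list \<sigma>) (tuples B n) (tuples B n)"
      by (rule bij_betwI[of _ _ _ "permute_list (inv \<sigma>)"])
        (use s i in \<open>auto simp: tuples_def permutes_inv_o set_permute_list permute_list_compose[symmetric]\<close>)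
  qed
  have "infsum (\<lambda>ls. sqn (alt \<phi> ls)) (tuples B n) \<le>
      infsum (\<lambda>ls. \<Sum>\<sigma>\<in>?P. ennreal (1 / fact n) * sqn (\<phi> (permute_list \<sigma> ls))) (tuples B n)"
    by (rule esum_mono[OF le])
  also have "\<dots> = (\<Sum>\<sigma>\<in>?P. infsum (\<lambda>ls. ennreal (1 / fact n) * sqn (\<phi> (permute_list \<sigma> ls))) (tuples B n))"
    by (rule esum_sum)
  also have "\<dots> = (\<Sum>\<sigma>\<in>?P. ennreal (1 / fact n) * infsum (\<lambda>ls. sqn (\<phi> ls)) (tuples B n))"
    by (simp add: esum_cmult perm)
  also have "\<dots> = infsum (\<lambda>ls. sqn (\<phi> ls)) (tuples B n)"
    by (simp add: card_permutations mult.assoc[symmetric] ennreal_of_nat_eq_real_of_nat flip: ennreal_mult)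
  finally show ?thesis .
qed

text \<open>The coefficient sqrt (n choose p) is written as sqrt (1 / (n choose p)) times (n choose
  p). Cauchy-Schwarz leaves the sum of 1 / (n choose p), at most 3, and (n choose p)^2 / (n!)^2 = 1
  / (p! (n - p)!)^2 distributes the weight over the two blocks.\<close>

lemma gpair_pointwise:
  "wt ls * sqn (gpair w ls) \<le> (\<Sum>p\<le>length ls. 3 * (ennreal (1 / (fact p)\<^sup>2) * ennreal (1 / (fact (length ls - p))\<^sup>2) *
     sqn (alt (\<lambda>xs. w (take p xs) (drop p xs)) ls)))"
proof -
  let ?n = "length ls"
  define A where "A p = alt (\<lambda>xs. w (take p xs) (drop p xs)) ls" for p
  have bin: "fact ?n / (fact p * fact (?n - p)) = real (?n choose p)" if "p \<le> ?n" for p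
    using that by (simp add: binomial_fact)
  have "gpair w ls = (\<Sum>p\<le>?n. complex_of_real (sqrt (1 / real (?n choose p))) * (of_real (real (?n choose p)) * A p))"
    unfolding gpair_def A_def
  proof (rule sum.cong)
    fix p assume p: "p \<in> {..?n}"
    have "sqrt (1 / real (?n choose p)) * real (?n choose p) = sqrt (real (?n choose p))"
      using p by (simp add: real_sqrt_divide real_div_sqrt)
    from arg_cong[OF this, of complex_of_real]
    show "complex_of_real (sqrt (fact ?n / (fact p * fact (?n - p)))) * alt (\<lambda>xs. w (take p xs) (drop p xs)) ls =
      complex_of_real (sqrt (1 / real (?n choose p))) *
       (of_real (real (?n choose p)) * alt (\<lambda>xs. w (take p xs) (drop p xs)) ls)"
      using bin p by (simp del: of_real_of_nat_eq flip: mult.assoc of_real_mult)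
  qed simp
  then have "(cmod (gpair w ls))\<^sup>2 \<le> (\<Sum>p\<le>?n. (sqrt (1 / real (?n choose p)))\<^sup>2) *
      (\<Sum>p\<le>?n. (cmod (of_real (real (?n choose p)) * A p))\<^sup>2)"
    by (simp only: norm_sum_squared_le)
  also have "\<dots> \<le> 3 * (\<Sum>p\<le>?n. (cmod (of_real (real (?n choose p)) * A p))\<^sup>2)"
    using sum_inverse_choose[of ?n] by (intro mult_right_mono sum_nonneg) simp_all
  finally have "(cmod (gpair w ls))\<^sup>2 / (fact ?n)\<^sup>2 \<le>
      3 * (\<Sum>p\<le>?n. (cmod (of_real (real (?n choose p)) * A p))\<^sup>2) / (fact ?n)\<^sup>2"
    by (rule divide_right_mono) simp
  also have "\<dots> = (\<Sum>p\<le>?n. 3 * (1 / (fact p)\<^sup>2 * (1 / (fact (?n - p))\<^sup>2) * (cmod (A p))\<^sup>2))"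
    unfolding sum_distrib_left sum_divide_distrib
  proof (rule sum.cong)
    fix p assume p: "p \<in> {..?n}"
    have "(real (?n choose p))\<^sup>2 / (fact ?n)\<^sup>2 = 1 / (fact p)\<^sup>2 * (1 / (fact (?n - p))\<^sup>2)"
      using bin[of p] p by (simp add: power_divide power_mult_distrib field_simps flip: bin)
    moreover have "3 * (cmod (of_real (real (?n choose p)) * A p))\<^sup>2 / (fact ?n)\<^sup>2 =
        3 * ((real (?n choose p))\<^sup>2 / (fact ?n)\<^sup>2 * (cmod (A p))\<^sup>2)"
      by (simp add: norm_mult power_mult_distrib)
    ultimately show "3 * (cmod (of_real (real (?n choose p)) * A p))\<^sup>2 / (fact ?n)\<^sup>2 =
        3 * (1 / (fact p)\<^sup>2 * (1 / (fact (?n - p))\<^sup>2) * (cmod (A p))\<^sup>2)"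
      by (simp only:)
  qed simp
  finally have "wt ls * sqn (gpair w ls) \<le>
      ennreal (\<Sum>p\<le>?n. 3 * (1 / (fact p)\<^sup>2 * (1 / (fact (?n - p))\<^sup>2) * (cmod (A p))\<^sup>2))"
    unfolding ennreal_wt[symmetric] by (rule ennreal_leI)
  also have "\<dots> = (\<Sum>p\<le>?n. ennreal (3 * (1 / (fact p)\<^sup>2 * (1 / (fact (?n - p))\<^sup>2) * (cmod (A p))\<^sup>2)))"
    by (rule sum_ennreal[symmetric]) simp
  also have "\<dots> = (\<Sum>p\<le>?n. 3 * (ennreal (1 / (fact p)\<^sup>2) * ennreal (1 / (fact (?n - p))\<^sup>2) * sqn (A p)))"
    by (intro sum.cong refl) (simp add: sqn_def flip: ennreal_mult ennreal_numeral)
  finally show ?thesis by (simp only: A_def)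
qed

text \<open>A list with a cut position is the same datum as a pair of lists.\<close>

lemma esum_split_lists:
  "infsum (\<lambda>ls. \<Sum>p\<le>length ls. f (take p ls) (drop p ls)) (lists B) =
   infsum (\<lambda>a. infsum (f a) (lists B)) (lists B)" for f :: "_ \<Rightarrow> _ \<Rightarrow> ennreal"
proof -
  have "infsum (\<lambda>ls. \<Sum>p\<le>length ls. f (take p ls) (drop p ls)) (lists B) =
      infsum (\<lambda>(ls, p). f (take p ls) (drop p ls)) (Sigma (lists B) (\<lambda>ls. {..length ls}))"
    by (simp add: esum_Sigma)
  also have "\<dots> = infsum (\<lambda>(a, b). f a b) (lists B \<times> lists B)"
    by (rule infsum_reindex_bij_witness[of _ "\<lambda>(a, b). (a @ b, length a)" "\<lambda>(ls, p). (take p ls, drop p ls)"])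
      (auto dest: in_set_takeD in_set_dropD simp: min_def)
  finally show ?thesis by (simp add: esum_Sigma)
qed

lemma gsum_gpair_le:
  "gsum (gpair w) \<le> 3 * infsum (\<lambda>a. infsum (\<lambda>b. wt a * wt b * sqn (w a b)) (lists onb)) (lists onb)"
proof -
  let ?k = "\<lambda>n p. 3 * (ennreal (1 / (fact p)\<^sup>2) * ennreal (1 / (fact (n - p))\<^sup>2))"
  \<comment> \<open>The sum is grouped by length because \<open>esum_alt_le\<close> removes
    \<open>alt\<close> only after summation over all words of one degree.\<close>
  have "gsum (gpair w) \<le> infsum (\<lambda>n. infsum (\<lambda>ls. wt ls * sqn (gpair w ls)) (tuples onb n)) UNIV"
    unfolding gsum_def esum_lists by simp
  also have "\<dots> \<le> infsum (\<lambda>n. infsum (\<lambda>ls. \<Sum>p\<le>n. ?k n p * sqn (w (take p ls) (drop p ls))) (tuples onb n)) UNIV"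
  proof (rule esum_mono)
    fix n :: nat
    have "infsum (\<lambda>ls. wt ls * sqn (gpair w ls)) (tuples onb n) \<le>
        infsum (\<lambda>ls. \<Sum>p\<le>n. ?k n p * sqn (alt (\<lambda>xs. w (take p xs) (drop p xs)) ls)) (tuples onb n)"
      by (rule esum_mono, rule order_trans[OF gpair_pointwise])
        (auto simp: tuples_def mult.assoc intro!: sum_mono)
    also have "\<dots> = (\<Sum>p\<le>n. ?k n p * infsum (\<lambda>ls. sqn (alt (\<lambda>xs. w (take p xs) (drop p xs)) ls)) (tuples onb n))"
      by (simp only: esum_sum esum_cmult)
    also have "\<dots> \<le> (\<Sum>p\<le>n. ?k n p * infsum (\<lambda>ls. sqn (w (take p ls) (drop p ls))) (tuples onb n))"
      by (intro sum_mono mult_left_mono esum_alt_le) simp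
    also have "\<dots> = infsum (\<lambda>ls. \<Sum>p\<le>n. ?k n p * sqn (w (take p ls) (drop p ls))) (tuples onb n)"
      by (simp only: esum_sum esum_cmult)
    finally show "infsum (\<lambda>ls. wt ls * sqn (gpair w ls)) (tuples onb n) \<le> \<dots>" .
  qed
  also have "\<dots> = infsum (\<lambda>n. infsum (\<lambda>ls. \<Sum>p\<le>length ls. 3 * (wt (take p ls) * wt (drop p ls) *
      sqn (w (take p ls) (drop p ls)))) (tuples onb n)) UNIV"
    by (intro infsum_cong sum.cong) (auto simp: tuples_def wt_def min_def mult.assoc)
  also have "\<dots> = infsum (\<lambda>a. infsum (\<lambda>b. 3 * (wt a * wt b * sqn (w a b))) (lists onb)) (lists onb)"
    unfolding esum_lists[symmetric] by (rule esum_split_lists)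
  finally show ?thesis by (simp only: esum_cmult)
qed

lemma gsum_grass_mult_le: "gsum (grass_mult l m) \<le> 3 * (gsum l * gsum m)"
proof -
  have "gsum (grass_mult l m) \<le>
      3 * infsum (\<lambda>a. infsum (\<lambda>b. wt a * wt b * sqn (l a * m b)) (lists onb)) (lists onb)"
    unfolding grass_mult_gpair by (rule gsum_gpair_le)
  also have "infsum (\<lambda>a. infsum (\<lambda>b. wt a * wt b * sqn (l a * m b)) (lists onb)) (lists onb) =
      infsum (\<lambda>a. infsum (\<lambda>b. (wt a * sqn (l a)) * (wt b * sqn (m b))) (lists onb)) (lists onb)"
    by (simp add: sqn_mult mult_ac)
  also have "\<dots> = gsum l * gsum m" unfolding gsum_def by (simp only: esum_cmult esum_cmult_right)
  finally show ?thesis .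
qed

lemma gsum_vac: "gsum vac = (1 :: ennreal)"
proof -
  have "gsum (vac :: 'a list \<Rightarrow> complex) = infsum (\<lambda>ls :: 'a list. wt ls * sqn (vac ls)) {[]}"
    unfolding gsum_def by (rule infsum_cong_neutral) (auto simp: vac_def sqn_def)
  then show ?thesis by (simp add: vac_def sqn_def)
qed

text \<open>Through \<open>gpair_shuf\<close> both properties are read off from the recursion of
  \<open>shuf\<close>.\<close>

lemma bform_gpair:
  fixes w :: "'a::complex_hilbert list \<Rightarrow> 'a list \<Rightarrow> complex"
  assumes sk: "\<And>b. skew (\<lambda>a. w a b)" "\<And>a. skew (w a)"
    and ml: "\<And>b. multi_antilinear (\<lambda>a. w a b)" "\<And>a. multi_antilinear (w a)"
    and bd: "\<And>m n. \<exists>C. \<forall>a b. length a = m \<longrightarrow> length b = n \<longrightarrow>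
      cmod (w a b) \<le> C * (pnorm a * pnorm b)"
  shows "bform (gpair w)"
proof -
  let ?w = "\<lambda>a b. rfac a * rfac b * w a b"
  have eq: "gpair w = (\<lambda>ls. (1 / complex_of_real (sqrt (fact (length ls)))) * shuf ?w ls)"
    using gpair_shuf[OF sk] by (simp add: fun_eq_iff rfac_def field_simps)
  have "multi_antilinear (shuf ?w)"
  proof (rule multi_antilinear_shuf)
    show "multi_antilinear (\<lambda>a. ?w a b)" for b
      using multi_antilinear_weight[OF ml(1), of "\<lambda>n. complex_of_real (sqrt (fact n)) * rfac b"]
      by (simp add: rfac_def)
    show "multi_antilinear (?w a)" for a
      using multi_antilinear_weight[OF ml(2), of "\<lambda>n. rfac a * complex_of_real (sqrt (fact n))"]
      by (simp add: rfac_def)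
  qed
  then have "multi_antilinear (gpair w)" unfolding eq by (rule multi_antilinear_weight)
  moreover have "bounded_form (gpair w)" unfolding bounded_form_def
  proof
    fix n
    obtain C where C: "\<And>m n a b. length a = m \<Longrightarrow> length b = n \<Longrightarrow>
        cmod (w a b) \<le> C m n * (pnorm a * pnorm b)" using bd by metis
    let ?c = "\<lambda>m n. sqrt (fact m) * sqrt (fact n) * C m n"
    from shuf_bound[of ?c n] obtain D where D: "\<forall>(w :: 'a list \<Rightarrow> 'a list \<Rightarrow> complex) r. 0 \<le> r \<longrightarrow>
       (\<forall>a b. norm (w a b) \<le> r * ?c (length a) (length b) * (pnorm a * pnorm b)) \<longrightarrow>
       (\<forall>ls. length ls = n \<longrightarrow> norm (shuf w ls) \<le> r * D * pnorm ls)" by blast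
    have W: "norm (?w a b) \<le> 1 * ?c (length a) (length b) * (pnorm a * pnorm b)" for a b
    proof -
      have "norm (?w a b) = sqrt (fact (length a)) * sqrt (fact (length b)) * cmod (w a b)"
        by (simp add: norm_mult rfac_def)
      also have "\<dots> \<le> sqrt (fact (length a)) * sqrt (fact (length b)) * (C (length a) (length b) *
          (pnorm a * pnorm b))"
        by (intro mult_left_mono C) auto
      finally show ?thesis by (simp add: mult.assoc)
    qed
    have S: "norm (shuf ?w ls) \<le> 1 * D * pnorm ls" if "length ls = n" for ls
      by (rule D[rule_format]) (use W that in auto)
    have "cmod (gpair w ls) \<le> (D / sqrt (fact n)) * pnorm ls" if l: "length ls = n" for ls
      unfolding eq using S[OF l] l by (simp add: norm_mult norm_divide divide_right_mono)
    then show "\<exists>C. \<forall>xs. length xs = n \<longrightarrow> cmod (gpair w xs) \<le> C * pnorm xs" by blast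
  qed
  ultimately show ?thesis by (simp add: bform_def)
qed

section \<open>Closure of the Grassmann algebra under products\<close>

lemma grass_bounds:
  assumes "l \<in> grass" "m \<in> grass"
  shows "\<exists>C. \<forall>a b. length a = n \<longrightarrow> length b = n' \<longrightarrow>
      cmod (l a * m b) \<le> C * (pnorm a * pnorm b)"
proof -
  obtain C where C: "\<And>xs. length xs = n \<Longrightarrow> cmod (l xs) \<le> C * pnorm xs"
    using assms(1) unfolding grass_def bounded_form_def by blast
  obtain D where D: "\<And>xs. length xs = n' \<Longrightarrow> cmod (m xs) \<le> D * pnorm xs"
    using assms(2) unfolding grass_def bounded_form_def by blast
  have "cmod (l a * m b) \<le> (C * D) * (pnorm a * pnorm b)"
    if "length a = n" "length b = n'" for a b
  proof -
    have "cmod (l a * m b) \<le> (C * pnorm a) * (D * pnorm b)"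
      unfolding norm_mult using C[OF that(1)] D[OF that(2)] order_trans[OF norm_ge_zero]
      by (intro mult_mono) auto
    then show ?thesis by (simp add: mult_ac)
  qed
  then show ?thesis by blast
qed

lemma grass_mult_closed:
  assumes "l \<in> grass" "m \<in> grass"
  shows "grass_mult l m \<in> grass"
proof -
  have l: "bform l" "skew l" "gsum l < top" and m: "bform m" "skew m" "gsum m < top"
    using assms by (auto simp: grass_iff)
  have "gsum (grass_mult l m) < top"
    using gsum_grass_mult_le[of l m] l m by (simp add: ennreal_mult_less_top less_le_trans le_less_trans)
  moreover have "bform (grass_mult l m)"
    unfolding grass_mult_gpair
  proof (rule bform_gpair)
    show "multi_antilinear (\<lambda>a. l a * m b)" for b
      using multi_antilinear_cmult[of l "m b"] l by (simp add: bform_def mult.commute)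
    show "multi_antilinear (\<lambda>b. l a * m b)" for a
      using multi_antilinear_cmult[of m "l a"] m by (simp add: bform_def)
  qed (use l m grass_bounds[OF assms] in \<open>auto intro: skew_cmult skew_mult_right\<close>)
  ultimately show ?thesis by (simp add: grass_iff skew_grass_mult)
qed

lemma vac_grass: "vac \<in> grass"
proof -
  have "bform vac"
    unfolding bform_def multi_antilinear_def bounded_form_def
    by (auto simp: vac_def intro!: exI[of _ 1] prod_list_nonneg)
  then show ?thesis by (simp add: grass_iff skew_vac gsum_vac)
qed

lemma gprod_grass: "set ms \<subseteq> grass \<Longrightarrow> gprod ms \<in> grass"
  by (induction ms) (auto simp: vac_grass grass_mult_closed)

lemma gsum_gprod_le: "gsum (gprod ms) \<le> 3 ^ length ms * prod_list (map gsum ms)"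
proof (induction ms)
  case (Cons m ms)
  have "gsum (gprod (m # ms)) \<le> 3 * (gsum m * gsum (gprod ms))"
    using gsum_grass_mult_le[of m "gprod ms"] by simp
  also have "\<dots> \<le> 3 * (gsum m * (3 ^ length ms * prod_list (map gsum ms)))"
    by (intro mult_left_mono Cons) auto
  finally show ?case by (simp add: mult_ac)
qed (simp add: gsum_vac)

section \<open>The Grassmann extension of the Fock space\<close>

definition ssum :: "('l::complex_hilbert, 'h::complex_hilbert) sform \<Rightarrow> ennreal" where
  "ssum X = infsum (\<lambda>ls. wt ls * infsum (\<lambda>hs. sqn (X ls hs)) (lists onb)) (lists onb)"

lemma summable_ssum_iff:
  "(\<lambda>(ls, hs). (cmod (X ls hs))\<^sup>2 / (fact (length ls))\<^sup>2) summable_on (lists onb \<times> lists onb) \<longleftrightarrow> ssum X < top"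
proof -
  have "(\<lambda>(ls, hs). (cmod (X ls hs))\<^sup>2 / (fact (length ls))\<^sup>2) summable_on (lists onb \<times> lists onb) \<longleftrightarrow>
      infsum (\<lambda>z. ennreal (case z of (ls, hs) \<Rightarrow> (cmod (X ls hs))\<^sup>2 / (fact (length ls))\<^sup>2)) (lists onb \<times> lists onb) < top"
    by (rule summable_iff_esum) auto
  also have "infsum (\<lambda>z. ennreal (case z of (ls, hs) \<Rightarrow> (cmod (X ls hs))\<^sup>2 / (fact (length ls))\<^sup>2)) (lists onb \<times> lists onb) = ssum X"
    by (simp add: esum_Sigma ennreal_wt esum_cmult ssum_def)
  finally show ?thesis .
qed

lemma skew_add: "skew f \<Longrightarrow> skew g \<Longrightarrow> skew (\<lambda>a. f a + g a)"
proof -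
  assume f: "skew f" and g: "skew g"
  show ?thesis unfolding skew_def
  proof (intro allI)
    fix xs x y ys
    show "f (xs @ x # y # ys) + g (xs @ x # y # ys) = - (f (xs @ y # x # ys) + g (xs @ y # x # ys))"
      using skewD[OF f, of xs x y ys] skewD[OF g, of xs x y ys] by simp
  qed
qed

lemma prod_norm_nonneg: "0 \<le> pnorm (xs :: 'a::real_normed_vector list)"
  by (rule prod_list_nonneg) auto

context
  fixes H E :: "bit \<Rightarrow> 'h::complex_hilbert set" and J :: "'h \<Rightarrow> 'h"
  assumes sh: "super_hilbert H E J"
begin

lemma slam_iff:
  "X \<in> slam H \<longleftrightarrow>
     (\<forall>hs. multi_antilinear (\<lambda>ls :: 'l::complex_hilbert list. X ls hs) \<and> skew (\<lambda>ls. X ls hs)) \<and>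
     (\<forall>ls. multi_antilinear (X ls) \<and> graded_sym H (X ls)) \<and>
     (\<forall>m n. \<exists>C. \<forall>ls hs. length ls = m \<longrightarrow> length hs = n \<longrightarrow>
        cmod (X ls hs) \<le> C * (pnorm ls * pnorm hs)) \<and>
     ssum X < top"
proof -
  have "multi_antilinear F \<and> sym_proj H F = F \<longleftrightarrow> multi_antilinear F \<and> graded_sym H F" for F
    using sym_proj_eq_iff_graded_sym[OF sh, of F] by blast
  then show ?thesis
    by (simp only: slam_def mem_Collect_eq summable_ssum_iff alt_eq_iff_skew)
qed

lemma slam_bform:
  assumes X: "X \<in> slam H"
  shows slam_bform_left: "bform (\<lambda>ls :: 'l::complex_hilbert list. X ls hs)"
    and slam_bform_right: "bform (X ls)"
proof -
  have "\<forall>m n. \<exists>C. \<forall>ls hs. length ls = m \<longrightarrow> length hs = n \<longrightarrow>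
      cmod (X ls hs) \<le> C * (pnorm ls * pnorm hs)"
    using X unfolding slam_iff by blast
  then obtain C where C: "\<And>m n ls hs. length ls = m \<Longrightarrow> length hs = n \<Longrightarrow>
      cmod (X ls hs) \<le> C m n * (pnorm ls * pnorm hs)"
    by metis
  have "bounded_form (\<lambda>ls. X ls hs)" unfolding bounded_form_def
  proof (intro allI exI impI)
    fix n and xs :: "'l list" assume "length xs = n"
    then show "cmod (X xs hs) \<le> (C n (length hs) * pnorm hs) * pnorm xs"
      using C[of xs n hs] by (simp add: mult_ac)
  qed
  then show "bform (\<lambda>ls. X ls hs)" using X by (simp add: bform_def slam_iff)
  have "bounded_form (X ls)" unfolding bounded_form_def
  proof (intro allI exI impI)
    fix n and xs :: "'h list" assume "length xs = n"
    then show "cmod (X ls xs) \<le> (C (length ls) n * pnorm ls) * pnorm xs"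
      using C[of ls "length ls" xs n] by (simp add: mult_ac)
  qed
  then show "bform (X ls)" using X by (simp add: bform_def slam_iff)
qed

text \<open>\<open>ssum\<close> controls only basis words \<open>ls\<close>;
  \<open>bform_bound\<close> in the Grassmann arguments extends this to all lists, and the squared
  factorial undoes the weight. Hence every partial form \<open>X ls\<close> lies in
  \<open>fock H\<close>.\<close>

lemma slam_slot_bound:
  assumes X: "X \<in> slam H"
  shows "infsum (\<lambda>hs. sqn (X ls hs)) (lists onb) \<le>
    ennreal ((pnorm (ls :: 'l::complex_hilbert list))\<^sup>2) * (ennreal ((fact (length ls))\<^sup>2) * ssum X)"
proof -
  let ?n = "length ls"
  have "infsum (\<lambda>hs. sqn (X ls hs)) (lists onb) \<le> infsum (\<lambda>hs. ennreal ((pnorm ls)\<^sup>2) *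
      infsum (\<lambda>ls'. sqn (X ls' hs)) (tuples onb ?n)) (lists onb)"
    by (rule esum_mono) (rule bform_bound[OF is_onb_onb slam_bform_left[OF X]])
  also have "\<dots> = ennreal ((pnorm ls)\<^sup>2) *
      infsum (\<lambda>ls'. infsum (\<lambda>hs. sqn (X ls' hs)) (lists onb)) (tuples onb ?n)"
    by (simp only: esum_cmult esum_swap[of _ "tuples onb ?n" "lists onb"])
  also have "infsum (\<lambda>ls'. infsum (\<lambda>hs. sqn (X ls' hs)) (lists onb)) (tuples onb ?n) =
      infsum (\<lambda>ls'. ennreal ((fact ?n)\<^sup>2) * (wt ls' * infsum (\<lambda>hs. sqn (X ls' hs)) (lists onb))) (tuples onb ?n)"
    by (intro infsum_cong) (simp add: tuples_def wt_def mult.assoc[symmetric] flip: ennreal_mult)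
  also have "\<dots> \<le> ennreal ((fact ?n)\<^sup>2) * ssum X"
    unfolding ssum_def esum_cmult by (intro mult_left_mono esum_tuples_le_lists) simp
  finally show ?thesis by (simp add: mult_left_mono)
qed

lemma slam_fock:
  assumes X: "X \<in> slam H"
  shows "X (ls :: 'l::complex_hilbert list) \<in> fock H"
proof -
  have "infsum (\<lambda>hs. sqn (X ls hs)) (lists onb) < top"
    by (rule le_less_trans[OF slam_slot_bound[OF X]])
      (use X in \<open>simp add: slam_iff ennreal_mult_less_top\<close>)
  then show ?thesis using X slam_bform_right[OF X]
    by (simp add: fock_iff[OF sh] l2form_def summable_sqn_iff slam_iff)
qed

lemma slam_l2norm_bound:
  assumes X: "X \<in> slam H"
  shows "\<exists>C. \<forall>ls :: 'l::complex_hilbert list. length ls = n \<longrightarrow> l2norm (X ls) \<le> C * pnorm ls"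
proof -
  define c where "c = enn2real (ennreal ((fact n)\<^sup>2) * ssum X)"
  have c: "ennreal ((fact n)\<^sup>2) * ssum X = ennreal c" "0 \<le> c"
    unfolding c_def using X by (simp_all add: slam_iff ennreal_mult_less_top)
  have "l2norm (X ls) \<le> sqrt c * pnorm ls" if l: "length ls = n" for ls :: "'l list"
  proof -
    have "ennreal ((l2norm (X ls))\<^sup>2) \<le> ennreal ((pnorm ls)\<^sup>2 * c)"
      using slam_slot_bound[OF X, of ls] l c
      by (simp add: esum_l2norm[OF fock_l2form[OF sh slam_fock[OF X]]] ennreal_mult)
    then have "(l2norm (X ls))\<^sup>2 \<le> (sqrt c * pnorm ls)\<^sup>2"
      using c by (simp add: ennreal_le_iff power_mult_distrib mult.commute)
    then show ?thesis by (rule power2_le_imp_le) (use c prod_norm_nonneg[of ls] in simp)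
  qed
  then show ?thesis by blast
qed

text \<open>Here a form is regarded as a skew multi-antilinear map into \<open>fock H\<close>; the
  joint bound follows from \<open>l2form_bound\<close> in the second group of arguments.\<close>

lemma slamI:
  assumes a: "\<And>hs. multi_antilinear (\<lambda>ls :: 'l::complex_hilbert list. X ls hs)" "\<And>hs. skew (\<lambda>ls. X ls hs)"
    and b: "\<And>ls. X ls \<in> fock H"
    and c: "\<And>n. \<exists>C. \<forall>ls. length ls = n \<longrightarrow> l2norm (X ls) \<le> C * pnorm ls"
    and d: "ssum X < top"
  shows "X \<in> slam H"
  unfolding slam_iff
proof (intro conjI allI a d)
  show "multi_antilinear (X ls)" "graded_sym H (X ls)" for ls
    using b[of ls] by (simp_all add: fock_iff[OF sh] l2form_def bform_def)
  fix m n
  obtain C where C: "\<And>ls. length ls = m \<Longrightarrow> l2norm (X ls) \<le> C * pnorm ls" using c by blast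
  have "cmod (X ls hs) \<le> C * (pnorm ls * pnorm hs)" if "length ls = m" for ls hs
  proof -
    have "cmod (X ls hs) \<le> l2norm (X ls) * pnorm hs"
      by (rule l2form_bound[OF fock_l2form[OF sh b]])
    also have "\<dots> \<le> (C * pnorm ls) * pnorm hs"
      by (intro mult_right_mono C that prod_norm_nonneg)
    finally show ?thesis by (simp add: mult.assoc)
  qed
  then show "\<exists>C. \<forall>ls hs. length ls = m \<longrightarrow> length hs = n \<longrightarrow>
        cmod (X ls hs) \<le> C * (pnorm ls * pnorm hs)" by blast
qed

lemma slam_add:
  assumes X: "X \<in> slam H" and Y: "Y \<in> slam H"
  shows "(\<lambda>(ls :: 'l::complex_hilbert list) hs. X ls hs + Y ls hs) \<in> slam H"
proof (rule slamI)
  show "multi_antilinear (\<lambda>ls. X ls hs + Y ls hs)" "skew (\<lambda>ls. X ls hs + Y ls hs)" for hs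
    using X Y by (auto simp: slam_iff intro: multi_antilinear_plus skew_add)
  show "(\<lambda>hs. X ls hs + Y ls hs) \<in> fock H" for ls
    by (intro fock_add[OF sh] slam_fock X Y)
  fix n
  obtain C where C: "\<And>ls. length ls = n \<Longrightarrow> l2norm (X ls) \<le> C * pnorm ls"
    using slam_l2norm_bound[OF X] by blast
  obtain D where D: "\<And>ls. length ls = n \<Longrightarrow> l2norm (Y ls) \<le> D * pnorm ls"
    using slam_l2norm_bound[OF Y] by blast
  have "l2norm (\<lambda>hs. X ls hs + Y ls hs) \<le> (C + D) * pnorm ls" if "length ls = n" for ls
    using l2norm_triangle[OF fock_l2form[OF sh slam_fock[OF X]] fock_l2form[OF sh slam_fock[OF Y]], of ls ls]
      C[OF that] D[OF that] by (simp add: distrib_right)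
  then show "\<exists>C. \<forall>ls. length ls = n \<longrightarrow> l2norm (\<lambda>hs. X ls hs + Y ls hs) \<le> C * pnorm ls" by blast
next
  have "ssum (\<lambda>ls hs. X ls hs + Y ls hs) \<le> infsum (\<lambda>ls. wt ls * infsum (\<lambda>hs. 2 * (sqn (X ls hs) + sqn (Y ls hs))) (lists onb)) (lists onb)"
    unfolding ssum_def by (intro esum_mono mult_left_mono sqn_add_le) simp
  also have "\<dots> = 2 * (ssum X + ssum Y)"
    by (simp add: ssum_def esum_cmult esum_add distrib_left mult.left_commute[of _ 2])
  also have "\<dots> < top" using X Y by (simp add: slam_iff ennreal_mult_less_top)
  finally show "ssum (\<lambda>ls hs. X ls hs + Y ls hs) < top" .
qed

lemma slam_cmult:
  assumes X: "X \<in> slam H"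
  shows "(\<lambda>(ls :: 'l::complex_hilbert list) hs. c * X ls hs) \<in> slam H"
proof (rule slamI)
  show "multi_antilinear (\<lambda>ls. c * X ls hs)" "skew (\<lambda>ls. c * X ls hs)" for hs
    using X by (auto simp: slam_iff intro: multi_antilinear_cmult skew_cmult)
  show "(\<lambda>hs. c * X ls hs) \<in> fock H" for ls
    by (intro fock_cmult[OF sh] slam_fock X)
  fix n
  obtain C where C: "\<And>ls. length ls = n \<Longrightarrow> l2norm (X ls) \<le> C * pnorm ls"
    using slam_l2norm_bound[OF X] by blast
  have "l2norm (\<lambda>hs. c * X ls hs) \<le> (cmod c * C) * pnorm ls" if "length ls = n" for ls
    using mult_left_mono[OF C[OF that], of "cmod c"] by (simp add: l2norm_cmult mult.assoc)
  then show "\<exists>C. \<forall>ls. length ls = n \<longrightarrow> l2norm (\<lambda>hs. c * X ls hs) \<le> C * pnorm ls" by blast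
next
  have "ssum (\<lambda>ls hs. c * X ls hs) = sqn c * ssum X"
    by (simp add: ssum_def sqn_mult esum_cmult mult.left_commute[of _ "sqn c"])
  also have "\<dots> < top" using X by (simp add: slam_iff ennreal_mult_less_top sqn_def)
  finally show "ssum (\<lambda>ls hs. c * X ls hs) < top" .
qed

lemma ssum_l2norm:
  assumes "\<And>ls. X ls \<in> fock H"
  shows "ssum X = infsum (\<lambda>ls. wt ls * ennreal ((l2norm (X ls))\<^sup>2)) (lists onb)"
  unfolding ssum_def by (simp add: esum_l2norm[OF fock_l2form[OF sh assms]])

lemma slam_slice_grass:
  assumes X: "X \<in> slam H"
  shows "(\<lambda>ls :: 'l::complex_hilbert list. X ls hs) \<in> grass"
proof -
  have "gsum (\<lambda>ls. X ls hs) \<le> infsum (\<lambda>ls. wt ls * ennreal ((l2norm (X ls))\<^sup>2) * ennreal ((pnorm hs)\<^sup>2)) (lists onb)"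
    unfolding gsum_def
  proof (rule esum_mono)
    fix ls :: "'l list"
    have "(cmod (X ls hs))\<^sup>2 \<le> (l2norm (X ls) * pnorm hs)\<^sup>2"
      by (rule power_mono[OF l2form_bound[OF fock_l2form[OF sh slam_fock[OF X]]]]) simp
    then have "sqn (X ls hs) \<le> ennreal ((l2norm (X ls))\<^sup>2) * ennreal ((pnorm hs)\<^sup>2)"
      unfolding sqn_def by (simp add: power_mult_distrib flip: ennreal_mult)
    then show "wt ls * sqn (X ls hs) \<le> wt ls * ennreal ((l2norm (X ls))\<^sup>2) * ennreal ((pnorm hs)\<^sup>2)"
      unfolding mult.assoc by (rule mult_left_mono) simp
  qed
  also have "\<dots> = ssum X * ennreal ((pnorm hs)\<^sup>2)"
    unfolding esum_cmult_right ssum_l2norm[OF slam_fock[OF X]] ..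
  also have "\<dots> < top" using X by (simp add: slam_iff ennreal_mult_less_top)
  finally show ?thesis
    using X slam_bform_left[OF X] by (simp add: grass_iff slam_iff)
qed

text \<open>Equations between whole Fock vectors, in the shape to which an operator or the pairing
  can be applied.\<close>

lemma slam_Cons_eq:
  fixes X :: "('l::complex_hilbert, 'h) sform"
  assumes X: "X \<in> slam H"
  shows slam_swap: "X (xs @ x # y # ys) = (\<lambda>hs. - 1 * X (xs @ y # x # ys) hs)"
    and slam_plus: "X (xs @ (x + y) # ys) = (\<lambda>hs. X (xs @ x # ys) hs + X (xs @ y # ys) hs)"
    and slam_scaleC: "X (xs @ (c *\<^sub>C x) # ys) = (\<lambda>hs. cnj c * X (xs @ x # ys) hs)"
proof -
  have m: "multi_antilinear (\<lambda>ls. X ls hs)" and s: "skew (\<lambda>ls. X ls hs)" for hs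
    using X by (auto simp: slam_iff)
  show "X (xs @ x # y # ys) = (\<lambda>hs. - 1 * X (xs @ y # x # ys) hs)"
  proof
    fix hs
    show "X (xs @ x # y # ys) hs = - 1 * X (xs @ y # x # ys) hs"
      using skewD[OF s[of hs], of xs x y ys] by simp
  qed
  show "X (xs @ (x + y) # ys) = (\<lambda>hs. X (xs @ x # ys) hs + X (xs @ y # ys) hs)"
    using multi_antilinear_add[OF m] by (intro ext) simp
  show "X (xs @ (c *\<^sub>C x) # ys) = (\<lambda>hs. cnj c * X (xs @ x # ys) hs)"
    using multi_antilinear_scaleC[OF m] by (intro ext) simp
qed

lemma fock_pair_skew:
  fixes X Y :: "('l::complex_hilbert, 'h) sform"
  assumes X: "X \<in> slam H" and Y: "Y \<in> slam H"
  shows "skew (\<lambda>a. fock_pair J (X a) (Y b))" "skew (\<lambda>b. fock_pair J (X a) (Y b))"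
proof -
  show "skew (\<lambda>a. fock_pair J (X a) (Y b))" unfolding skew_def
  proof (intro allI)
    fix xs x y ys
    show "fock_pair J (X (xs @ x # y # ys)) (Y b) = - fock_pair J (X (xs @ y # x # ys)) (Y b)"
      unfolding slam_swap[OF X, of xs x y ys] fock_pair_cmult_left by simp
  qed
  show "skew (\<lambda>b. fock_pair J (X a) (Y b))" unfolding skew_def
  proof (intro allI)
    fix xs x y ys
    show "fock_pair J (X a) (Y (xs @ x # y # ys)) = - fock_pair J (X a) (Y (xs @ y # x # ys))"
      unfolding slam_swap[OF Y, of xs x y ys] fock_pair_cmult_right by simp
  qed
qed

lemma slam_pair_grass:
  fixes X Y :: "('l::complex_hilbert, 'h) sform"
  assumes X: "X \<in> slam H" and Y: "Y \<in> slam H"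
  shows "slam_pair J X Y \<in> grass"
proof -
  note aJ = J_antiunitary[OF sh]
  note lX = fock_l2form[OF sh slam_fock[OF X]] and lY = fock_l2form[OF sh slam_fock[OF Y]]
  let ?w = "\<lambda>a b. fock_pair J (X a) (Y b)"
  have "bform (gpair ?w)"
  proof (rule bform_gpair)
    show "multi_antilinear (\<lambda>a. ?w a b)" for b
      unfolding multi_antilinear_def slam_plus[OF X] slam_scaleC[OF X]
      by (simp add: fock_pair_add_left[OF aJ lX lX lY] fock_pair_cmult_left)
    show "multi_antilinear (?w a)" for a
      unfolding multi_antilinear_def slam_plus[OF Y] slam_scaleC[OF Y]
      by (simp add: fock_pair_add_right[OF aJ lX lY lY] fock_pair_cmult_right)
    fix m n
    obtain C where C: "\<And>ls. length ls = m \<Longrightarrow> l2norm (X ls) \<le> C * pnorm ls"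
      using slam_l2norm_bound[OF X] by blast
    obtain D where D: "\<And>ls. length ls = n \<Longrightarrow> l2norm (Y ls) \<le> D * pnorm ls"
      using slam_l2norm_bound[OF Y] by blast
    have "cmod (?w a b) \<le> (C * D) * (pnorm a * pnorm b)"
      if "length a = m" "length b = n" for a b
    proof -
      have "cmod (?w a b) \<le> l2norm (X a) * l2norm (Y b)" by (rule fock_pair_bound[OF aJ lX lY])
      also have "\<dots> \<le> (C * pnorm a) * (D * pnorm b)"
        using C[OF that(1)] D[OF that(2)] order_trans[OF l2norm_nonneg]
        by (intro mult_mono) auto
      finally show ?thesis by (simp add: mult_ac)
    qed
    then show "\<exists>C. \<forall>a b. length a = m \<longrightarrow> length b = n \<longrightarrow>
      cmod (?w a b) \<le> C * (pnorm a * pnorm b)" by blast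
  qed (rule fock_pair_skew[OF X Y])+
  moreover have "gsum (gpair ?w) < top"
  proof -
    have "gsum (gpair ?w) \<le> 3 * infsum (\<lambda>a. infsum (\<lambda>b. wt a * wt b * sqn (?w a b)) (lists onb)) (lists onb)"
      by (rule gsum_gpair_le)
    \<comment> \<open>Cauchy-Schwarz in the Fock space decouples the two sums.\<close>
    also have "\<dots> \<le> 3 * infsum (\<lambda>a. infsum (\<lambda>b. (wt a * ennreal ((l2norm (X a))\<^sup>2)) *
        (wt b * ennreal ((l2norm (Y b))\<^sup>2))) (lists onb)) (lists onb)"
    proof (intro mult_left_mono esum_mono)
      fix a b :: "'l list"
      have "(cmod (?w a b))\<^sup>2 \<le> (l2norm (X a) * l2norm (Y b))\<^sup>2"
        by (rule power_mono[OF fock_pair_bound[OF aJ lX lY]]) simp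
      then have "sqn (?w a b) \<le> ennreal ((l2norm (X a))\<^sup>2) * ennreal ((l2norm (Y b))\<^sup>2)"
        unfolding sqn_def by (simp add: power_mult_distrib flip: ennreal_mult)
      then have "wt a * wt b * sqn (?w a b) \<le> wt a * wt b * (ennreal ((l2norm (X a))\<^sup>2) * ennreal ((l2norm (Y b))\<^sup>2))"
        by (rule mult_left_mono) simp
      then show "wt a * wt b * sqn (?w a b) \<le> (wt a * ennreal ((l2norm (X a))\<^sup>2)) * (wt b * ennreal ((l2norm (Y b))\<^sup>2))"
        by (simp only: mult_ac)
    qed simp
    also have "\<dots> = 3 * (ssum X * ssum Y)"
      by (simp only: esum_cmult esum_cmult_right ssum_l2norm[OF slam_fock[OF X]] ssum_l2norm[OF slam_fock[OF Y]])
    also have "\<dots> < top" using X Y by (simp add: slam_iff ennreal_mult_less_top)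
    finally show ?thesis .
  qed
  ultimately show ?thesis unfolding slam_pair_gpair by (simp add: grass_iff skew_gpair)
qed

text \<open>\<open>T\<close> acts on every partial form with one constant, so \<open>ssum\<close>
  grows by at most the factor C^2.\<close>

lemma lam_ext_slam:
  fixes X :: "('l::complex_hilbert, 'h) sform"
  assumes T: "linear_on_fock H T" and C: "\<And>F. F \<in> fock H \<Longrightarrow> l2norm (T F) \<le> C * l2norm F"
    and X: "X \<in> slam H"
  shows "lam_ext T X \<in> slam H"
  unfolding lam_ext_def
proof (rule slamI)
  note fX = slam_fock[OF X]
  have Tf: "T (X ls) \<in> fock H" for ls using T fX by (auto simp: linear_on_fock_def)
  then show "T (X ls) \<in> fock H" for ls .
  have Tadd: "T (\<lambda>hs. F hs + G hs) = (\<lambda>hs. T F hs + T G hs)" if "F \<in> fock H" "G \<in> fock H" for F G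
    using T that unfolding linear_on_fock_def by blast
  have Tcm: "T (\<lambda>hs. c * F hs) = (\<lambda>hs. c * T F hs)" if "F \<in> fock H" for F c
    using T that unfolding linear_on_fock_def by blast
  show "multi_antilinear (\<lambda>ls. T (X ls) hs)" for hs
    unfolding multi_antilinear_def slam_plus[OF X] slam_scaleC[OF X] Tadd[OF fX fX] Tcm[OF fX] by simp
  show "skew (\<lambda>ls. T (X ls) hs)" for hs unfolding skew_def
  proof (intro allI)
    fix xs x y ys
    show "T (X (xs @ x # y # ys)) hs = - T (X (xs @ y # x # ys)) hs"
      unfolding slam_swap[OF X, of xs x y ys] Tcm[OF fX] by simp
  qed
  have C': "l2norm (T F) \<le> \<bar>C\<bar> * l2norm F" if "F \<in> fock H" for F
    using C[OF that] by (meson abs_ge_self l2norm_nonneg mult_right_mono order_trans)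
  fix n
  obtain D where D: "\<And>ls. length ls = n \<Longrightarrow> l2norm (X ls) \<le> D * pnorm ls"
    using slam_l2norm_bound[OF X] by blast
  have "l2norm (T (X ls)) \<le> (\<bar>C\<bar> * D) * pnorm ls" if "length ls = n" for ls
    using order_trans[OF C'[OF fX] mult_left_mono[OF D[OF that]]] by (simp add: mult.assoc)
  then show "\<exists>C. \<forall>ls. length ls = n \<longrightarrow> l2norm (T (X ls)) \<le> C * pnorm ls" by blast
  have "ssum (\<lambda>ls. T (X ls)) \<le> infsum (\<lambda>ls. ennreal (C\<^sup>2) * (wt ls * ennreal ((l2norm (X ls))\<^sup>2))) (lists onb)"
    unfolding ssum_l2norm[of "\<lambda>ls. T (X ls)", OF Tf]
  proof (rule esum_mono)
    fix ls :: "'l list"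
    have "(l2norm (T (X ls)))\<^sup>2 \<le> (\<bar>C\<bar> * l2norm (X ls))\<^sup>2" by (rule power_mono[OF C'[OF fX]]) simp
    then have "ennreal ((l2norm (T (X ls)))\<^sup>2) \<le> ennreal (C\<^sup>2) * ennreal ((l2norm (X ls))\<^sup>2)"
      by (simp add: power_mult_distrib flip: ennreal_mult)
    then have "wt ls * ennreal ((l2norm (T (X ls)))\<^sup>2) \<le> wt ls * (ennreal (C\<^sup>2) * ennreal ((l2norm (X ls))\<^sup>2))"
      by (rule mult_left_mono) simp
    then show "wt ls * ennreal ((l2norm (T (X ls)))\<^sup>2) \<le> ennreal (C\<^sup>2) * (wt ls * ennreal ((l2norm (X ls))\<^sup>2))"
      by (simp only: mult_ac)
  qed
  also have "\<dots> = ennreal (C\<^sup>2) * ssum X" by (simp only: esum_cmult ssum_l2norm[OF fX])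
  also have "\<dots> < top" using X by (simp add: slam_iff ennreal_mult_less_top)
  finally show "ssum (\<lambda>ls. T (X ls)) < top" .
qed

end

section \<open>Exponentials\<close>

definition slot :: "('l, 'h) sform \<Rightarrow> 'h \<Rightarrow> 'l list \<Rightarrow> complex" where
  "slot z h = (\<lambda>ls. z ls [h])"

lemma sym_proj_cong:
  assumes "\<And>ys. length ys = length hs \<Longrightarrow> F ys = G ys"
  shows "sym_proj H F hs = sym_proj H G hs"
  unfolding sym_proj_def by (intro arg_cong2[where f = "(*)"] sum.cong refl) (simp add: assms)

lemma sym_proj_sum: "sym_proj H (\<lambda>ys. \<Sum>i\<in>I. F i ys) hs = (\<Sum>i\<in>I. sym_proj H (F i) hs)"
proof (induction I rule: infinite_finite_induct)
  case (insert i I)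
  then show ?case
    by (simp add: sym_proj_def sum.distrib distrib_left add_divide_distrib)
qed (simp_all add: sym_proj_def)

lemma alt_sym_proj:
  "alt (\<lambda>xs. sym_proj H (K xs) hs) ls = sym_proj H (\<lambda>ys. alt (\<lambda>xs. K xs ys) ls) hs"
  unfolding sym_proj_def alt_cmult alt_sum ..

text \<open>Interchanging the two finite sums collects the Grassmann part in \<open>gpair\<close>,
  so that the splits of the Fock arguments can be examined on their own.\<close>

lemma slam_mult_gpair:
  "slam_mult H X Y ls hs = (\<Sum>q\<le>length hs.
     complex_of_real (sqrt (fact (length hs) / (fact q * fact (length hs - q)))) *
     sym_proj H (\<lambda>ys. gpair (\<lambda>a b. X a (take q ys) * Y b (drop q ys)) ls) hs)"
  unfolding slam_mult_def alt_sym_proj gpair_def sym_proj_sum sym_proj_scale sum_distrib_left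
  by (subst sum.swap) (simp only: mult.left_commute mult.assoc)

lemma gpair_zero [simp]: "gpair (\<lambda>a b. 0) ls = 0"
  using gpair_cmult[of 0 "\<lambda>_ _. 0" ls] by simp

lemma sym_proj_zero [simp]: "sym_proj H (\<lambda>ys. 0) hs = 0"
  by (simp add: sym_proj_def)

lemma esum_tuples_prod:
  "infsum (\<lambda>hs. prod_list (map f hs)) (tuples B n) = (infsum f B) ^ n" for f :: "_ \<Rightarrow> ennreal"
proof (induction n)
  case (Suc n)
  then show ?case by (simp add: esum_tuples_Suc esum_cmult esum_cmult_right)
qed simp

context
  fixes H E :: "bit \<Rightarrow> 'h::complex_hilbert set" and J :: "'h \<Rightarrow> 'h"
  assumes sh: "super_hilbert H E J"
begin

lemma h_lam_slam:
  assumes "z \<in> h_lam H"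
  shows "z \<in> (slam H :: ('l::complex_hilbert, 'h) sform set)"
proof -
  obtain X Y where "z = (\<lambda>ls hs. X ls hs + Y ls hs)" "X \<in> h_lam_part H 0" "Y \<in> h_lam_part H 1"
    using assms unfolding h_lam_def by blast
  then show ?thesis using slam_add[OF sh, of X Y] by (simp add: h_lam_part_def)
qed

lemma h_lam_degree:
  fixes z :: "('l::complex_hilbert, 'h) sform"
  assumes "z \<in> h_lam H" "length hs \<noteq> 1"
  shows "z ls hs = 0"
proof -
  obtain X Y where z: "z = (\<lambda>ls hs. X ls hs + Y ls hs)" and XY: "X \<in> h_lam_part H 0" "Y \<in> h_lam_part H 1"
    using assms unfolding h_lam_def by blast
  have "X ls hs = 0" "Y ls hs = 0" using XY assms(2) unfolding h_lam_part_def by blast+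
  then show ?thesis by (simp add: z)
qed

text \<open>The even summand vanishes on \<open>H 1\<close> and the odd one on \<open>H 0\<close>,
  so a homogeneous argument sees only one of them.\<close>

lemma h_lam_parity:
  fixes z :: "('l::complex_hilbert, 'h) sform"
  assumes z: "z \<in> h_lam H" and h: "h \<in> H k"
  shows "has_parity k (slot z h)"
  unfolding has_parity_def slot_def
proof (intro allI impI)
  fix ls assume nz: "z ls [h] \<noteq> 0"
  obtain X Y where z: "z = (\<lambda>ls hs. X ls hs + Y ls hs)" and X: "X \<in> h_lam_part H 0" and Y: "Y \<in> h_lam_part H 1"
    using z unfolding h_lam_def by blast
  have 1: "X ls [h] = 0" if "k = 1" using X h that unfolding h_lam_part_def by simp
  have 2: "Y ls [h] = 0" if "k = 0" using Y h that unfolding h_lam_part_def by simp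
  have 3: "X ls [h] \<noteq> 0 \<Longrightarrow> of_nat (length ls) = (0::bit)" "Y ls [h] \<noteq> 0 \<Longrightarrow> of_nat (length ls) = (1::bit)"
    using X Y unfolding h_lam_part_def by blast+
  show "of_nat (length ls) = k" using bit_cases[of k] 1 2 3 nz z by auto
qed

context
  fixes z :: "('l::complex_hilbert, 'h) sform"
  assumes z: "z \<in> h_lam H"
begin

lemma slot_grass: "slot z h \<in> grass"
  unfolding slot_def by (rule slam_slice_grass[OF sh h_lam_slam[OF z]])

lemma skew_slot: "skew (slot z h)"
  using slot_grass by (simp add: grass_iff)

lemma slot_add: "slot z (x + y) = (\<lambda>ls. slot z x ls + slot z y ls)"
proof
  fix ls
  have "multi_antilinear (z ls)" using h_lam_slam[OF z] by (simp add: slam_iff[OF sh])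
  from multi_antilinear_add[OF this, of "[]" x y "[]"]
  show "slot z (x + y) ls = slot z x ls + slot z y ls" by (simp add: slot_def)
qed

lemma slot_scaleC: "slot z (c *\<^sub>C x) = (\<lambda>ls. cnj c * slot z x ls)"
proof
  fix ls
  have "multi_antilinear (z ls)" using h_lam_slam[OF z] by (simp add: slam_iff[OF sh])
  from multi_antilinear_scaleC[OF this, of "[]" c x "[]"]
  show "slot z (c *\<^sub>C x) ls = cnj c * slot z x ls" by (simp add: slot_def)
qed

lemma gprod_slot_multi_antilinear: "multi_antilinear (\<lambda>hs. gprod (map (slot z) hs) ls)"
  unfolding multi_antilinear_def by (simp add: slot_add slot_scaleC gprod_add gprod_cmult)

lemma gprod_slot_graded_sym: "graded_sym H (\<lambda>hs. gprod (map (slot z) hs) ls)"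
  unfolding graded_sym_def[OF sh]
  by (intro allI impI) (simp only: map_append list.map,
      rule gprod_swap[OF skew_slot skew_slot h_lam_parity[OF z] h_lam_parity[OF z]])

text \<open>As z has degree one in the second group, only the split q = 1 survives. Its coefficient
  sqrt (p + 1) times sqrt (p!) is sqrt ((p + 1)!), and \<open>sym_proj\<close> fixes the exterior
  product.\<close>

lemma slam_power_h_lam:
  "slam_power H z p ls hs =
     (if length hs = p then complex_of_real (sqrt (fact p)) * gprod (map (slot z) hs) ls else 0)"
proof (induction p arbitrary: ls hs)
  case 0
  show ?case by (auto simp: tens_def vac_def)
next
  case (Suc p)
  let ?n = "length hs"
  let ?d = "\<lambda>q. complex_of_real (sqrt (fact ?n / (fact q * fact (?n - q))))"
  let ?P = "\<lambda>q. sym_proj H (\<lambda>ys. gpair (\<lambda>a b. z a (take q ys) * slam_power H z p b (drop q ys)) ls) hs"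
  have zero: "?P q = 0" if q: "q \<le> ?n" "q \<noteq> 1" for q
  proof -
    have "?P q = sym_proj H (\<lambda>ys. 0) hs"
      by (rule sym_proj_cong) (use q in \<open>simp add: h_lam_degree[OF z]\<close>)
    then show ?thesis by simp
  qed
  show ?case
  proof (cases "?n = 0")
    case True
    then show ?thesis using zero[of 0] by (simp add: slam_mult_gpair)
  next
    case False
    have "slam_power H z (Suc p) ls hs = (\<Sum>q\<le>?n. if q = 1 then ?d 1 * ?P 1 else 0)"
      unfolding slam_power.simps slam_mult_gpair by (rule sum.cong) (auto simp: zero)
    also have "\<dots> = ?d 1 * ?P 1"
      using False by (subst sum.delta) (auto simp: Suc_le_eq)
    also have "?P 1 = sym_proj H (\<lambda>ys. (if ?n = Suc p then complex_of_real (sqrt (fact p)) else 0) *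
        gprod (map (slot z) ys) ls) hs"
    proof (rule sym_proj_cong)
      fix ys :: "'h list" assume l: "length ys = ?n"
      then obtain y ys' where y: "ys = y # ys'" using False by (cases ys) auto
      show "gpair (\<lambda>a b. z a (take 1 ys) * slam_power H z p b (drop 1 ys)) ls =
        (if ?n = Suc p then complex_of_real (sqrt (fact p)) else 0) * gprod (map (slot z) ys) ls"
      proof (cases "length ys' = p")
        case True
        have "gpair (\<lambda>a b. z a (take 1 ys) * slam_power H z p b (drop 1 ys)) ls =
            gpair (\<lambda>a b. complex_of_real (sqrt (fact p)) * (slot z y a * gprod (map (slot z) ys') b)) ls"
          using True by (simp add: y Suc slot_def mult_ac)
        also have "\<dots> = complex_of_real (sqrt (fact p)) * gprod (map (slot z) ys) ls"
          unfolding gpair_cmult by (simp add: y grass_mult_gpair)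
        finally show ?thesis using True l y by simp
      next
        case False
        then show ?thesis using l y by (auto simp: Suc)
      qed
    qed
    also have "\<dots> = (if ?n = Suc p then complex_of_real (sqrt (fact p)) else 0) *
        sym_proj H (\<lambda>ys. gprod (map (slot z) ys) ls) hs"
      by (rule sym_proj_scale)
    also have "sym_proj H (\<lambda>ys. gprod (map (slot z) ys) ls) hs = gprod (map (slot z) hs) ls"
      by (simp only: iffD2[OF sym_proj_eq_iff_graded_sym[OF sh gprod_slot_multi_antilinear] gprod_slot_graded_sym])
    also have "?d 1 * ((if ?n = Suc p then complex_of_real (sqrt (fact p)) else 0) * gprod (map (slot z) hs) ls) =
      (if ?n = Suc p then complex_of_real (sqrt (fact (Suc p))) * gprod (map (slot z) hs) ls else 0)"
      by (simp add: real_sqrt_mult real_sqrt_divide)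
    finally show ?thesis .
  qed
qed

text \<open>Only the power of order n = \<open>length hs\<close> contributes, and sqrt (n!) / n! = 1
  / sqrt (n!).\<close>

lemma slam_exp_h_lam: "slam_exp H z ls hs = gprod (map (slot z) hs) ls / rfac hs"
proof -
  let ?n = "length hs"
  have "slam_exp H z ls hs = (\<Sum>p\<in>{?n}. (1 / fact p) * slam_power H z p ls hs)"
    unfolding slam_exp_def by (rule suminf_finite) (auto simp: slam_power_h_lam)
  also have "\<dots> = (rfac hs * gprod (map (slot z) hs) ls) / fact ?n"
    by (simp add: slam_power_h_lam rfac_def)
  also have "\<dots> = gprod (map (slot z) hs) ls / rfac hs"
    unfolding rfac_sq[symmetric] by simp
  finally show ?thesis .
qed

text \<open>The constant must not depend on the Fock arguments; their norms are carried by the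
  factor \<open>r\<close> of \<open>shuf_bound\<close>.\<close>

lemma gprod_slot_bound:
  "\<exists>C. \<forall>ls hs. length ls = m \<longrightarrow> length hs = n \<longrightarrow>
     cmod (gprod (map (slot z) hs) ls) \<le> C * (pnorm ls * pnorm hs)"
proof (induction n arbitrary: m)
  case 0
  have "cmod (vac ls) \<le> 1 * (pnorm ls)" for ls :: "'l list"
    using prod_norm_nonneg[of ls] by (simp add: vac_def)
  then show ?case by (intro exI[of _ 1]) simp
next
  case (Suc n)
  have "\<forall>m. \<exists>C. \<forall>ls. length ls = m \<longrightarrow> (\<forall>h. cmod (z ls [h]) \<le> C * (pnorm ls * norm h))"
  proof
    fix m
    obtain C where C: "\<forall>ls hs. length ls = m \<longrightarrow> length hs = 1 \<longrightarrow>
        cmod (z ls hs) \<le> C * (pnorm ls * pnorm hs)"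
      using h_lam_slam[OF z] unfolding slam_iff[OF sh] by blast
    then show "\<exists>C. \<forall>ls. length ls = m \<longrightarrow> (\<forall>h. cmod (z ls [h]) \<le> C * (pnorm ls * norm h))"
    proof (intro exI[of _ C] allI impI)
      fix ls :: "'l list" and h assume "length ls = m"
      then have "cmod (z ls [h]) \<le> C * (pnorm ls * pnorm [h])"
        by (intro C[rule_format]) simp_all
      then show "cmod (z ls [h]) \<le> C * (pnorm ls * norm h)" by simp
    qed
  qed
  then obtain C where C: "\<And>m ls h. length ls = m \<Longrightarrow> cmod (z ls [h]) \<le> C m * (pnorm ls * norm h)"
    by metis
  obtain D where D: "\<And>m ls hs. length ls = m \<Longrightarrow> length hs = n \<Longrightarrow>
      cmod (gprod (map (slot z) hs) ls) \<le> D m * (pnorm ls * pnorm hs)"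
    using Suc by metis
  let ?c = "\<lambda>m k. sqrt (fact m) * sqrt (fact k) * (C m * D k)"
  obtain K where K: "\<forall>(w :: 'l list \<Rightarrow> 'l list \<Rightarrow> complex) r. 0 \<le> r \<longrightarrow>
       (\<forall>a b. norm (w a b) \<le> r * ?c (length a) (length b) * (pnorm a * pnorm b)) \<longrightarrow>
       (\<forall>ls. length ls = m \<longrightarrow> norm (shuf w ls) \<le> r * K * pnorm ls)"
    using shuf_bound[of ?c m] by blast
  have "cmod (gprod (map (slot z) hs) ls) \<le> (K / sqrt (fact m)) * (pnorm ls * pnorm hs)"
    if l: "length ls = m" and hs: "length hs = Suc n" for ls hs
  proof -
    obtain h hs' where h: "hs = h # hs'" "length hs' = n" using hs by (cases hs) auto
    let ?w = "\<lambda>a b. rfac a * rfac b * (slot z h a * gprod (map (slot z) hs') b)"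
    let ?r = "norm h * pnorm hs'"
    have W: "norm (?w a b) \<le> ?r * ?c (length a) (length b) * (pnorm a * pnorm b)" for a b
    proof -
      have "cmod (slot z h a) * cmod (gprod (map (slot z) hs') b) \<le>
          (C (length a) * (pnorm a * norm h)) * (D (length b) * (pnorm b * pnorm hs'))"
        using C[of a "length a" h] D[of b "length b" hs'] h order_trans[OF norm_ge_zero]
        by (intro mult_mono) (auto simp: slot_def)
      from mult_left_mono[OF this, of "sqrt (fact (length a)) * sqrt (fact (length b))"]
      show ?thesis by (simp add: norm_mult rfac_def mult_ac)
    qed
    have "norm (shuf ?w ls) \<le> ?r * K * pnorm ls"
    proof (rule K[rule_format])
      show "0 \<le> ?r" by (intro mult_nonneg_nonneg prod_norm_nonneg) simp
    qed (use W l in auto)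
    moreover have "rfac ls * gprod (map (slot z) hs) ls = shuf ?w ls"
      unfolding h list.map gprod_simps grass_mult_gpair
      by (rule gpair_shuf) (intro skew_cmult skew_mult_right skew_slot skew_gprod)+
    from arg_cong[OF this, of norm] have "sqrt (fact m) * cmod (gprod (map (slot z) hs) ls) = norm (shuf ?w ls)"
      by (simp only: norm_mult rfac_def l norm_of_real) simp
    ultimately show ?thesis by (simp add: h field_simps)
  qed
  then show ?case by blast
qed

lemma gsum_slot: "infsum (\<lambda>h. gsum (slot z h)) onb < top"
proof -
  have "infsum (\<lambda>h. gsum (slot z h)) onb = infsum (\<lambda>ls. wt ls * infsum (\<lambda>h. sqn (z ls [h])) onb) (lists onb)"
    unfolding gsum_def by (subst esum_swap) (simp add: esum_cmult slot_def)
  also have "\<dots> \<le> ssum z"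
    unfolding ssum_def
  proof (intro esum_mono mult_left_mono)
    fix ls
    have "infsum (\<lambda>h. sqn (z ls [h])) onb = infsum (\<lambda>hs. sqn (z ls hs)) ((\<lambda>h. [h]) ` onb)"
      by (subst infsum_reindex) (auto simp: inj_on_def o_def)
    also have "\<dots> \<le> infsum (\<lambda>hs. sqn (z ls hs)) (lists onb)"
      by (intro infsum_mono_neutral esummable) auto
    finally show "infsum (\<lambda>h. sqn (z ls [h])) onb \<le> infsum (\<lambda>hs. sqn (z ls hs)) (lists onb)" .
  qed simp
  also have "\<dots> < top" using h_lam_slam[OF z] by (simp add: slam_iff[OF sh])
  finally show ?thesis .
qed

lemma slam_exp_slam: "slam_exp H z \<in> slam H"
  unfolding slam_iff[OF sh]
proof (intro conjI allI)
  have g: "gprod (map (slot z) hs) \<in> grass" for hs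
    by (rule gprod_grass) (auto simp: slot_grass)
  have eq: "slam_exp H z = (\<lambda>ls hs. (1 / complex_of_real (sqrt (fact (length hs)))) * gprod (map (slot z) hs) ls)"
    by (simp add: slam_exp_h_lam rfac_def fun_eq_iff)
  show "multi_antilinear (\<lambda>ls. slam_exp H z ls hs)" for hs
    unfolding eq using g[of hs] by (intro multi_antilinear_cmult) (simp add: grass_def)
  show "skew (\<lambda>ls. slam_exp H z ls hs)" for hs
    unfolding eq by (intro skew_cmult skew_gprod)
  show "multi_antilinear (slam_exp H z ls)" for ls
    unfolding eq by (rule multi_antilinear_weight[OF gprod_slot_multi_antilinear])
  show "graded_sym H (slam_exp H z ls)" for ls
    unfolding eq graded_sym_def[OF sh]
  proof (intro allI impI)
    fix xs ys x y k k'
    assume *: "set xs \<subseteq> H 0 \<union> H 1" "set ys \<subseteq> H 0 \<union> H 1" "x \<in> H k" "y \<in> H k'"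
    show "(1 / complex_of_real (sqrt (fact (length (xs @ x # y # ys))))) * gprod (map (slot z) (xs @ x # y # ys)) ls =
       comm_sign k k' * ((1 / complex_of_real (sqrt (fact (length (xs @ y # x # ys))))) * gprod (map (slot z) (xs @ y # x # ys)) ls)"
      unfolding graded_symD[OF sh gprod_slot_graded_sym *] by simp
  qed
  fix m n
  obtain C where C: "\<And>ls hs. length ls = m \<Longrightarrow> length hs = n \<Longrightarrow>
     cmod (gprod (map (slot z) hs) ls) \<le> C * (pnorm ls * pnorm hs)"
    using gprod_slot_bound by metis
  have "cmod (slam_exp H z ls hs) \<le> (C / sqrt (fact n)) * (pnorm ls * pnorm hs)"
    if "length ls = m" "length hs = n" for ls hs
    using divide_right_mono[OF C[OF that], of "sqrt (fact n)"] that
    by (simp add: slam_exp_h_lam norm_divide rfac_def)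
  then show "\<exists>C. \<forall>ls hs. length ls = m \<longrightarrow> length hs = n \<longrightarrow>
      cmod (slam_exp H z ls hs) \<le> C * (pnorm ls * pnorm hs)" by blast
next
  obtain c where c: "infsum (\<lambda>h. gsum (slot z h)) onb = ennreal c" "0 \<le> c"
    using gsum_slot by (metis ennreal_cases less_irrefl infinity_ennreal_def)
  have sq: "sqn (x / rfac hs) = ennreal (1 / fact (length hs)) * sqn x" for x and hs :: "'h list"
    by (simp add: sqn_def rfac_def norm_divide power_divide flip: ennreal_mult)
  \<comment> \<open>With the Fock words outside, each inner sum is the norm of a single exterior
    product.\<close>
  have "ssum (slam_exp H z) = infsum (\<lambda>hs. infsum (\<lambda>ls. wt ls * sqn (slam_exp H z ls hs)) (lists onb)) (lists onb)"
    unfolding ssum_def by (subst esum_swap) (simp add: esum_cmult)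
  also have "\<dots> = infsum (\<lambda>hs. ennreal (1 / fact (length hs)) * gsum (gprod (map (slot z) hs))) (lists onb)"
    by (simp add: slam_exp_h_lam sq mult.left_commute[of "wt _"] esum_cmult gsum_def)
  also have "\<dots> = infsum (\<lambda>n. infsum (\<lambda>hs. ennreal (1 / fact (length hs)) * gsum (gprod (map (slot z) hs))) (tuples onb n)) UNIV"
    by (rule esum_lists)
  \<comment> \<open>The sum over words of length n factorises into the n-th power of c, so the total
    is at most the exponential series of 3 c.\<close>
  also have "\<dots> \<le> infsum (\<lambda>n. infsum (\<lambda>hs. ennreal (1 / fact n) * 3 ^ n * prod_list (map (\<lambda>h. gsum (slot z h)) hs)) (tuples onb n)) UNIV"
  proof (intro esum_mono)
    fix n and hs :: "'h list" assume "hs \<in> tuples onb n"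
    then have "length hs = n" by (simp add: tuples_def)
    then show "ennreal (1 / fact (length hs)) * gsum (gprod (map (slot z) hs)) \<le>
        ennreal (1 / fact n) * 3 ^ n * prod_list (map (\<lambda>h. gsum (slot z h)) hs)"
      using mult_left_mono[OF gsum_gprod_le[of "map (slot z) hs"], of "ennreal (1 / fact n)"]
      by (simp add: o_def mult.assoc)
  qed
  also have "\<dots> = infsum (\<lambda>n. ennreal (inverse (fact n) * (3 * c) ^ n)) UNIV"
    unfolding esum_cmult esum_tuples_prod c(1)
    by (intro infsum_cong)
      (simp add: c(2) ennreal_power power_mult_distrib divide_inverse mult.assoc flip: ennreal_mult ennreal_numeral)
  also have "\<dots> < top"
    by (subst summable_iff_esum[symmetric])
      (use c summable_exp[of "3 * c"] in \<open>auto simp: summable_on_UNIV_nonneg_real_iff\<close>)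
  finally show "ssum (slam_exp H z) < top" .
qed

end

end

section \<open>Reality of the exponential\<close>

lemma grass_involution_vac:
  assumes "grass_involution s"
  shows "s vac = vac"
proof -
  have v: "s vac \<in> grass" "s (s vac) = vac"
    using assms vac_grass unfolding grass_involution_def by blast+
  \<comment> \<open>By the unit law and involutivity the left side is \<open>vac\<close> and the
    right side is \<open>s vac\<close>.\<close>
  have "s (grass_mult (s vac) vac) = grass_mult (s vac) (s (s vac))"
    using assms v(1) vac_grass unfolding grass_involution_def by blast
  moreover have "grass_mult (s vac) vac = s vac"
    using v(1) by (intro grass_mult_vac_right) (simp add: grass_iff)
  ultimately show ?thesis using v by simp
qed

lemma grass_involution_gprod:
  assumes s: "grass_involution s" and "set ms \<subseteq> grass"
  shows "s (gprod ms) = gprod (rev (map s ms))"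
  using assms(2)
proof (induction ms)
  case Nil
  show ?case by (simp add: grass_involution_vac[OF s])
next
  case (Cons m ms)
  have sm: "\<And>l. l \<in> grass \<Longrightarrow> s l \<in> grass" using s unfolding grass_involution_def by blast
  have sk: "\<And>l. l \<in> grass \<Longrightarrow> skew l" by (simp add: grass_iff)
  have "s (gprod (m # ms)) = grass_mult (s (gprod ms)) (s m)"
    using s Cons.prems gprod_grass[of ms] unfolding grass_involution_def by auto
  also have "\<dots> = grass_mult (gprod (rev (map s ms))) (gprod [s m])"
    using Cons sm[of m] by (simp add: grass_mult_vac_right sk)
  also have "\<dots> = gprod (rev (map s ms) @ [s m])"
    by (rule gprod_append[symmetric]) (use Cons.prems sm sk in auto)
  finally show ?case by simp
qed

lemma slam_star_exp:
  assumes sh: "super_hilbert H E J" and s: "grass_involution s" and z: "z \<in> h_lam_diag H J s"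
  shows "slam_star J s (slam_exp H z) = slam_exp H z"
proof (intro ext)
  fix ls hs
  have zl: "z \<in> h_lam H" and zs: "slam_star J s z = z" using z by (auto simp: h_lam_diag_def)
  let ?ms = "map (slot z) (map J (rev hs))"
  have ms: "set ?ms \<subseteq> grass" using slot_grass[OF sh zl] by auto
  have slot: "s (slot z (J h)) = slot z h" for h
    using fun_cong[OF fun_cong[OF zs], of _ "[h]"] by (auto simp: slam_star_def slot_def)
  have "slam_star J s (slam_exp H z) ls hs = s (\<lambda>ls'. (1 / rfac hs) * gprod ?ms ls') ls"
    by (simp add: slam_star_def slam_exp_h_lam[OF sh zl] rfac_def)
  also have "\<dots> = cnj (1 / rfac hs) * s (gprod ?ms) ls"
    using s gprod_grass[OF ms] unfolding grass_involution_def by metis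
  \<comment> \<open>The reversal of the product by \<open>s\<close> undoes the reversal of the
    arguments in \<open>slam_star\<close>.\<close>
  also have "s (gprod ?ms) = gprod (map (slot z) hs)"
    unfolding grass_involution_gprod[OF s ms] by (simp add: rev_map o_def slot)
  also have "cnj (1 / rfac hs) * gprod (map (slot z) hs) ls = slam_exp H z ls hs"
    by (simp add: slam_exp_h_lam[OF sh zl] rfac_def)
  finally show "slam_star J s (slam_exp H z) ls hs = slam_exp H z ls hs" .
qed

section \<open>Polarisation\<close>

lemma real_powser_zero:
  fixes a :: "nat \<Rightarrow> real"
  assumes "\<And>r. (\<lambda>k. a k * r ^ k) sums 0"
  shows "a n = 0"
proof (induction n rule: less_induct)
  case (less n)
  \<comment> \<open>The sum of the remaining series divided by r^n: it is 0 off the origin and a n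
    at the origin. Continuity of the power series at 0 then forces a n = 0.\<close>
  define f where "f r = (if r = 0 then a n else 0)" for r :: real
  have "(\<lambda>k. a (k + n) * r ^ k) sums f r" for r
  proof (cases "r = 0")
    case True
    then show ?thesis using powser_sums_zero[of "\<lambda>k. a (k + n)"] by (simp add: f_def)
  next
    case False
    have "(\<lambda>k. a (k + n) * r ^ (k + n)) sums (0 - (\<Sum>k<n. a k * r ^ k))"
      by (rule sums_split_initial_segment[OF assms])
    then have "(\<lambda>k. r ^ n * (a (k + n) * r ^ k)) sums (r ^ n * 0)"
      using less by (simp add: power_add mult_ac)
    then have "(\<lambda>k. a (k + n) * r ^ k) sums 0"
      using False by (subst (asm) sums_mult_iff) auto
    then show ?thesis using False by (simp add: f_def)
  qed
  then have "(f \<longlongrightarrow> a (0 + n)) (at 0)" by (intro powser_limit_0[of 1]) auto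
  moreover have "(f \<longlongrightarrow> 0) (at 0)"
    by (rule Lim_transform_eventually[OF tendsto_const]) (simp add: f_def eventually_at_filter)
  ultimately show ?case using LIM_unique by fastforce
qed

lemma complex_powser_zero:
  fixes a :: "nat \<Rightarrow> complex"
  assumes "\<And>r. (\<lambda>k. complex_of_real r ^ k * a k) sums 0"
  shows "a n = 0"
proof -
  have "(\<lambda>k. Re (a k) * r ^ k) sums 0" "(\<lambda>k. Im (a k) * r ^ k) sums 0" for r
    using sums_Re[OF assms[of r]] sums_Im[OF assms[of r]]
    by (simp_all add: mult.commute flip: of_real_power)
  from real_powser_zero[OF this(1)] real_powser_zero[OF this(2)] show ?thesis
    by (simp add: complex_eq_iff)
qed

text \<open>
  A multilinear function of formal sums: the sum of \<open>Q\<close> over all words whose \<open>i\<close>-th letter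
  is drawn from the \<open>i\<close>-th list.
\<close>

fun msum :: "('u list \<Rightarrow> complex) \<Rightarrow> 'u list list \<Rightarrow> complex" where
  "msum Q [] = Q []"
| "msum Q (L # Ls) = (\<Sum>u\<leftarrow>L. msum (\<lambda>w. Q (u # w)) Ls)"

lemma msum_add:
  "msum Q (As @ (L @ L') # Bs) = msum Q (As @ L # Bs) + msum Q (As @ L' # Bs)"
  by (induction As arbitrary: Q) (simp_all add: sum_list_addf)

lemma msum_const_mult: "msum (\<lambda>w. c * Q w) Ls = c * msum Q Ls"
  by (induction Ls arbitrary: Q) (simp_all add: sum_list_const_mult)

lemma msum_scale:
  assumes "\<And>xs u ys. Q (xs @ g u # ys) = c * Q (xs @ u # ys)"
  shows "msum Q (As @ map g L # Bs) = c * msum Q (As @ L # Bs)"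
  using assms
proof (induction As arbitrary: Q)
  case Nil
  have "msum (\<lambda>w. Q (g u # w)) Bs = c * msum (\<lambda>w. Q (u # w)) Bs" for u
    using Nil[of "[]" u] by (simp add: msum_const_mult)
  then show ?case by (simp add: o_def sum_list_const_mult)
next
  case (Cons A As)
  have "msum (\<lambda>w. Q (a # w)) (As @ map g L # Bs) = c * msum (\<lambda>w. Q (a # w)) (As @ L # Bs)" for a
    by (rule Cons.IH) (use Cons.prems[of "a # _"] in simp)
  then show ?case by (simp add: sum_list_const_mult)
qed

lemma msum_cong:
  assumes "\<And>w. list_all2 (\<lambda>u L. u \<in> set L) w Ls \<Longrightarrow> Q w = Q' w"
  shows "msum Q Ls = msum Q' Ls"
  using assms
proof (induction Ls arbitrary: Q Q')
  case (Cons L Ls)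
  have "msum (\<lambda>w. Q (u # w)) Ls = msum (\<lambda>w. Q' (u # w)) Ls" if "u \<in> set L" for u
    by (rule Cons.IH) (use Cons.prems that in auto)
  then show ?case by (auto intro!: arg_cong[where f = sum_list])
qed simp

lemma sum_list_swap:
  "(\<Sum>u\<leftarrow>L. \<Sum>v\<leftarrow>L'. f u v) = (\<Sum>v\<leftarrow>L'. \<Sum>u\<leftarrow>L. f u v)" for f :: "_ \<Rightarrow> _ \<Rightarrow> complex"
  by (induction L) (simp_all add: sum_list_addf)

text \<open>All letters of the words that occur stay in \<open>A\<close>, so symmetry of
  \<open>Q\<close> is asked only for words over \<open>A\<close>.\<close>

lemma msum_swap:
  assumes "\<And>xs u v ys. set (xs @ u # v # ys) \<subseteq> A \<Longrightarrow> Q (xs @ u # v # ys) = Q (xs @ v # u # ys)"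
    and "\<Union>(set ` set (As @ L # L' # Bs)) \<subseteq> A"
  shows "msum Q (As @ L # L' # Bs) = msum Q (As @ L' # L # Bs)"
  using assms
proof (induction As arbitrary: Q)
  case Nil
  have "msum (\<lambda>w. Q (u # v # w)) Bs = msum (\<lambda>w. Q (v # u # w)) Bs" if "u \<in> set L" "v \<in> set L'" for u v
  proof (rule msum_cong)
    fix w assume "list_all2 (\<lambda>u L. u \<in> set L) w Bs"
    then have "set w \<subseteq> \<Union>(set ` set Bs)" by (induction rule: list_all2_induct) auto
    then have "set w \<subseteq> A" using Nil(2) by auto
    then show "Q (u # v # w) = Q (v # u # w)"
      using Nil(1)[of "[]" u v w] Nil(2) that by auto
  qed
  then have "msum Q ([] @ L # L' # Bs) = (\<Sum>u\<leftarrow>L. \<Sum>v\<leftarrow>L'. msum (\<lambda>w. Q (v # u # w)) Bs)"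
    by (auto intro!: arg_cong[where f = sum_list])
  then show ?case by (simp add: sum_list_swap[of _ L])
next
  case (Cons C As)
  have "msum (\<lambda>w. Q (a # w)) (As @ L # L' # Bs) = msum (\<lambda>w. Q (a # w)) (As @ L' # L # Bs)"
    if "a \<in> set C" for a
    by (rule Cons.IH) (use Cons.prems(1)[of "a # _"] Cons.prems(2) that in auto)
  then show ?case by (auto intro!: arg_cong[where f = sum_list])
qed

lemma msum_singletons: "msum Q (map (\<lambda>u. [u]) us) = Q us"
proof (induction us arbitrary: Q)
  case (Cons u us)
  show ?case by (simp only: list.map msum.simps Cons.IH sum_list.Cons sum_list.Nil add_0_right)
qed (simp only: list.map msum.simps)

lemma has_sum_sum_list:
  fixes f :: "_ \<Rightarrow> _ \<Rightarrow> complex"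
  assumes "\<And>u. u \<in> set L \<Longrightarrow> ((\<lambda>x. f u x) has_sum S u) A"
  shows "((\<lambda>x. \<Sum>u\<leftarrow>L. f u x) has_sum (\<Sum>u\<leftarrow>L. S u)) A"
  using assms by (induction L) (auto intro!: has_sum_add)

lemma has_sum_msum:
  assumes "\<And>w. length w = length Ls \<Longrightarrow> ((\<lambda>x. Q w x) has_sum S w) A"
  shows "((\<lambda>x. msum (\<lambda>w. Q w x) Ls) has_sum msum S Ls) A"
  using assms
proof (induction Ls arbitrary: Q S)
  case (Cons L Ls)
  show ?case unfolding msum.simps
    by (rule has_sum_sum_list, rule Cons.IH) (use Cons.prems in auto)
qed simp

lemma gpair_sum_list: "gpair (\<lambda>a b. \<Sum>u\<leftarrow>L. w u a b) ls = (\<Sum>u\<leftarrow>L. gpair (w u) ls)"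
  by (induction L) (simp_all add: gpair_add)

lemma gpair_msum: "gpair (\<lambda>a b. msum (\<lambda>w. q w a b) Ls) ls = msum (\<lambda>w. gpair (q w) ls) Ls"
  by (induction Ls arbitrary: q) (simp_all add: gpair_sum_list)

text \<open>\<open>M\<close> is multilinear in formal vectors and symmetric on \<open>V\<close>.
  Addition and scaling are parameters because they are instantiated by concatenation and termwise
  scaling of lists, which do not satisfy the vector space laws.\<close>

context
  fixes M :: "'z list \<Rightarrow> complex" and V :: "'z set" and add :: "'z \<Rightarrow> 'z \<Rightarrow> 'z" and sc :: "real \<Rightarrow> 'z \<Rightarrow> 'z"
  assumes M_add: "\<And>xs x y ys. M (xs @ add x y # ys) = M (xs @ x # ys) + M (xs @ y # ys)"
    and M_sc: "\<And>xs t x ys. M (xs @ sc t x # ys) = complex_of_real t * M (xs @ x # ys)"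
    and M_swap: "\<And>xs x y ys. set (xs @ x # y # ys) \<subseteq> V \<Longrightarrow> M (xs @ x # y # ys) = M (xs @ y # x # ys)"
    and V_add: "\<And>x y. x \<in> V \<Longrightarrow> y \<in> V \<Longrightarrow> add x y \<in> V"
    and V_sc: "\<And>t x. x \<in> V \<Longrightarrow> sc t x \<in> V"
begin

lemma polar_move:
  assumes "set (xs @ ys @ z # zs) \<subseteq> V"
  shows "M (xs @ ys @ z # zs) = M (xs @ z # ys @ zs)"
  using assms
proof (induction ys arbitrary: xs)
  case (Cons y ys)
  have "M (xs @ (y # ys) @ z # zs) = M ((xs @ [y]) @ ys @ z # zs)" by simp
  also have "\<dots> = M ((xs @ [y]) @ z # ys @ zs)" by (rule Cons.IH) (use Cons.prems in auto)
  also have "\<dots> = M (xs @ z # y # ys @ zs)" using M_swap[of xs y z "ys @ zs"] Cons.prems by auto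
  finally show ?case by simp
qed simp

text \<open>Each induction step moves one copy of the vector into \<open>zs\<close>, where
  additivity splits it; \<open>polar_move\<close> brings z back to its block, and Pascal's rule
  collects the terms.\<close>

lemma polar_binomial:
  assumes "z \<in> V" "w \<in> V" "set zs \<subseteq> V"
  shows "M (replicate n (add z (sc t w)) @ zs) =
    (\<Sum>i\<le>n. of_nat (n choose i) * complex_of_real t ^ i * M (replicate (n - i) z @ replicate i w @ zs))"
  using assms
proof (induction n arbitrary: zs)
  case (Suc n)
  let ?v = "add z (sc t w)"
  define A where "A i = M (replicate (Suc n - i) z @ replicate i w @ zs)" for i
  have "M (replicate (Suc n) ?v @ zs) = M (replicate n ?v @ ?v # zs)"
    by (simp add: replicate_app_Cons_same)
  also have "\<dots> = (\<Sum>i\<le>n. of_nat (n choose i) * complex_of_real t ^ i *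
      M (replicate (n - i) z @ replicate i w @ ?v # zs))"
    by (rule Suc.IH) (use Suc.prems V_add V_sc in auto)
  also have "\<dots> = (\<Sum>i\<le>n. of_nat (n choose i) * complex_of_real t ^ i * (A i + complex_of_real t * A (Suc i)))"
  proof (rule sum.cong)
    fix i assume i: "i \<in> {..n}"
    have "M (replicate (n - i) z @ replicate i w @ ?v # zs) =
        M (replicate (n - i) z @ replicate i w @ z # zs) +
        complex_of_real t * M (replicate (n - i) z @ replicate i w @ w # zs)"
      using M_add[of "replicate (n - i) z @ replicate i w"] M_sc[of "replicate (n - i) z @ replicate i w"] by simp
    also have "M (replicate (n - i) z @ replicate i w @ z # zs) = M (replicate (n - i) z @ z # replicate i w @ zs)"
      by (rule polar_move) (use Suc.prems in auto)
    also have "\<dots> = A i" using i by (simp add: A_def Suc_diff_le replicate_app_Cons_same)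
    also have "M (replicate (n - i) z @ replicate i w @ w # zs) = A (Suc i)"
      by (simp add: A_def replicate_app_Cons_same)
    finally show "of_nat (n choose i) * complex_of_real t ^ i * M (replicate (n - i) z @ replicate i w @ ?v # zs) =
        of_nat (n choose i) * complex_of_real t ^ i * (A i + complex_of_real t * A (Suc i))" by simp
  qed simp
  also have "\<dots> = (\<Sum>i\<le>n. of_nat (n choose i) * (complex_of_real t ^ i * A i)) +
      (\<Sum>i\<le>n. of_nat (n choose i) * (complex_of_real t ^ Suc i * A (Suc i)))"
    by (simp add: algebra_simps sum.distrib)
  also have "(\<Sum>i\<le>n. of_nat (n choose i) * (complex_of_real t ^ i * A i)) =
      A 0 + (\<Sum>i\<le>n. of_nat (n choose Suc i) * (complex_of_real t ^ Suc i * A (Suc i)))"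
  proof -
    have "(\<Sum>i\<le>n. of_nat (n choose i) * (complex_of_real t ^ i * A i)) =
        (\<Sum>i\<le>Suc n. of_nat (n choose i) * (complex_of_real t ^ i * A i))"
      by (simp add: binomial_eq_0)
    then show ?thesis by (simp only: sum.atMost_Suc_shift) simp
  qed
  also have "\<dots> + (\<Sum>i\<le>n. of_nat (n choose i) * (complex_of_real t ^ Suc i * A (Suc i))) =
     (\<Sum>i\<le>Suc n. of_nat (Suc n choose i) * complex_of_real t ^ i * A i)"
    by (simp only: sum.atMost_Suc_shift) (simp add: sum.distrib algebra_simps)
  finally show ?case by (simp only: A_def)
qed simp

text \<open>Induction on the number of free arguments: in the identity for z + t w the coefficient
  of t is a positive multiple of the value with one more free argument w, and a polynomial that
  vanishes for all real t has zero coefficients.\<close>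

lemma polarization:
  assumes diag: "\<And>z. z \<in> V \<Longrightarrow> M (replicate k z) = 0" and V: "V \<noteq> {}" and zs: "set zs \<subseteq> V" "length zs = k"
  shows "M zs = 0"
proof -
  have "M (replicate (k - j) z @ zs) = 0" if "length zs = j" "j \<le> k" "set zs \<subseteq> V" "z \<in> V" for j z zs
    using that
  proof (induction j arbitrary: z zs)
    case 0
    then show ?case by (simp add: diag)
  next
    case (Suc j)
    obtain w ws where w: "zs = w # ws" using Suc.prems by (cases zs) auto
    define m where "m = k - Suc j"
    have m: "k - j = Suc m" using Suc.prems by (simp add: m_def)
    define c where "c i = of_nat (Suc m choose i) * M (replicate (Suc m - i) z @ replicate i w @ ws)" for i
    have t: "(\<Sum>i\<le>Suc m. c i * complex_of_real t ^ i) = 0" for t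
    proof -
      have "M (replicate (k - j) (add z (sc t w)) @ ws) = 0"
        by (rule Suc.IH) (use Suc.prems w V_add V_sc in auto)
      then show ?thesis
        using polar_binomial[of z w ws "Suc m" t] Suc.prems w unfolding m
        by (simp only: c_def mult_ac) (simp add: mult_ac)
    qed
    have "(\<lambda>i. complex_of_real t ^ i * (if i \<le> Suc m then c i else 0)) sums 0" for t
    proof -
      have "(\<lambda>i. complex_of_real t ^ i * (if i \<le> Suc m then c i else 0)) sums
          (\<Sum>i\<le>Suc m. complex_of_real t ^ i * (if i \<le> Suc m then c i else 0))"
        by (rule sums_finite) auto
      also have "(\<Sum>i\<le>Suc m. complex_of_real t ^ i * (if i \<le> Suc m then c i else 0)) =
          (\<Sum>i\<le>Suc m. c i * complex_of_real t ^ i)"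
        by (rule sum.cong) (auto simp: mult.commute)
      finally show ?thesis by (simp only: t)
    qed
    from complex_powser_zero[OF this, of 1] have "c 1 = 0" by simp
    then have "M (replicate m z @ w # ws) = 0" by (simp add: c_def del: of_nat_Suc)
    then show ?case by (simp add: w m_def)
  qed
  moreover obtain z where "z \<in> V" using V by blast
  ultimately have "M (replicate (k - k) z @ zs) = 0" using zs by blast
  then show ?thesis by simp
qed

end

section \<open>Injectivity of the function representation\<close>

lemma has_sum_gpair:
  assumes w: "\<And>a b. ((\<lambda>k. w k a b) has_sum W a b) A"
  shows "((\<lambda>k. gpair (w k) ls) has_sum gpair W ls) A"
proof -
  have fin: "((\<lambda>x. \<Sum>i\<in>I. f i x) has_sum (\<Sum>i\<in>I. S i)) A"
    if "\<And>i. i \<in> I \<Longrightarrow> ((\<lambda>x. f i x) has_sum S i) A"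
    for f :: "'i \<Rightarrow> 'b \<Rightarrow> complex" and S and I :: "'i set"
    using that by (induction I rule: infinite_finite_induct) (auto intro!: has_sum_add)
  show ?thesis unfolding gpair_def alt_def
    by (intro fin has_sum_cmult_right w)
qed

text \<open>The contribution of degree \<open>k\<close> to \<open>fock_pair J F G\<close>.\<close>

definition degpair :: "('h::complex_hilbert \<Rightarrow> 'h) \<Rightarrow> nat \<Rightarrow> ('h list \<Rightarrow> complex) \<Rightarrow> ('h list \<Rightarrow> complex) \<Rightarrow> complex" where
  "degpair J k F G = infsum (\<lambda>hs. F (map J (rev hs)) * G hs) (tuples onb k)"

lemma degpair_has_sum:
  assumes J: "antiunitary_involution J" and F: "l2form F" and G: "l2form G"
  shows "((\<lambda>k. degpair J k F G) has_sum fock_pair J F G) UNIV"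
proof -
  let ?f = "\<lambda>hs. F (map J (rev hs)) * G hs"
  have f: "(?f has_sum fock_pair J F G) (lists onb)" by (rule fock_pair_has_sum[OF J F G])
  have S: "((\<lambda>z. ?f (snd z)) has_sum fock_pair J F G) (Sigma UNIV (tuples onb))"
    using has_sum_reindex_bij_betw[OF bij_tuples_lists[of onb], of ?f] f by simp
  have inner: "(?f has_sum degpair J k F G) (tuples onb k)" for k
    unfolding degpair_def
    by (rule has_sum_infsum, rule summable_on_subset_banach[OF has_sum_imp_summable[OF f]])
      (auto simp: tuples_def)
  show ?thesis by (rule has_sum_SigmaD[OF S]) (simp only: snd_conv inner)
qed

text \<open>Pairs stand for formal elementary tensors. Distinct lists may denote the same form, so
  multilinear expansions are taken over the list.\<close>

definition finite_rank :: "(('l list \<Rightarrow> complex) \<times> 'h::complex_hilbert) list \<Rightarrow> ('l, 'h) sform" where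
  "finite_rank L = (\<lambda>ls hs. \<Sum>u\<leftarrow>L. fst u ls * simple_tensor [snd u] hs)"

text \<open>An exterior product of sums expands over all words in the terms: the vectors are
  collected in the tensor, the Grassmann elements in the product.\<close>

lemma gprod_finite_rank:
  "gprod (map (slot (finite_rank L)) hs) ls =
     msum (\<lambda>w. simple_tensor (map snd w) hs * gprod (map fst w) ls) (replicate (length hs) L)"
proof (induction hs arbitrary: ls)
  case Nil
  show ?case by (simp add: vac_def)
next
  case (Cons h hs)
  let ?R = "replicate (length hs) L"
  let ?q = "\<lambda>w b. simple_tensor (map snd w) hs * gprod (map fst w) b"
  have slot: "slot (finite_rank L) h a = (\<Sum>u\<leftarrow>L. cinner h (snd u) * fst u a)" for a
    by (simp add: slot_def finite_rank_def simple_tensor_Cons vac_def mult.commute)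
  have "gprod (map (slot (finite_rank L)) (h # hs)) ls =
      gpair (\<lambda>a b. slot (finite_rank L) h a * gprod (map (slot (finite_rank L)) hs) b) ls"
    by (simp add: grass_mult_gpair)
  also have "\<dots> = gpair (\<lambda>a b. \<Sum>u\<leftarrow>L. msum (\<lambda>w. (cinner h (snd u) * fst u a) * ?q w b) ?R) ls"
    unfolding Cons slot msum_const_mult sum_list_mult_const ..
  also have "\<dots> = (\<Sum>u\<leftarrow>L. msum (\<lambda>w. gpair (\<lambda>a b. (cinner h (snd u) * fst u a) * ?q w b) ls) ?R)"
    unfolding gpair_sum_list gpair_msum ..
  also have "\<dots> = (\<Sum>u\<leftarrow>L. msum (\<lambda>w. simple_tensor (map snd (u # w)) (h # hs) * gprod (map fst (u # w)) ls) ?R)"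
  proof -
    have "gpair (\<lambda>a b. (cinner h (snd u) * fst u a) * ?q w b) ls =
        simple_tensor (map snd (u # w)) (h # hs) * gprod (map fst (u # w)) ls" for u w
    proof -
      have "gpair (\<lambda>a b. (cinner h (snd u) * fst u a) * ?q w b) ls =
          gpair (\<lambda>a b. (cinner h (snd u) * simple_tensor (map snd w) hs) * (fst u a * gprod (map fst w) b)) ls"
        by (simp add: mult_ac)
      then show ?thesis unfolding gpair_cmult by (simp add: simple_tensor_Cons grass_mult_gpair)
    qed
    then show ?thesis by simp
  qed
  finally show ?case by simp
qed

section \<open>Elementary tensors of degree one\<close>

lemma simple_tensor_single: "simple_tensor [e] hs = (if length hs = 1 then cinner (hd hs) e else 0)"
  by (cases hs) (auto simp: simple_tensor_def)

lemma bform_simple_tensor_single: "bform (simple_tensor [e])"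
proof -
  have "multi_antilinear (simple_tensor [e])"
    unfolding multi_antilinear_def
  proof (intro conjI allI)
    fix xs ys x y c
    show "simple_tensor [e] (xs @ (x + y) # ys) = simple_tensor [e] (xs @ x # ys) + simple_tensor [e] (xs @ y # ys)"
      by (cases xs; cases ys) (simp_all add: simple_tensor_single cinner_add_left)
    show "simple_tensor [e] (xs @ (c *\<^sub>C x) # ys) = cnj c * simple_tensor [e] (xs @ x # ys)"
      by (cases xs; cases ys) (simp_all add: simple_tensor_single cinner_scaleC_left)
  qed
  moreover have "cmod (simple_tensor [e] xs) \<le> norm e * pnorm xs" for xs
  proof (cases "length xs = 1")
    case True
    then obtain x where "xs = [x]" by (auto simp: length_Suc_conv)
    then show ?thesis using cinner_bound[of x e] by (simp add: simple_tensor_single mult.commute)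
  next
    case False
    then show ?thesis by (simp add: simple_tensor_single prod_norm_nonneg)
  qed
  then have "bounded_form (simple_tensor [e])" unfolding bounded_form_def by blast
  ultimately show ?thesis by (simp add: bform_def)
qed

lemma skew_simple_tensor_single: "skew (simple_tensor [e])"
  by (simp add: skew_def simple_tensor_single)

lemma esum_simple_tensor_single:
  "infsum (\<lambda>hs. sqn (simple_tensor [e] hs)) (lists onb) < top"
proof -
  have "infsum (\<lambda>hs. sqn (simple_tensor [e] hs)) (lists onb) = infsum (\<lambda>hs. sqn (simple_tensor [e] hs)) (tuples onb (length [e]))"
    by (rule infsum_cong_neutral) (auto simp: tuples_def simple_tensor_single sqn_def)
  then show ?thesis using esum_simple_tensor[OF is_onb_onb, of "[e]"] by simp
qed

lemma l2form_simple_tensor_single: "l2form (simple_tensor [e])"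
  by (simp add: l2form_def bform_simple_tensor_single summable_sqn_iff esum_simple_tensor_single)

lemma simple_tensor_grass_part: "simple_tensor [e] \<in> grass_part 1"
proof -
  have "gsum (simple_tensor [e]) = infsum (\<lambda>hs. sqn (simple_tensor [e] hs)) (lists onb)"
    unfolding gsum_def by (rule infsum_cong) (simp add: simple_tensor_single wt_def sqn_def)
  then show ?thesis
    using esum_simple_tensor_single[of e]
    by (auto simp: grass_part_def grass_iff bform_simple_tensor_single skew_simple_tensor_single simple_tensor_single)
qed

lemma vac_grass_part: "vac \<in> grass_part 0"
  by (auto simp: grass_part_def vac_grass vac_def split: if_splits)

lemma grass_part_cmult:
  assumes "l \<in> grass_part k"
  shows "(\<lambda>ls. c * l ls) \<in> grass_part k"
proof -
  have "gsum (\<lambda>ls. c * l ls) = sqn c * gsum l"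
    by (simp add: gsum_def sqn_mult mult.left_commute[of _ "sqn c"] esum_cmult)
  then have "gsum (\<lambda>ls. c * l ls) < top"
    using assms by (simp add: grass_part_def grass_iff ennreal_mult_less_top sqn_def)
  then show ?thesis using assms
    by (auto simp: grass_part_def grass_iff bform_cmult skew_cmult)
qed

section \<open>Cancellation of generators\<close>

lemma wedge_orthogonal:
  assumes "\<And>a. set a \<subseteq> set ls \<Longrightarrow> f a = 0"
  shows "wedge f g ls = 0"
proof -
  have "wedge f g ls = shuf (\<lambda>a b. 0) ls"
    unfolding wedge_def by (rule shuf_cong) (simp add: assms)
  then show ?thesis by simp
qed

text \<open>
  A form is recovered from its products with the generators: given basis arguments \<open>ls\<close>,
  multiply by a basis vector \<open>e\<close> not in \<open>ls\<close> and evaluate at \<open>e # ls\<close>.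
\<close>

lemma generator_cancel:
  fixes \<mu> :: "'l::complex_hilbert list \<Rightarrow> complex"
  assumes inf: "infinite (onb :: 'l set)" and sk: "skew \<mu>" and ls: "ls \<in> lists onb"
    and zero: "\<And>e ls. e \<in> onb \<Longrightarrow> ls \<in> lists onb \<Longrightarrow> grass_mult (simple_tensor [e]) \<mu> ls = 0"
  shows "\<mu> ls = 0"
proof -
  obtain e where e: "e \<in> onb" "e \<notin> set ls" using inf by (metis List.finite_set finite_subset subsetI)
  have o: "cinner b c = (if b = c then 1 else 0)" if "b \<in> onb" "c \<in> onb" for b c :: 'l
    using is_onb_onb[where 'a='l] that unfolding is_onb_def by blast
  let ?f = "hat (simple_tensor [e])"
  have "hat (grass_mult (simple_tensor [e]) \<mu>) (e # ls) = 0"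
    unfolding hat_def using zero[OF e(1), of "e # ls"] e ls by simp
  then have "wedge ?f (hat \<mu>) (e # ls) = 0"
    by (simp add: hat_grass_mult skew_simple_tensor_single sk)
  \<comment> \<open>The generator is orthogonal to all entries of \<open>ls\<close>, so this branch
    of the contraction vanishes and the other one returns the form.\<close>
  moreover have "wedge (\<lambda>a. (- 1) ^ length a * ?f a) (\<lambda>b. hat \<mu> (e # b)) ls = 0"
  proof (rule wedge_orthogonal)
    fix a assume a: "set a \<subseteq> set ls"
    have "cinner (hd a) e = 0" if "length a = 1"
    proof -
      have "hd a \<in> set ls" using a that by (cases a) auto
      then show ?thesis using o[of "hd a" e] e ls by auto
    qed
    then show "(- 1) ^ length a * ?f a = 0" by (simp add: hat_def simple_tensor_single)
  qed
  moreover have "(\<lambda>a. ?f (e # a)) = vac"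
    using o[OF e(1) e(1)] by (auto simp: hat_def simple_tensor_single vac_def rfac_def)
  ultimately have "hat \<mu> ls = 0" by (simp add: wedge_Cons wedge_vac_left)
  then show ?thesis by (simp add: hat_def)
qed

text \<open>Enough elements of each parity for cancellation: the unit for even arguments and, for
  odd ones, the basis generators that \<open>generator_cancel\<close> divides out.\<close>

definition generators :: "bit \<Rightarrow> ('l::complex_hilbert list \<Rightarrow> complex) set" where
  "generators k = (if k = 0 then {vac} else {simple_tensor [e] | e. e \<in> onb})"

lemma generators_grass_part: "l \<in> generators k \<Longrightarrow> l \<in> grass_part k"
  using bit_cases[of k] by (auto simp: generators_def vac_grass_part simple_tensor_grass_part split: if_splits)

text \<open>The outermost factor is removed at each step: for a fixed product of the others, all
  choices of that factor give zero on basis words.\<close>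

lemma generators_cancel:
  fixes \<mu> :: "'l::complex_hilbert list \<Rightarrow> complex"
  assumes inf: "infinite (onb :: 'l set)" and sk: "skew \<mu>" and ls: "ls \<in> lists onb"
    and zero: "\<And>ms ls. list_all2 (\<lambda>m k. m \<in> generators k) ms ks \<Longrightarrow> ls \<in> lists onb \<Longrightarrow>
      grass_mult (gprod ms) \<mu> ls = 0"
  shows "\<mu> ls = 0"
  using ls zero
proof (induction ks arbitrary: ls)
  case Nil
  then show ?case using Nil(2)[of "[]" ls] by (simp add: grass_mult_vac_left sk)
next
  case (Cons k ks)
  show ?case
  proof (rule Cons.IH[OF Cons.prems(1)])
    fix ms :: "('l list \<Rightarrow> complex) list" and ls
    assume ms: "list_all2 (\<lambda>m k. m \<in> generators k) ms ks" and ls: "ls \<in> lists (onb :: 'l set)"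
    let ?\<nu> = "grass_mult (gprod ms) \<mu>"
    have z: "grass_mult m ?\<nu> ls = 0" if "m \<in> generators k" "ls \<in> lists onb" for m ls
    proof -
      have "skew m" using generators_grass_part[OF that(1)] by (simp add: grass_part_def grass_iff)
      then have "grass_mult m ?\<nu> = grass_mult (gprod (m # ms)) \<mu>"
        by (simp add: grass_mult_assoc skew_gprod sk)
      then show ?thesis using Cons.prems(2)[of "m # ms" ls] ms that by simp
    qed
    show "?\<nu> ls = 0"
    proof (cases "k = 0")
      case True
      then show ?thesis using z[of vac ls] ls
        by (simp add: generators_def grass_mult_vac_left skew_grass_mult)
    next
      case False
      show ?thesis
        by (rule generator_cancel[OF inf skew_grass_mult ls], rule z)
          (use False in \<open>auto simp: generators_def\<close>)
    qed
  qed
qed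

section \<open>Real elements of finite rank\<close>

context
  fixes H E :: "bit \<Rightarrow> 'h::complex_hilbert set" and J :: "'h \<Rightarrow> 'h"
    and s :: "('l::complex_hilbert list \<Rightarrow> complex) \<Rightarrow> ('l list \<Rightarrow> complex)"
  assumes sh: "super_hilbert H E J" and s: "grass_involution s"
begin

lemma tens_h_lam_part:
  fixes l :: "'l list \<Rightarrow> complex"
  assumes l: "l \<in> grass_part k" and f: "f \<in> H k"
  shows "(\<lambda>ls hs. l ls * simple_tensor [f] hs) \<in> h_lam_part H k"
proof -
  have lg: "bform l" "skew l" "gsum l < top" using l by (auto simp: grass_part_def grass_iff)
  have gs: "graded_sym H (simple_tensor [f])"
    unfolding graded_sym_def[OF sh] by (simp add: simple_tensor_single)
  have st: "simple_tensor [f] \<in> fock H"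
    by (simp add: fock_iff[OF sh] l2form_simple_tensor_single gs)
  have "(\<lambda>ls hs. l ls * simple_tensor [f] hs) \<in> slam H"
  proof (rule slamI[OF sh])
    show "multi_antilinear (\<lambda>ls. l ls * simple_tensor [f] hs)" for hs
      using multi_antilinear_cmult[of l "simple_tensor [f] hs"] lg by (simp add: bform_def mult.commute)
    show "skew (\<lambda>ls. l ls * simple_tensor [f] hs)" for hs
      by (rule skew_mult_right[OF lg(2)])
    show "(\<lambda>hs. l ls * simple_tensor [f] hs) \<in> fock H" for ls
      by (rule fock_cmult[OF sh st])
    fix n
    obtain C where C: "\<And>ls. length ls = n \<Longrightarrow> cmod (l ls) \<le> C * pnorm ls"
      using lg(1) unfolding bform_def bounded_form_def by blast
    have "l2norm (\<lambda>hs. l ls * simple_tensor [f] hs) \<le> (C * l2norm (simple_tensor [f])) * pnorm ls"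
      if "length ls = n" for ls
      using mult_right_mono[OF C[OF that], of "l2norm (simple_tensor [f])"]
      by (simp add: l2norm_cmult mult_ac)
    then show "\<exists>C. \<forall>ls. length ls = n \<longrightarrow> l2norm (\<lambda>hs. l ls * simple_tensor [f] hs) \<le> C * pnorm ls" by blast
  next
    have "ssum (\<lambda>ls hs. l ls * simple_tensor [f] hs) = gsum l * infsum (\<lambda>hs. sqn (simple_tensor [f] hs)) (lists onb)"
      by (simp add: ssum_def gsum_def sqn_mult esum_cmult flip: mult.assoc esum_cmult_right)
    then show "ssum (\<lambda>ls hs. l ls * simple_tensor [f] hs) < top"
      using lg(3) esum_simple_tensor_single[of f] by (simp add: ennreal_mult_less_top)
  qed
  moreover have "cinner h f = 0" if "h \<in> H (k + 1)" for h
    using orth_parity[OF sh that f] by simp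
  ultimately show ?thesis
    using l by (auto simp: h_lam_part_def grass_part_def simple_tensor_single)
qed

lemma h_lam_part_cmult: "X \<in> h_lam_part H k \<Longrightarrow> (\<lambda>(ls :: 'l list) hs. c * X ls hs) \<in> h_lam_part H k"
  by (auto simp: h_lam_part_def slam_cmult[OF sh])

lemma h_lam_part_add:
  assumes "X \<in> h_lam_part H k" "Y \<in> h_lam_part H k"
  shows "(\<lambda>(ls :: 'l list) hs. X ls hs + Y ls hs) \<in> h_lam_part H k"
  unfolding h_lam_part_def mem_Collect_eq
proof (intro conjI allI impI ballI)
  show "(\<lambda>ls hs. X ls hs + Y ls hs) \<in> slam H"
    using assms by (intro slam_add[OF sh]) (auto simp: h_lam_part_def)
  show "X ls [h] + Y ls [h] = 0" if "h \<in> H (k + 1)" for ls h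
    using assms that by (simp add: h_lam_part_def)
  fix ls hs assume "X ls hs + Y ls hs \<noteq> 0"
  then have "X ls hs \<noteq> 0 \<or> Y ls hs \<noteq> 0" by auto
  then have "of_nat (length ls) = k \<and> length hs = 1" using assms unfolding h_lam_part_def by blast
  then show "of_nat (length ls) = k" "length hs = 1" by auto
qed

lemma h_lamI:
  fixes X Y :: "('l, 'h) sform"
  shows "X \<in> h_lam_part H 0 \<Longrightarrow> Y \<in> h_lam_part H 1 \<Longrightarrow> (\<lambda>ls hs. X ls hs + Y ls hs) \<in> h_lam H"
  unfolding h_lam_def by blast

lemma h_lam_partI:
  fixes X :: "('l, 'h) sform"
  assumes X: "X \<in> h_lam_part H k"
  shows "X \<in> h_lam H"
proof -
  have "(\<lambda>ls hs. 0 * X ls hs) \<in> slam H" using X by (intro slam_cmult[OF sh]) (simp add: h_lam_part_def)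
  then have z: "(\<lambda>ls hs. 0) \<in> (h_lam_part H k' :: ('l, 'h) sform set)" for k' by (simp add: h_lam_part_def)
  show ?thesis
  proof (cases "k = 0")
    case True
    then show ?thesis using h_lamI[OF _ z, of X] X by simp
  next
    case False
    then show ?thesis using h_lamI[OF z, of X] X by simp
  qed
qed

lemma h_lam_cmult:
  fixes z :: "('l, 'h) sform"
  assumes "z \<in> h_lam H"
  shows "(\<lambda>ls hs. c * z ls hs) \<in> h_lam H"
proof -
  obtain X Y where z: "z = (\<lambda>ls hs. X ls hs + Y ls hs)" "X \<in> h_lam_part H 0" "Y \<in> h_lam_part H 1"
    using assms unfolding h_lam_def by blast
  have "(\<lambda>ls hs. c * z ls hs) = (\<lambda>ls hs. c * X ls hs + c * Y ls hs)" by (simp add: z(1) distrib_left)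
  then show ?thesis using h_lamI[OF h_lam_part_cmult[OF z(2), of c] h_lam_part_cmult[OF z(3), of c]] by simp
qed

lemma h_lam_add:
  fixes z :: "('l, 'h) sform"
  assumes "z \<in> h_lam H" "z' \<in> h_lam H"
  shows "(\<lambda>ls hs. z ls hs + z' ls hs) \<in> h_lam H"
proof -
  obtain X Y where z: "z = (\<lambda>ls hs. X ls hs + Y ls hs)" "X \<in> h_lam_part H 0" "Y \<in> h_lam_part H 1"
    using assms unfolding h_lam_def by blast
  obtain X' Y' where z': "z' = (\<lambda>ls hs. X' ls hs + Y' ls hs)" "X' \<in> h_lam_part H 0" "Y' \<in> h_lam_part H 1"
    using assms unfolding h_lam_def by blast
  have "(\<lambda>ls hs. z ls hs + z' ls hs) = (\<lambda>ls hs. (X ls hs + X' ls hs) + (Y ls hs + Y' ls hs))"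
    by (simp add: z(1) z'(1) algebra_simps)
  then show ?thesis using h_lamI[OF h_lam_part_add[OF z(2) z'(2)] h_lam_part_add[OF z(3) z'(3)]] by simp
qed

lemma s_add: "l \<in> grass \<Longrightarrow> m \<in> grass \<Longrightarrow> s (\<lambda>ls. l ls + m ls) = (\<lambda>ls. s l ls + s m ls)"
  and s_cmult: "l \<in> grass \<Longrightarrow> s (\<lambda>ls. c * l ls) = (\<lambda>ls. cnj c * s l ls)"
  and s_s: "l \<in> grass \<Longrightarrow> s (s l) = l"
  and s_part: "l \<in> grass_part k \<Longrightarrow> s l \<in> grass_part k"
  using s unfolding grass_involution_def by blast+

lemma slam_star_add:
  fixes X Y :: "('l, 'h) sform"
  assumes "X \<in> slam H" "Y \<in> slam H"
  shows "slam_star J s (\<lambda>ls hs. X ls hs + Y ls hs) = (\<lambda>ls hs. slam_star J s X ls hs + slam_star J s Y ls hs)"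
  unfolding slam_star_def
  by (simp add: s_add slam_slice_grass[OF sh assms(1)] slam_slice_grass[OF sh assms(2)])

lemma slam_star_cmult:
  fixes X :: "('l, 'h) sform"
  assumes "X \<in> slam H"
  shows "slam_star J s (\<lambda>ls hs. c * X ls hs) = (\<lambda>ls hs. cnj c * slam_star J s X ls hs)"
  unfolding slam_star_def by (simp add: s_cmult slam_slice_grass[OF sh assms])

lemma h_lam_diag_add:
  assumes "z \<in> h_lam_diag H J s" "z' \<in> h_lam_diag H J s"
  shows "(\<lambda>ls hs. z ls hs + z' ls hs) \<in> h_lam_diag H J s"
proof -
  have z: "z \<in> h_lam H" "slam_star J s z = z" and z': "z' \<in> h_lam H" "slam_star J s z' = z'"
    using assms by (auto simp: h_lam_diag_def)
  show ?thesis unfolding h_lam_diag_def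
    using h_lam_add[OF z(1) z'(1)] slam_star_add[OF h_lam_slam[OF sh z(1)] h_lam_slam[OF sh z'(1)]]
    by (simp add: z(2) z'(2))
qed

lemma h_lam_diag_scale:
  assumes "z \<in> h_lam_diag H J s"
  shows "(\<lambda>ls hs. complex_of_real r * z ls hs) \<in> h_lam_diag H J s"
proof -
  have z: "z \<in> h_lam H" "slam_star J s z = z" using assms by (auto simp: h_lam_diag_def)
  show ?thesis unfolding h_lam_diag_def
    using h_lam_cmult[OF z(1)] slam_star_cmult[OF h_lam_slam[OF sh z(1)]] by (simp add: z(2))
qed

text \<open>Elementary tensors of even total parity, which lie in \<open>h_lam H\<close>.\<close>

definition even_pair :: "('l list \<Rightarrow> complex) \<times> 'h \<Rightarrow> bool" where
  "even_pair u \<longleftrightarrow> (\<exists>k. fst u \<in> grass_part k \<and> snd u \<in> H k)"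

definition scl :: "complex \<Rightarrow> ('l list \<Rightarrow> complex) \<times> 'h \<Rightarrow> ('l list \<Rightarrow> complex) \<times> 'h" where
  "scl c u = (\<lambda>ls. c * fst u ls, snd u)"

definition pstar :: "('l list \<Rightarrow> complex) \<times> 'h \<Rightarrow> ('l list \<Rightarrow> complex) \<times> 'h" where
  "pstar u = (s (fst u), J (snd u))"

lemma even_pair_scl: "even_pair u \<Longrightarrow> even_pair (scl c u)"
  unfolding even_pair_def scl_def fst_conv snd_conv by (blast intro: grass_part_cmult)

lemma even_pair_pstar: "even_pair u \<Longrightarrow> even_pair (pstar u)"
  unfolding even_pair_def pstar_def fst_conv snd_conv by (blast intro: s_part J_parity[OF sh])

lemma pstar_scl: "even_pair u \<Longrightarrow> pstar (scl c u) = scl (cnj c) (pstar u)"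
  by (auto simp: even_pair_def pstar_def scl_def s_cmult grass_part_def)

text \<open>Reality is demanded of the sum only; single terms may be moved by the
  involution.\<close>

definition real_lists :: "(('l list \<Rightarrow> complex) \<times> 'h) list set" where
  "real_lists = {L. (\<forall>u\<in>set L. even_pair u) \<and> finite_rank L \<in> h_lam_diag H J s}"

lemma real_lists_append:
  assumes "L \<in> real_lists" "L' \<in> real_lists"
  shows "L @ L' \<in> real_lists"
proof -
  have "finite_rank (L @ L') = (\<lambda>ls hs. finite_rank L ls hs + finite_rank L' ls hs)" by (simp add: finite_rank_def)
  then show ?thesis using assms by (auto simp: real_lists_def h_lam_diag_add)
qed

lemma real_lists_scl:
  assumes "L \<in> real_lists"
  shows "map (scl (complex_of_real t)) L \<in> real_lists"
proof -
  have "finite_rank (map (scl (complex_of_real t)) L) = (\<lambda>ls hs. complex_of_real t * finite_rank L ls hs)"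
    by (simp add: finite_rank_def scl_def o_def sum_list_const_mult[symmetric] mult.assoc)
  then show ?thesis using assms by (auto simp: real_lists_def h_lam_diag_scale even_pair_scl)
qed

lemma real_lists_pair:
  assumes u: "even_pair u"
  shows "[u, pstar u] \<in> real_lists"
proof -
  obtain k where k: "fst u \<in> grass_part k" "snd u \<in> H k" using u by (auto simp: even_pair_def)
  have lg: "fst u \<in> grass" "s (fst u) \<in> grass" using k(1) s_part[OF k(1)] by (auto simp: grass_part_def)
  let ?X = "\<lambda>ls hs. fst u ls * simple_tensor [snd u] hs"
  let ?Y = "\<lambda>ls hs. s (fst u) ls * simple_tensor [J (snd u)] hs"
  have X: "?X \<in> h_lam_part H k" by (rule tens_h_lam_part[OF k])
  have Y: "?Y \<in> h_lam_part H k" by (rule tens_h_lam_part[OF s_part[OF k(1)] J_parity[OF sh k(2)]])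
  have slam: "?X \<in> slam H" "?Y \<in> slam H" using X Y by (auto simp: h_lam_part_def)
  have st: "fock_star J (simple_tensor [f]) = simple_tensor [J f]" for f
    using fock_star_simple_tensor[OF J_antiunitary[OF sh], of "[f]"] by simp
  have "slam_star J s ?X = ?Y" "slam_star J s ?Y = ?X"
    using slam_star_tens[OF s lg(1), of J "simple_tensor [snd u]"]
      slam_star_tens[OF s lg(2), of J "simple_tensor [J (snd u)]"]
    by (simp_all add: tens_def st s_s[OF lg(1)] J_J[OF J_antiunitary[OF sh]])
  then have "slam_star J s (\<lambda>ls hs. ?X ls hs + ?Y ls hs) = (\<lambda>ls hs. ?X ls hs + ?Y ls hs)"
    unfolding slam_star_add[OF slam] by (simp add: add.commute)
  moreover have "(\<lambda>ls hs. ?X ls hs + ?Y ls hs) \<in> h_lam H"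
    by (rule h_lam_partI[OF h_lam_part_add[OF X Y]])
  moreover have "finite_rank [u, pstar u] = (\<lambda>ls hs. ?X ls hs + ?Y ls hs)" by (simp add: finite_rank_def pstar_def)
  ultimately show ?thesis using u even_pair_pstar[OF u] by (simp add: real_lists_def h_lam_diag_def)
qed

section \<open>Forms annihilated by all real exponentials\<close>

context
  fixes D :: "('l, 'h) sform"
  assumes D: "D \<in> slam H"
    and zero: "\<And>z ls. z \<in> h_lam_diag H J s \<Longrightarrow> slam_pair J (slam_exp H z) D ls = 0"
begin

lemma degree_zero:
  assumes z: "z \<in> h_lam_diag H J s"
  shows "gpair (\<lambda>a b. degpair J k (slam_exp H z a) (D b)) ls = 0"
proof -
  have zl: "z \<in> h_lam H" using z by (simp add: h_lam_diag_def)
  \<comment> \<open>The factor r is real, so the scaled element stays in \<open>h_lam_diag\<close>;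
    the degree k part of its exponential is multiplied by r^k, and the pairing becomes a power
    series in r.\<close>
  let ?z = "\<lambda>r ls hs. complex_of_real r * z ls hs"
  have rz: "?z r \<in> h_lam_diag H J s" for r by (rule h_lam_diag_scale[OF z])
  then have rzl: "?z r \<in> h_lam H" for r by (simp add: h_lam_diag_def)
  have slot: "slot (?z r) h = (\<lambda>ls. complex_of_real r * slot z h ls)" for r h by (simp add: slot_def)
  have gp: "gprod (map (slot (?z r)) hs) = (\<lambda>ls. complex_of_real r ^ length hs * gprod (map (slot z) hs) ls)" for r hs
    by (induction hs) (simp_all add: slot grass_mult_cmult_left grass_mult_cmult_right mult.assoc)
  have deg: "degpair J k (slam_exp H (?z r) a) (D b) = complex_of_real r ^ k * degpair J k (slam_exp H z a) (D b)" for r k a b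
    unfolding degpair_def infsum_cmult_right'[symmetric]
    by (rule infsum_cong) (simp add: slam_exp_h_lam[OF sh rzl] slam_exp_h_lam[OF sh zl] gp tuples_def del: map_map)
  have "((\<lambda>k. complex_of_real r ^ k * gpair (\<lambda>a b. degpair J k (slam_exp H z a) (D b)) ls) has_sum 0) UNIV" for r
  proof -
    have "((\<lambda>k. gpair (\<lambda>a b. degpair J k (slam_exp H (?z r) a) (D b)) ls) has_sum
        gpair (\<lambda>a b. fock_pair J (slam_exp H (?z r) a) (D b)) ls) UNIV"
      by (intro has_sum_gpair degpair_has_sum[OF J_antiunitary[OF sh]] fock_l2form[OF sh] slam_fock[OF sh]
          slam_exp_slam[OF sh rzl] D)
    then show ?thesis
      using zero[OF rz[of r], of ls] unfolding slam_pair_gpair deg gpair_cmult by simp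
  qed
  then show ?thesis
    by (intro complex_powser_zero[of "\<lambda>k. gpair (\<lambda>a b. degpair J k (slam_exp H z a) (D b)) ls"]) (rule has_sum_imp_sums)
qed

text \<open>The reversal and \<open>J\<close> come from the bilinear pairing, whose left argument
  enters through \<open>fock_star\<close>.\<close>

definition word_val :: "'l list \<Rightarrow> (('l list \<Rightarrow> complex) \<times> 'h) list \<Rightarrow> complex" where
  "word_val ls w = grass_mult (gprod (map fst w)) (\<lambda>b. D b (map J (rev (map snd w)))) ls"

text \<open>For z = \<open>finite_rank L\<close> the degree k part of the pairing of exp z with
  \<open>D\<close> is the sum of \<open>word_val\<close> over all words, divided by sqrt (k!).
  \<open>bform_expansion\<close> collapses the sum over basis words to a value of
  \<open>D\<close>.\<close>

lemma word_val_diag: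
  assumes L: "L \<in> real_lists"
  shows "msum (word_val ls) (replicate k L) = 0"
proof -
  have zd: "finite_rank L \<in> h_lam_diag H J s" using L by (simp add: real_lists_def)
  then have zl: "finite_rank L \<in> h_lam H" by (simp add: h_lam_diag_def)
  let ?c = "1 / complex_of_real (sqrt (fact k))"
  have deg: "degpair J k (slam_exp H (finite_rank L) a) (D b) =
      ?c * msum (\<lambda>w. gprod (map fst w) a * D b (map J (rev (map snd w)))) (replicate k L)" for a b
    unfolding degpair_def
  proof (rule infsumI)
    have Db: "l2form (D b)" by (rule fock_l2form[OF sh slam_fock[OF sh D]])
    have "((\<lambda>hs. gprod (map fst w :: ('l list \<Rightarrow> complex) list) a * (cnj (simple_tensor (map J (rev (map snd w))) hs) * D b hs)) has_sum
        gprod (map fst w) a * D b (map J (rev (map snd w)))) (tuples onb k)"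
      if w: "length w = length (replicate k L)" for w :: "(('l list \<Rightarrow> complex) \<times> 'h) list"
    proof (rule has_sum_cmult_right)
      have "infsum (\<lambda>hs. sqn (D b hs)) (tuples onb (length (map J (rev (map snd w))))) < top"
        using esum_tuples_le_lists[of "\<lambda>hs. sqn (D b hs)" onb] Db
        by (auto simp: l2form_def summable_sqn_iff intro: le_less_trans)
      from bform_expansion[OF is_onb_onb _ this] Db w
      show "((\<lambda>hs. cnj (simple_tensor (map J (rev (map snd w))) hs) * D b hs) has_sum D b (map J (rev (map snd w)))) (tuples onb k)"
        by (simp add: l2form_def)
    qed
    then have "((\<lambda>hs. msum (\<lambda>w. gprod (map fst w) a * (cnj (simple_tensor (map J (rev (map snd w))) hs) * D b hs)) (replicate k L))
        has_sum msum (\<lambda>w. gprod (map fst w) a * D b (map J (rev (map snd w)))) (replicate k L)) (tuples onb k)"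
      by (rule has_sum_msum)
    then have hsum: "((\<lambda>hs. ?c * msum (\<lambda>w. gprod (map fst w) a * (cnj (simple_tensor (map J (rev (map snd w))) hs) * D b hs)) (replicate k L))
        has_sum ?c * msum (\<lambda>w. gprod (map fst w) a * D b (map J (rev (map snd w)))) (replicate k L)) (tuples onb k)"
      by (rule has_sum_cmult_right)
    have eq: "?c * msum (\<lambda>w. gprod (map fst w) a * (cnj (simple_tensor (map J (rev (map snd w))) hs) * D b hs)) (replicate k L) =
        slam_exp H (finite_rank L) a (map J (rev hs)) * D b hs" if hs: "hs \<in> tuples onb k" for hs
    proof -
      have st: "simple_tensor fs (map J (rev hs)) = cnj (simple_tensor (map J (rev fs)) hs)" for fs
        unfolding fock_star_simple_tensor[OF J_antiunitary[OF sh], symmetric] by (simp add: fock_star_def)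
      have "slam_exp H (finite_rank L) a (map J (rev hs)) * D b hs =
          (?c * D b hs) * msum (\<lambda>w. simple_tensor (map snd w) (map J (rev hs)) * gprod (map fst w) a) (replicate k L)"
        using hs by (simp add: slam_exp_h_lam[OF sh zl] gprod_finite_rank rfac_def tuples_def del: map_map)
      then show ?thesis
        unfolding msum_const_mult[symmetric] st by (simp add: mult_ac)
    qed
    from has_sum_cong[OF eq, THEN iffD1, OF _ hsum]
    show "((\<lambda>hs. slam_exp H (finite_rank L) a (map J (rev hs)) * D b hs) has_sum
        ?c * msum (\<lambda>w. gprod (map fst w) a * D b (map J (rev (map snd w)))) (replicate k L)) (tuples onb k)"
      .
  qed
  have "?c * msum (word_val ls) (replicate k L) = 0"
    using degree_zero[OF zd, of k ls] unfolding deg gpair_cmult gpair_msum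
    by (simp add: word_val_def[abs_def] grass_mult_gpair)
  then show ?thesis by simp
qed

lemma word_val_scl: "word_val ls (xs @ scl c u # ys) = c * word_val ls (xs @ u # ys)"
proof -
  have "gprod (map fst (xs @ scl c u # ys)) = (\<lambda>a. c * gprod (map fst (xs @ u # ys)) a)"
    by (simp add: scl_def gprod_cmult fun_eq_iff)
  then show ?thesis by (simp add: word_val_def scl_def grass_mult_cmult_left)
qed

text \<open>The sign from the Grassmann product and the sign from the graded symmetry of
  \<open>D\<close> are equal and cancel. Thus \<open>word_val\<close> is symmetric on even pairs, as
  polarisation requires.\<close>

lemma word_val_swap:
  assumes "set (xs @ u # v # ys) \<subseteq> Collect even_pair"
  shows "word_val ls (xs @ u # v # ys) = word_val ls (xs @ v # u # ys)"
proof -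
  obtain k where u: "fst u \<in> grass_part k" "snd u \<in> H k" using assms by (auto simp: even_pair_def)
  obtain k' where v: "fst v \<in> grass_part k'" "snd v \<in> H k'" using assms by (auto simp: even_pair_def)
  have par: "skew (fst u)" "skew (fst v)" "has_parity k (fst u)" "has_parity k' (fst v)"
    using u v by (auto simp: grass_part_def grass_iff has_parity_def)
  have g: "gprod (map fst (xs @ u # v # ys)) = (\<lambda>a. comm_sign k k' * gprod (map fst (xs @ v # u # ys)) a)"
    using gprod_swap[OF par, of "map fst xs" "map fst ys"] by (simp add: fun_eq_iff)
  have H01: "h \<in> H 0 \<union> H 1" if "h \<in> H q" for h q using bit_cases[of q] that by auto
  have set: "set (map J (rev (map snd zs))) \<subseteq> H 0 \<union> H 1" if "set zs \<subseteq> Collect even_pair" for zs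
    using that J_parity[OF sh] H01 by (fastforce simp: even_pair_def)
  have "D b (map J (rev (map snd (xs @ u # v # ys)))) = comm_sign k' k * D b (map J (rev (map snd (xs @ v # u # ys))))" for b
  proof -
    have "graded_sym H (D b)" using D by (simp add: slam_iff[OF sh])
    from graded_symD[OF sh this set set J_parity[OF sh v(2)] J_parity[OF sh u(2)], of ys xs]
    show ?thesis using assms by simp
  qed
  then show ?thesis
    unfolding word_val_def g grass_mult_cmult_left grass_mult_cmult_right
    by (simp add: grass_mult_cmult_right comm_sign_commute[of k' k] flip: mult.assoc)
qed

lemma msum_word_val_zero:
  assumes "set Ls \<subseteq> real_lists"
  shows "msum (word_val ls) Ls = 0"
proof (rule polarization[where V = real_lists and add = "(@)" and sc = "\<lambda>t. map (scl (complex_of_real t))"])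
  show "msum (word_val ls) (As @ (L @ L') # Bs) = msum (word_val ls) (As @ L # Bs) + msum (word_val ls) (As @ L' # Bs)" for As L L' Bs
    by (rule msum_add)
  show "msum (word_val ls) (As @ map (scl (complex_of_real t)) L # Bs) = complex_of_real t * msum (word_val ls) (As @ L # Bs)" for As t L Bs
    by (rule msum_scale) (rule word_val_scl)
  show "msum (word_val ls) (As @ L # L' # Bs) = msum (word_val ls) (As @ L' # L # Bs)"
    if "set (As @ L # L' # Bs) \<subseteq> real_lists" for As L L' Bs
    by (rule msum_swap[where A = "Collect even_pair"], rule word_val_swap, assumption)
      (use that in \<open>force simp: real_lists_def\<close>)
  show "msum (word_val ls) (replicate (length Ls) L) = 0" if "L \<in> real_lists" for L
    by (rule word_val_diag[OF that])
  \<comment> \<open>Any even pair yields a real list; \<open>hpart\<close> supplies an element of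
    \<open>H 0\<close>.\<close>
  have "even_pair (vac, hpart H 0 0)" using vac_grass_part hpart_in[OF sh, of 0 0] by (auto simp: even_pair_def)
  from real_lists_pair[OF this] show "real_lists \<noteq> {}" by blast
qed (use assms real_lists_append real_lists_scl in auto)

text \<open>
  Real formal sums are enough: \<open>2 u\<close> is the complex combination of the real sums
  \<open>u + u\<^sup>*\<close> and \<open>\<i>u + (\<i>u)\<^sup>*\<close>.
\<close>

lemma word_val_zero:
  assumes "set us \<subseteq> Collect even_pair"
  shows "word_val ls us = 0"
proof -
  have "msum (word_val ls) (map (\<lambda>u. [u]) us @ Ls) = 0" if "set us \<subseteq> Collect even_pair" "set Ls \<subseteq> real_lists" for us Ls
    using that
  proof (induction us arbitrary: Ls rule: rev_induct)
    case Nil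
    then show ?case using msum_word_val_zero by simp
  next
    case (snoc u us)
    let ?M = "\<lambda>L. msum (word_val ls) (map (\<lambda>u. [u]) us @ L # Ls)"
    have u: "even_pair u" using snoc by simp
    have iu: "even_pair (scl \<i> u)" by (rule even_pair_scl[OF u])
    have split: "?M [a, b] = ?M [a] + ?M [b]" for a b
      using msum_add[of "word_val ls" "map (\<lambda>u. [u]) us" "[a]" "[b]" Ls] by simp
    have scl: "?M [scl c a] = c * ?M [a]" for c a
      using msum_scale[of "word_val ls" "scl c" c "map (\<lambda>u. [u]) us" "[a]" Ls] word_val_scl by simp
    have "?M [u, pstar u] = 0" "?M [scl \<i> u, pstar (scl \<i> u)] = 0"
      using snoc real_lists_pair[OF u] real_lists_pair[OF iu] by auto
    \<comment> \<open>The conjugate of i is its negative, so the two relations are independent and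
      both values vanish.\<close>
    then have "?M [u] + ?M [pstar u] = 0" "\<i> * ?M [u] + cnj \<i> * ?M [pstar u] = 0"
      by (simp_all only: split pstar_scl[OF u] scl)
    then have "?M [u] = 0" by (simp add: algebra_simps)
    then show ?case by simp
  qed
  from this[of us "[]"] assms show ?thesis by (simp add: msum_singletons)
qed

lemma slam_zero:
  assumes inf: "infinite (onb :: 'l set)"
  shows "D ls hs = 0"
proof -
  have homog0: "D ls hs = 0" if ls: "ls \<in> lists onb" and hs: "homog H ks hs" for ls ks hs
  proof (rule generators_cancel[OF inf _ ls, of "\<lambda>ls. D ls hs" "rev ks"])
    show "skew (\<lambda>ls. D ls hs)" using D by (simp add: slam_iff[OF sh])
    fix ms :: "('l list \<Rightarrow> complex) list" and ls
    assume ms: "list_all2 (\<lambda>m k. m \<in> generators k) ms (rev ks)" and ls: "ls \<in> lists (onb :: 'l set)"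
    \<comment> \<open>The vectors are chosen so that the reversal and \<open>J\<close> in
      \<open>word_val\<close> return \<open>hs\<close>.\<close>
    let ?us = "zip ms (map J (rev hs))"
    have len: "length ms = length hs"
      using list_all2_lengthD[OF ms] homog_length[OF sh hs] by simp
    have "set ?us \<subseteq> Collect even_pair"
    proof
      fix u assume "u \<in> set ?us"
      then obtain i where i: "i < length ms" "u = (ms ! i, J (rev hs ! i))"
        using len by (auto simp: set_zip)
      have "ms ! i \<in> generators (rev ks ! i)" using ms i by (simp add: list_all2_conv_all_nth)
      moreover have "rev hs ! i \<in> H (rev ks ! i)"
        using hs i len unfolding homog_def[OF sh]
        by (simp add: list_all2_conv_all_nth rev_nth)
      ultimately show "u \<in> Collect even_pair"
        unfolding even_pair_def mem_Collect_eq i(2)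
        by (intro exI[of _ "rev ks ! i"]) (simp add: generators_grass_part J_parity[OF sh])
    qed
    from word_val_zero[OF this, of ls]
    show "grass_mult (gprod ms) (\<lambda>ls. D ls hs) ls = 0"
      using len by (simp add: word_val_def rev_map o_def J_J[OF J_antiunitary[OF sh]])
  qed
  have basis0: "D ls hs = 0" if ls: "ls \<in> lists onb" for ls hs
  proof -
    have "D ls ([] @ hs) = (\<Sum>ks | length ks = length hs. D ls ([] @ map2 (hpart H) ks hs))"
      using D by (intro sum_hparts[OF sh, symmetric]) (simp add: slam_iff[OF sh])
    also have "\<dots> = 0"
      by (rule sum.neutral) (use homog0[OF ls homog_hparts[OF sh]] in auto)
    finally show ?thesis by simp
  qed
  \<comment> \<open>Vanishing on basis words extends to all Grassmann arguments through
    \<open>bform_bound\<close>.\<close>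
  have "infsum (\<lambda>ls. sqn (D ls hs)) (tuples onb (length ls)) = 0"
    by (rule infsum_0) (use basis0 in \<open>auto simp: tuples_def sqn_def\<close>)
  then have "sqn (D ls hs) \<le> 0"
    using bform_bound[OF is_onb_onb slam_bform_left[OF sh D], of ls hs] by simp
  then show ?thesis by (simp add: sqn_def)
qed

end

lemma upsilon_inj:
  assumes inf: "infinite (onb :: 'l set)"
  shows "inj_on (upsilon H J s) (slam H)"
proof (rule inj_onI)
  fix X Y :: "('l, 'h) sform"
  assume X: "X \<in> slam H" and Y: "Y \<in> slam H" and eq: "upsilon H J s X = upsilon H J s Y"
  let ?D = "\<lambda>ls hs. X ls hs + - 1 * Y ls hs"
  have mY: "(\<lambda>ls hs. - 1 * Y ls hs) \<in> slam H" by (rule slam_cmult[OF sh Y])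
  have D: "?D \<in> slam H" by (rule slam_add[OF sh X mY])
  have "slam_pair J (slam_exp H z) ?D ls = 0" if z: "z \<in> h_lam_diag H J s" for z ls
  proof -
    have zl: "z \<in> h_lam H" using z by (simp add: h_lam_diag_def)
    note l2 = fock_l2form[OF sh slam_fock[OF sh]]
    have "slam_pair J (slam_exp H z) ?D ls = slam_pair J (slam_exp H z) X ls + - 1 * slam_pair J (slam_exp H z) Y ls"
      unfolding slam_pair_gpair
        fock_pair_add_right[OF J_antiunitary[OF sh] l2[OF slam_exp_slam[OF sh zl]] l2[OF X] l2[OF mY]]
        fock_pair_cmult_right gpair_add gpair_cmult ..
    also have "slam_pair J (slam_exp H z) X = slam_pair J (slam_exp H z) Y"
      using fun_cong[OF eq, of z] z by (simp add: upsilon_def)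
    finally show ?thesis by simp
  qed
  from slam_zero[OF D this inf] have "?D ls hs = 0" for ls hs .
  then show "X = Y" by (simp add: fun_eq_iff)
qed

end

section \<open>The kernel of an operator\<close>

lemma slam_pair_transposed:
  fixes X Y :: "('l::complex_hilbert, 'h::complex_hilbert) sform"
  assumes sh: "super_hilbert H E J" and T: "linear_on_fock H T" and tr: "is_transposed H J T T'"
    and X: "X \<in> slam H" and Y: "Y \<in> slam H"
  shows "slam_pair J (lam_ext T' X) Y = slam_pair J X (lam_ext T Y)"
    and "slam_pair J (lam_ext T X) Y = slam_pair J X (lam_ext T' Y)"
proof -
  have eq: "\<And>F G. F \<in> fock H \<Longrightarrow> G \<in> fock H \<Longrightarrow> fock_pair J (T' F) G = fock_pair J F (T G)"
    and T': "\<And>F. F \<in> fock H \<Longrightarrow> T' F \<in> fock H" and T: "\<And>F. F \<in> fock H \<Longrightarrow> T F \<in> fock H"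
    using tr T by (auto simp: is_transposed_def linear_on_fock_def)
  note XF = slam_fock[OF sh X] and YF = slam_fock[OF sh Y]
  have comm: "fock_pair J F G = fock_pair J G F" if "F \<in> fock H" "G \<in> fock H" for F G
    by (intro fock_pair_commute[OF J_antiunitary[OF sh]] fock_l2form[OF sh] that)
  show "slam_pair J (lam_ext T' X) Y = slam_pair J X (lam_ext T Y)"
    unfolding slam_pair_gpair lam_ext_def by (simp only: eq[OF XF YF])
  \<comment> \<open>\<open>is_transposed\<close> moves an operator from the left argument to the
    right with \<open>T'\<close> on the left; for \<open>T\<close> on the left the pairing is turned
    around twice.\<close>
  have "fock_pair J (T (X a)) (Y b) = fock_pair J (X a) (T' (Y b))" for a b
    using comm[OF T[OF XF] YF] eq[OF YF XF] comm[OF T'[OF YF] XF] by simp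
  then show "slam_pair J (lam_ext T X) Y = slam_pair J X (lam_ext T' Y)"
    unfolding slam_pair_gpair lam_ext_def by (simp only:)
qed

text \<open>Membership of the kernel in \<open>fun_space\<close> is asserted because
  \<open>fun_pair\<close> applies \<open>upsilon_inv\<close>, which is an inverse only on that
  image.\<close>

theorem proposition1:
  fixes H E :: "bit \<Rightarrow> 'h::{complex_hilbert, second_countable_topology} set"
    and J :: "'h \<Rightarrow> 'h"
    and s :: "('l::{complex_hilbert, second_countable_topology} list \<Rightarrow> complex) \<Rightarrow> ('l list \<Rightarrow> complex)"
    and T T' :: "('h list \<Rightarrow> complex) \<Rightarrow> ('h list \<Rightarrow> complex)"
  assumes "super_hilbert H E J"
    and "infinite_dimensional TYPE('l)"
    and "grass_involution s"
    and "linear_on_fock H T"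
    and "is_transposed H J T T'"
  shows "(\<forall>\<phi>\<in>fun_space H J s. \<forall>\<eta>\<in>h_lam_diag H J s.
            (\<lambda>\<zeta>\<in>h_lam_diag H J s. op_kernel H J T \<zeta> \<eta>) \<in> fun_space H J s \<and>
            fun_rep H J s T \<phi> \<eta> =
              fun_pair H J s (\<lambda>\<zeta>\<in>h_lam_diag H J s. op_kernel H J T \<zeta> \<eta>) \<phi>)
       \<and> (\<forall>\<zeta>\<^sub>1\<in>h_lam_diag H J s. \<forall>\<zeta>\<^sub>2\<in>h_lam_diag H J s.
            op_kernel H J T \<zeta>\<^sub>1 \<zeta>\<^sub>2 \<in> grass \<and>
            op_kernel H J T \<zeta>\<^sub>1 \<zeta>\<^sub>2 =
              slam_pair J (slam_exp H \<zeta>\<^sub>1) (lam_ext T' (slam_exp H \<zeta>\<^sub>2)) \<and>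
            op_kernel H J T \<zeta>\<^sub>1 \<zeta>\<^sub>2 =
              slam_sesq J s (slam_exp H \<zeta>\<^sub>1) (lam_ext T' (slam_exp H \<zeta>\<^sub>2)))"
proof -
  note sh = assms(1) and s = assms(3) and T = assms(4) and tr = assms(5)
  have TF: "T \<in> fock H \<rightarrow> fock H" using T by (simp add: linear_on_fock_def)
  obtain C where C: "\<And>F. F \<in> fock H \<Longrightarrow> l2norm (T' F) \<le> C * l2norm F"
    using transposed_bounded[OF sh TF tr] by blast
  have exp: "slam_exp H z \<in> slam H" if "z \<in> h_lam_diag H J s" for z :: "('l, 'h) sform"
    by (rule slam_exp_slam[OF sh]) (use that in \<open>simp add: h_lam_diag_def\<close>)
  have T'exp: "lam_ext T' (slam_exp H z) \<in> slam H" if "z \<in> h_lam_diag H J s" for z :: "('l, 'h) sform"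
    by (rule lam_ext_slam[OF sh transposed_linear[OF sh TF tr] C exp[OF that]])
  have kernel: "op_kernel H J T z z' = slam_pair J (slam_exp H z) (lam_ext T' (slam_exp H z'))"
    if "z \<in> h_lam_diag H J s" "z' \<in> h_lam_diag H J s" for z z' :: "('l, 'h) sform"
    unfolding op_kernel_def by (rule slam_pair_transposed(2)[OF sh T tr exp exp]) (use that in auto)
  \<comment> \<open>This exhibits the preimage of the kernel under \<open>upsilon\<close>, which
    lies in \<open>slam H\<close> by the bound on \<open>T'\<close>, so that \<open>fun_pair\<close>
    can be computed.\<close>
  have kernel_fun: "(\<lambda>z\<in>h_lam_diag H J s. op_kernel H J T z z') = upsilon H J s (lam_ext T' (slam_exp H z'))"
    if "z' \<in> h_lam_diag H J s" for z' :: "('l, 'h) sform"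
    unfolding upsilon_def using kernel[OF _ that] by (intro restrict_ext)
  have inv: "upsilon_inv H J s (upsilon H J s X) = X" if "X \<in> slam H" for X :: "('l, 'h) sform"
    unfolding upsilon_inv_def by (rule the_inv_into_f_f[OF upsilon_inj[OF sh s infinite_onb[OF assms(2)]] that])
  show ?thesis
  proof (intro conjI ballI)
    fix \<phi> and \<eta> :: "('l, 'h) sform"
    assume \<phi>: "\<phi> \<in> fun_space H J s" and \<eta>: "\<eta> \<in> h_lam_diag H J s"
    obtain X where X: "X \<in> slam H" "\<phi> = upsilon H J s X" using \<phi> by (auto simp: fun_space_def)
    show "(\<lambda>\<zeta>\<in>h_lam_diag H J s. op_kernel H J T \<zeta> \<eta>) \<in> fun_space H J s"
      unfolding kernel_fun[OF \<eta>] fun_space_def by (intro imageI T'exp \<eta>)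
    show "fun_rep H J s T \<phi> \<eta> = fun_pair H J s (\<lambda>\<zeta>\<in>h_lam_diag H J s. op_kernel H J T \<zeta> \<eta>) \<phi>"
      unfolding kernel_fun[OF \<eta>] fun_rep_def fun_pair_def X(2) inv[OF X(1)] inv[OF T'exp[OF \<eta>]]
      using slam_pair_transposed(1)[OF sh T tr exp[OF \<eta>] X(1)] \<eta> by (simp add: upsilon_def)
  next
    fix \<zeta>\<^sub>1 \<zeta>\<^sub>2 :: "('l, 'h) sform"
    assume z: "\<zeta>\<^sub>1 \<in> h_lam_diag H J s" "\<zeta>\<^sub>2 \<in> h_lam_diag H J s"
    show "op_kernel H J T \<zeta>\<^sub>1 \<zeta>\<^sub>2 = slam_pair J (slam_exp H \<zeta>\<^sub>1) (lam_ext T' (slam_exp H \<zeta>\<^sub>2))"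
      by (rule kernel[OF z])
    then show "op_kernel H J T \<zeta>\<^sub>1 \<zeta>\<^sub>2 \<in> grass"
      using slam_pair_grass[OF sh exp[OF z(1)] T'exp[OF z(2)]] by simp
    show "op_kernel H J T \<zeta>\<^sub>1 \<zeta>\<^sub>2 = slam_sesq J s (slam_exp H \<zeta>\<^sub>1) (lam_ext T' (slam_exp H \<zeta>\<^sub>2))"
      unfolding slam_sesq_def slam_star_exp[OF sh s z(1)] by (rule kernel[OF z])
  qed
qed

end
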